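(* If $D$ is a symmetric union link diagram with $n$ components, then $W_D(s,\xi)=(-s^{1/2}-s^{-1/2})^{n-1}$ for each $\xi\in\{1,\pm i,e^{\pm2i\pi/3}\}$, and $\frac{\partial W_D}{\partial t}(s,1)=0$. In other words, $W_D-(-s^{1/2}-s^{-1/2})^{n-1}$ is divisible by $(t-1)^2(t^2+1)(t^2+t+1)$.
   Context: Diagrams: we consider planar link diagrams in $\mathbb{R}^2$ transverse to the axis $\{0\}\times\mathbb{R}$; crossings may lie on the axis. Let $\rho(x,y)=(-x,y)$. A diagram is symmetric if $\rho(D)=D$ (including over/under information) except for crossings on the axis, which are necessarily reversed by $\rho$. A symmetric union is a symmetric diagram such that each component is mapped to itself by $\rho$ with reversed orientation; equivalently each component perpendicularly traverses the axis in exactly two points that are not crossings. Crossings on the axis: such a crossing has two ends on the left and two on the right. It is of type $X_o$ if the overstrand runs from upper left to lower right, $X_u$ if it runs from lower left to upper right. The horizontal smoothing $h$ joins upper left to upper right and lower left to lower right; the vertical smoothing $v$ joins the two left ends to each other and the two right ends to each other (without meeting the axis). $W$: the bracket $\langle D\rangle\in\mathbb{Z}(A,B)$ is defined (forgetting orientations) by: (A) for a crossing off the axis, $\langle D\rangle=A\langle D_A\rangle+A^{-1}\langle D_B\rangle$, where $D_A$ is the smoothing joining the two regions swept out when the overstrand is turned counterclockwise to the understrand, $D_B$ the other smoothing; (B) on the axis, $\langle X_o\rangle=B\langle h\rangle+B^{-1}\langle v\rangle$ and $\langle X_u\rangle=B^{-1}\langle h\rangle+B\langle v\rangle$; (C)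 for $n$ disjoint circles without crossings meeting the axis in $2m$ points, $\langle C\rangle=(-A^2-A^{-2})^{n-m}(-B^2-B^{-2})^{m-1}$. For oriented $D$ let $\alpha(D)$ (resp. $\beta(D)$) be the sum of crossing signs off (resp. on) the axis, and $W_D=W_D(s,t)=\langle D\rangle(-A^{-3})^{\alpha(D)}(-B^{-3})^{\beta(D)}$, rewritten via $A^2=t^{-1/2}$, $B^2=s^{-1/2}$. For symmetric unions with $n$ components, $W_D$ does not depend on the chosen orientations and lies in $\mathbb{Z}[s^{\pm1},t^{\pm1}]\cdot(s^{1/2}+s^{-1/2})^{n-1}$, so evaluation at $t=\xi$ makes sense. *)

theory Defs
  imports
    Complex_Main
    "HOL-Combinatorics.Combinatorics"
    "HOL-Computational_Algebra.Computational_Algebra"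
    "HOL-Library.Poly_Mapping"
    "HOL-Library.Product_Plus"
begin

section \<open>Link diagrams with an axis\<close>

text \<open>
  Diagrams are considered up to planar isotopy respecting the axis, and are encoded, as usual for
  plane graphs, by combinatorial maps of genus 0.  A diagram together with the axis
  \<open>{0} \<times> \<real>\<close>, closed up by a point at infinity, is a graph on the sphere.  Its vertices are

    \<^item> the crossings off the axis (valency 4),
    \<^item> the points that are not crossings and where the link traverses the axis (valency 4:
      two half-edges of the axis, two of the link),
    \<^item> the crossings on the axis (valency 6: two half-edges of the axis, four of the link, two on
      either side by transversality).

  The data are the half-edges (darts), the permutation \<open>rot\<close> sending a dart to the next one
  counterclockwise around its vertex, the involution \<open>edge\<close> exchanging the two halves of an edge,
  the darts lying on the axis, and the darts belonging to the overstrands at crossings.  A dart is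
  thought of as pointing away from its vertex.  The edge of the axis that contains the point at
  infinity is not recorded: neither the crossing types \<open>X\<^sub>o\<close>, \<open>X\<^sub>u\<close> nor the smoothings
  \<open>h\<close>, \<open>v\<close> change when up and down are exchanged by a rotation by \<open>\<pi>\<close>.
\<close>

record 'd axial_diagram =
  darts :: "'d set"
  rot :: "'d \<Rightarrow> 'd"
  edge :: "'d \<Rightarrow> 'd"
  axis :: "'d set"
  over :: "'d set"

definition vertex :: "'d axial_diagram \<Rightarrow> 'd \<Rightarrow> 'd set" where
  "vertex D d = orbit (rot D) d"

definition vertices :: "'d axial_diagram \<Rightarrow> 'd set set" where
  "vertices D = vertex D ` darts D"

definition edges :: "'d axial_diagram \<Rightarrow> 'd set set" where
  "edges D = (\<lambda>d. {d, edge D d}) ` darts D"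

text \<open>The next dart along the boundary of the region to the right of \<open>d\<close> is \<open>rot (edge d)\<close>.\<close>

definition faces :: "'d axial_diagram \<Rightarrow> 'd set set" where
  "faces D = orbit (rot D \<circ> edge D) ` darts D"

definition link :: "'d axial_diagram \<Rightarrow> 'd set" where
  "link D = darts D - axis D"

text \<open>All valencies are even; a strand entering a vertex leaves it through the opposite dart.\<close>

definition opp :: "'d axial_diagram \<Rightarrow> 'd \<Rightarrow> 'd" where
  "opp D d = (rot D ^^ (card (vertex D d) div 2)) d"

definition off_crossings :: "'d axial_diagram \<Rightarrow> 'd set set" where
  "off_crossings D = {v \<in> vertices D. card v = 4 \<and> card (v \<inter> axis D) = 0}"

definition axis_points :: "'d axial_diagram \<Rightarrow> 'd set set" where
  "axis_points D = {v \<in> vertices D. card v = 4 \<and> card (v \<inter> axis D) = 2}"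

definition axis_crossings :: "'d axial_diagram \<Rightarrow> 'd set set" where
  "axis_crossings D = {v \<in> vertices D. card v = 6 \<and> card (v \<inter> axis D) = 2}"

definition crossings :: "'d axial_diagram \<Rightarrow> 'd set set" where
  "crossings D = off_crossings D \<union> axis_crossings D"

text \<open>
  The unoriented closed curves obtained from the darts in \<open>X\<close> by connecting, at each vertex, the
  end \<open>d\<close> with the end \<open>j d\<close>.
\<close>

definition curves :: "'d axial_diagram \<Rightarrow> ('d \<Rightarrow> 'd) \<Rightarrow> 'd set \<Rightarrow> 'd set set" where
  "curves D j X = X // ({(d, edge D d) |d. d \<in> X} \<union> {(d, j d) |d. d \<in> X})\<^sup>*"

definition components :: "'d axial_diagram \<Rightarrow> nat" where
  "components D = card (curves D (opp D) (link D))"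

text \<open>
  Genus 0 is expressed by Euler's formula.  The union of the link diagram and the axis is required
  to be connected; this holds for every symmetric union, since each component meets the axis.
\<close>

definition diagram :: "'d axial_diagram \<Rightarrow> bool" where
  "diagram D \<longleftrightarrow>
     finite (darts D) \<and>
     rot D permutes darts D \<and>
     edge D permutes darts D \<and>
     (\<forall>d\<in>darts D. edge D d \<noteq> d \<and> edge D (edge D d) = d) \<and>
     \<comment> \<open>planarity\<close>
     (\<forall>d\<in>darts D. \<forall>e\<in>darts D.
        (d, e) \<in> ({(x, rot D x) |x. x \<in> darts D} \<union> {(x, edge D x) |x. x \<in> darts D})\<^sup>*) \<and>
     card (vertices D) + card (faces D) = card (edges D) + 2 \<and>
     \<comment> \<open>the axis is one closed curve through infinity\<close>
     axis D \<subseteq> darts D \<and>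
     (\<forall>a\<in>axis D. edge D a \<in> axis D \<and> opp D a \<in> axis D) \<and>
     card (curves D (opp D) (axis D)) = 1 \<and>
     vertices D = off_crossings D \<union> axis_points D \<union> axis_crossings D \<and>
     \<comment> \<open>at each crossing exactly one of the two strands is the overstrand\<close>
     over D \<subseteq> link D \<inter> \<Union> (crossings D) \<and>
     (\<forall>d \<in> link D \<inter> \<Union> (crossings D). opp D d \<in> over D \<longleftrightarrow> d \<in> over D) \<and>
     (\<forall>v \<in> off_crossings D. \<forall>d\<in>v. rot D d \<in> over D \<longleftrightarrow> d \<notin> over D) \<and>
     (\<forall>v \<in> axis_crossings D. \<forall>a \<in> v \<inter> axis D.
        rot D (rot D a) \<in> over D \<longleftrightarrow> rot D a \<notin> over D)"

section \<open>Symmetric unions\<close>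

text \<open>
  The reflection \<open>\<rho>(x,y) = (-x,y)\<close> acts on darts as an orientation-reversing involution of the map
  fixing the axis.
\<close>

definition axial_reflection :: "'d axial_diagram \<Rightarrow> ('d \<Rightarrow> 'd) \<Rightarrow> bool" where
  "axial_reflection D \<rho> \<longleftrightarrow>
     \<rho> permutes darts D \<and>
     (\<forall>d\<in>darts D. \<rho> (\<rho> d) = d \<and> edge D (\<rho> d) = \<rho> (edge D d) \<and> rot D (\<rho> (rot D d)) = \<rho> d) \<and>
     (\<forall>a\<in>axis D. \<rho> a = a)"

text \<open>
  Nothing is required at the crossings on the axis: there \<open>\<rho>\<close> exchanges the two strands, whence the
  crossing is automatically reversed.
\<close>

definition symmetric_by :: "'d axial_diagram \<Rightarrow> ('d \<Rightarrow> 'd) \<Rightarrow> bool" where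
  "symmetric_by D \<rho> \<longleftrightarrow>
     diagram D \<and> axial_reflection D \<rho> \<and>
     (\<forall>v\<in>off_crossings D. \<forall>d\<in>v. \<rho> d \<in> over D \<longleftrightarrow> d \<in> over D)"

text \<open>
  Starting along the dart \<open>d\<close> and following the strand, one successively leaves the vertices along
  the darts in the orbit of \<open>d\<close> under \<open>travel\<close>.  The orbit of \<open>edge d\<close> is the same component
  with the opposite orientation.
\<close>

definition travel :: "'d axial_diagram \<Rightarrow> 'd \<Rightarrow> 'd" where
  "travel D d = opp D (edge D d)"

definition symmetric_union :: "'d axial_diagram \<Rightarrow> bool" where
  "symmetric_union D \<longleftrightarrow>
     (\<exists>\<rho>. symmetric_by D \<rho> \<and> (\<forall>d\<in>link D. \<rho> d \<in> orbit (travel D) (edge D d)))"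

section \<open>The bracket\<close>

text \<open>
  With \<open>a\<close> the upward axis dart at a crossing on the axis, \<open>rot a\<close> is the upper left end; for the
  downward one it is the lower right end.
\<close>

definition X_o :: "'d axial_diagram \<Rightarrow> 'd set \<Rightarrow> bool" where
  "X_o D v \<longleftrightarrow> (\<exists>a \<in> v \<inter> axis D. rot D a \<in> over D)"

text \<open>
  Turning the over-half-strand \<open>d\<close> counterclockwise to the understrand sweeps out the region between
  \<open>d\<close> and \<open>rot d\<close>.  Joining this region to the opposite one connects \<open>d\<close> to its clockwise
  neighbour.
\<close>

definition smooth_A :: "'d axial_diagram \<Rightarrow> 'd \<Rightarrow> 'd" where
  "smooth_A D d = (if d \<in> over D then inv (rot D) d else rot D d)"

definition smooth_B :: "'d axial_diagram \<Rightarrow> 'd \<Rightarrow> 'd" where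
  "smooth_B D d = (if d \<in> over D then rot D d else inv (rot D) d)"

text \<open>
  At a crossing on the axis every link dart is adjacent to one axis dart.  The smoothing \<open>h\<close>
  connects it with the link dart on the other side of that axis dart, \<open>v\<close> with the one on the
  same side of the axis.
\<close>

definition smooth_h :: "'d axial_diagram \<Rightarrow> 'd \<Rightarrow> 'd" where
  "smooth_h D d = (if rot D d \<in> axis D then rot D (rot D d) else inv (rot D) (inv (rot D) d))"

definition smooth_v :: "'d axial_diagram \<Rightarrow> 'd \<Rightarrow> 'd" where
  "smooth_v D d = (if rot D d \<in> axis D then inv (rot D) d else rot D d)"

text \<open>
  The state given by \<open>S \<subseteq> crossings D\<close> has the smoothing \<open>A\<close> resp. \<open>h\<close> at the crossings in \<open>S\<close>,
  and \<open>B\<close> resp. \<open>v\<close> at the others.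
\<close>

definition smoothing :: "'d axial_diagram \<Rightarrow> 'd set set \<Rightarrow> 'd \<Rightarrow> 'd" where
  "smoothing D S d =
    (let v = vertex D d in
      if v \<in> off_crossings D then (if v \<in> S then smooth_A D d else smooth_B D d)
      else if v \<in> axis_crossings D then (if v \<in> S then smooth_h D d else smooth_v D d)
      else opp D d)"

definition state_circles :: "'d axial_diagram \<Rightarrow> 'd set set \<Rightarrow> nat" where
  "state_circles D S = card (curves D (smoothing D S) (link D))"

text \<open>
  The number \<open>m\<close> where the state meets the axis in \<open>2 m\<close> points: each smoothing \<open>h\<close> contributes two.
\<close>

definition state_axis_pairs :: "'d axial_diagram \<Rightarrow> 'd set set \<Rightarrow> nat" where
  "state_axis_pairs D S = (card (axis_points D) + 2 * card (S \<inter> axis_crossings D)) div 2"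

definition circles_value :: "'d axial_diagram \<Rightarrow> 'a \<Rightarrow> 'a \<Rightarrow> 'd set set \<Rightarrow> 'a::field" where
  "circles_value D A B S =
     (- (A powi 2) - A powi (-2)) powi (int (state_circles D S) - int (state_axis_pairs D S)) *
     (- (B powi 2) - B powi (-2)) powi (int (state_axis_pairs D S) - 1)"

definition weight_in :: "'d axial_diagram \<Rightarrow> 'a \<Rightarrow> 'a \<Rightarrow> 'd set \<Rightarrow> 'a::field" where
  "weight_in D A B v =
     (if v \<in> off_crossings D then A else if X_o D v then B else inverse B)"

definition weight_out :: "'d axial_diagram \<Rightarrow> 'a \<Rightarrow> 'a \<Rightarrow> 'd set \<Rightarrow> 'a::field" where
  "weight_out D A B v =
     (if v \<in> off_crossings D then inverse A else if X_o D v then inverse B else B)"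

text \<open>
  The bracket of the diagram with crossings \<open>U\<close> that arises from \<open>D\<close> when the other crossings are
  smoothed according to \<open>S\<close>; the next two lemmas are the
  rules for circles without crossings and for smoothing a crossing \<open>c\<close>.
\<close>

definition partial_bracket ::
    "'d axial_diagram \<Rightarrow> 'a \<Rightarrow> 'a \<Rightarrow> 'd set set \<Rightarrow> 'd set set \<Rightarrow> 'a::field" where
  "partial_bracket D A B U S =
     (\<Sum>T\<in>Pow U. (\<Prod>v\<in>T. weight_in D A B v) * (\<Prod>v\<in>U - T. weight_out D A B v) *
        circles_value D A B (S \<union> T))"

lemma partial_bracket_circles:
  "partial_bracket D A B {} S = circles_value D A B S"
  by (simp add: partial_bracket_def)

lemma partial_bracket_crossing:
  assumes "finite U" "c \<notin> U"
  shows "partial_bracket D A B (insert c U) S =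
    weight_in D A B c * partial_bracket D A B U (insert c S) +
    weight_out D A B c * partial_bracket D A B U S"
proof -
  have inj: "inj_on (insert c) (Pow U)"
    using assms(2) by (auto simp: inj_on_def)
  have disj: "Pow U \<inter> insert c ` Pow U = {}" using assms(2) by auto
  have 1: "(\<Prod>v\<in>insert c T. weight_in D A B v) * (\<Prod>v\<in>insert c U - insert c T. weight_out D A B v) *
        circles_value D A B (S \<union> insert c T) =
      weight_in D A B c * ((\<Prod>v\<in>T. weight_in D A B v) * (\<Prod>v\<in>U - T. weight_out D A B v) *
        circles_value D A B (insert c S \<union> T))" if "T \<in> Pow U" for T
  proof -
    have "insert c U - insert c T = U - T" "c \<notin> T" "finite T"
      using that assms by (auto dest: finite_subset)
    then show ?thesis by (simp add: mult.assoc)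
  qed
  have 2: "(\<Prod>v\<in>T. weight_in D A B v) * (\<Prod>v\<in>insert c U - T. weight_out D A B v) *
        circles_value D A B (S \<union> T) =
      weight_out D A B c * ((\<Prod>v\<in>T. weight_in D A B v) * (\<Prod>v\<in>U - T. weight_out D A B v) *
        circles_value D A B (S \<union> T))" if "T \<in> Pow U" for T
  proof -
    have "insert c U - T = insert c (U - T)" "c \<notin> U - T" "finite (U - T)"
      using that assms by auto
    then show ?thesis by (simp add: mult_ac)
  qed
  let ?f = "\<lambda>U S T. (\<Prod>v\<in>T. weight_in D A B v) * (\<Prod>v\<in>U - T. weight_out D A B v) *
        circles_value D A B (S \<union> T)"
  have "partial_bracket D A B (insert c U) S =
      sum (?f (insert c U) S) (Pow U) + sum (?f (insert c U) S) (insert c ` Pow U)"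
    unfolding partial_bracket_def Pow_insert
    by (rule sum.union_disjoint) (use assms disj in auto)
  also have "sum (?f (insert c U) S) (insert c ` Pow U) =
      (\<Sum>T\<in>Pow U. weight_in D A B c * ?f U (insert c S) T)"
    unfolding sum.reindex[OF inj] by (rule sum.cong[OF refl]) (use 1 in simp)
  also have "sum (?f (insert c U) S) (Pow U) = (\<Sum>T\<in>Pow U. weight_out D A B c * ?f U S T)"
    by (rule sum.cong[OF refl 2])
  finally show ?thesis
    by (simp add: partial_bracket_def sum_distrib_left add.commute)
qed

definition bracket :: "'d axial_diagram \<Rightarrow> 'a \<Rightarrow> 'a \<Rightarrow> 'a::field" where
  "bracket D A B = partial_bracket D A B (crossings D) {}"

section \<open>The W-polynomial\<close>

text \<open>An orientation is given by the darts along which a strand leaves a vertex.\<close>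

definition orientation :: "'d axial_diagram \<Rightarrow> 'd set \<Rightarrow> bool" where
  "orientation D Or \<longleftrightarrow>
     Or \<subseteq> link D \<and>
     (\<forall>d\<in>link D. edge D d \<in> Or \<longleftrightarrow> d \<notin> Or) \<and>
     (\<forall>d\<in>Or. travel D d \<in> Or)"

definition next_link :: "'d axial_diagram \<Rightarrow> 'd \<Rightarrow> 'd" where
  "next_link D d = (if rot D d \<in> axis D then rot D (rot D d) else rot D d)"

text \<open>A crossing is positive iff the outgoing understrand follows counterclockwise on the outgoing
  overstrand.\<close>

definition crossing_sign :: "'d axial_diagram \<Rightarrow> 'd set \<Rightarrow> 'd set \<Rightarrow> int" where
  "crossing_sign D Or v = (if \<exists>d \<in> v \<inter> over D \<inter> Or. next_link D d \<in> Or then 1 else -1)"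

definition W :: "'d axial_diagram \<Rightarrow> 'd set \<Rightarrow> 'a \<Rightarrow> 'a \<Rightarrow> 'a::field" where
  "W D Or A B = bracket D A B *
     (- (A powi (-3))) powi (\<Sum>v\<in>off_crossings D. crossing_sign D Or v) *
     (- (B powi (-3))) powi (\<Sum>v\<in>axis_crossings D. crossing_sign D Or v)"

text \<open>
  \<open>W\<close> is defined for arguments in an arbitrary field: for the two indeterminates of
  \<open>\<int>(A,B)\<close> it is the formal invariant, for complex arguments its value.  (Negative powers of
  \<open>-A\<^sup>2 - A\<^sup>-\<^sup>2\<close> occur, so values are meaningful for \<open>A\<^sup>4 \<noteq> -1\<close>, that is, for \<open>t \<noteq> -1\<close>.)
\<close>

type_synonym ratfun = "int poly poly fract"

definition var_A :: ratfun where "var_A = to_fract [:[:0, 1:]:]"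
definition var_B :: ratfun where "var_B = to_fract [:0, 1:]"

text \<open>
  The ring \<open>\<int>[s\<^sup>\<plusminus>\<^sup>1\<^sup>/\<^sup>2, t\<^sup>\<plusminus>\<^sup>1]\<close>: the coefficient at \<open>(i, j)\<close> is that of \<open>(s\<^sup>1\<^sup>/\<^sup>2)\<^sup>i t\<^sup>j\<close>.
\<close>

type_synonym laurent = "(int \<times> int) \<Rightarrow>\<^sub>0 int"

definition sqrt_s :: laurent where "sqrt_s = Poly_Mapping.single (1, 0) 1"
definition inv_sqrt_s :: laurent where "inv_sqrt_s = Poly_Mapping.single (-1, 0) 1"
definition var_t :: laurent where "var_t = Poly_Mapping.single (0, 1) 1"

definition laurent_eval :: "laurent \<Rightarrow> 'a \<Rightarrow> 'a \<Rightarrow> 'a::field" where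
  "laurent_eval P x y =
     (\<Sum>(i, j)\<in>Poly_Mapping.keys P. of_int (Poly_Mapping.lookup P (i, j)) * x powi i * y powi j)"

text \<open>
  \<open>P\<close> is \<open>W\<close> rewritten via \<open>A\<^sup>2 = t\<^sup>-\<^sup>1\<^sup>/\<^sup>2\<close> and \<open>B\<^sup>2 = s\<^sup>-\<^sup>1\<^sup>/\<^sup>2\<close>.  There is at most one such \<open>P\<close>, since
  \<open>B\<^sup>-\<^sup>2\<close> and \<open>A\<^sup>-\<^sup>4\<close> are algebraically independent; that there is one for symmetric unions is
  the integrality of \<open>W\<close>.
\<close>

definition W_laurent :: "'d axial_diagram \<Rightarrow> 'd set \<Rightarrow> laurent \<Rightarrow> bool" where
  "W_laurent D Or P \<longleftrightarrow>
     W D Or var_A var_B = laurent_eval P (var_B powi (-2)) (var_A powi (-4))"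

end

theory Submission
  imports "HOL-Analysis.Complex_Analysis_Basics" Defs
begin

text \<open>
  Smoothing only the crossings on the axis turns a symmetric union into diagrams consisting of a
  half and its mirror image, made of \<open>m\<close> strings each.  For these it suffices to show that the sum
  over all states, with \<open>c\<close> circles weighted by \<open>\<delta>\<^sup>c\<^sup>-\<^sup>m\<close> where \<open>\<delta> = -A\<^sup>2 - A\<^sup>-\<^sup>2\<close>, is 1: the remaining
  sum over the crossings on the axis then factorizes into the contributions of kinks.

  A state with \<open>c\<close> circles has \<open>2\<^sup>c\<close> colourings by \<open>\<int>/2\<close>.  By planarity a colouring is the jump of a
  two-colouring of the regions, and its values on the black and on the white regions of the
  checkerboard can be separated.  Hence \<open>2\<^sup>c\<close> is, up to a constant and \<open>2\<^sup>|\<^sup>U\<^sup>|\<close>, the square of the number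
  of black colourings that are constant at each of the crossings in \<open>U\<close> where the state joins black
  regions.  At the special values \<open>\<delta>\<^sup>2 = \<xi> + \<xi>\<^sup>-\<^sup>1 + 2\<close> is \<open>2\<^sup>q\<close> with \<open>q \<in> {0, 1, 2}\<close>, so the state
  sum becomes a \<open>q\<close>-fold Gauss sum over black colourings.  A colouring is the sum of a mirror
  symmetric one, on which the contributions of mirrored crossings cancel, and one supported on one
  half.  Summing over the former leaves the colourings of the half that are orthogonal to all
  symmetric ones.  There is only the trivial one, since by duality with the white colourings any
  such colouring extends along the strands of the link, and every component reaches the axis.

  The derivative at \<open>t = 1\<close> vanishes because the reflection exchanges \<open>A\<close> and \<open>A\<^sup>-\<^sup>1\<close>.
\<close>


section \<open>Linear algebra over the field with two elements\<close>

text \<open>Circles are never handled as curves. Their number is the dimension of the space of sets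
  of darts invariant under two matchings, so every topological step becomes counting over the field
  with two elements. Planarity enters through one fact only: an even set of edges is the boundary of
  a set of regions. The link diagram may be disconnected and its black regions need not be discs, so
  circles are not counted through regions. Instead a state is compared with the state
  \<open>{}\<close> that follows the black boundaries everywhere off the axis:
  \<open>c(U) + c({}) = 2 a + |U|\<close>, where \<open>a\<close> is the dimension of the space of
  black colourings constant at \<open>U\<close>. Folding gives \<open>c({}) = 2 h + m\<close> and a
  dimension \<open>b = h + m\<close> for the symmetric colourings, so
  \<open>c(U) - m = 2 (a - b) + |U|\<close>. Hence \<open>\<delta>\<close> occurs once for each
  crossing in \<open>U\<close>, which can be absorbed into local weights, and otherwise only through
  \<open>\<delta>^2\<close>. If \<open>\<delta>^2\<close> is \<open>2^q\<close>, that remaining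
  factor counts \<open>q\<close>-tuples of colourings. For \<open>q = 1\<close> and
  \<open>q = 2\<close> the resulting local weights are fourth roots of unity, which makes the sums
  quadratic Gauss sums.\<close>

text \<open>Subspaces over the field with two elements, a set standing for its characteristic
  function.\<close>

definition xor_closed :: "'a set set \<Rightarrow> bool" where
  "xor_closed G \<longleftrightarrow> {} \<in> G \<and> (\<forall>f\<in>G. \<forall>g\<in>G. sym_diff f g \<in> G)"

lemma even_card_sym_diff:
  assumes "finite a" "finite b"
  shows "even (card (sym_diff a b)) \<longleftrightarrow> (even (card a) \<longleftrightarrow> even (card b))"
proof -
  have 1: "card (sym_diff a b) = card (a - b) + card (b - a)"
    using assms by (intro card_Un_disjoint) auto
  have 2: "card a = card (a - b) + card (a \<inter> b)"
    using assms by (metis Int_Diff_Un Int_Diff_disjoint card_Un_disjoint finite_Diff finite_Int add.commute)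
  have 3: "card b = card (b - a) + card (a \<inter> b)"
    using assms by (metis Int_Diff_Un Int_Diff_disjoint card_Un_disjoint finite_Diff finite_Int add.commute Int_commute)
  show ?thesis using 1 2 3 by auto
qed

lemma xor_closed_Pow [simp]: "xor_closed (Pow X)"
  by (auto simp: xor_closed_def)

lemma xor_closedD:
  assumes "xor_closed G" "f \<in> G" "g \<in> G"
  shows "sym_diff f g \<in> G"
  using assms by (auto simp: xor_closed_def)

text \<open>Rank and nullity in counting form: every fibre is a translate of the kernel.\<close>

lemma card_xor_hom:
  assumes G: "finite G" "xor_closed G"
    and hom: "\<And>f g. f \<in> G \<Longrightarrow> g \<in> G \<Longrightarrow> \<pi> (sym_diff f g) = sym_diff (\<pi> f) (\<pi> g)"
  shows "card G = card (\<pi> ` G) * card {f \<in> G. \<pi> f = {}}"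
proof -
  have fib: "card {f \<in> G. \<pi> f = y} = card {f \<in> G. \<pi> f = {}}" if y: "y \<in> \<pi> ` G" for y
  proof -
    obtain h where h: "h \<in> G" "\<pi> h = y" using y by auto
    have inj: "inj_on (\<lambda>f. sym_diff f h) X" for X :: "'a set set"
      by (rule inj_onI) blast
    have im: "(\<lambda>f. sym_diff f h) ` {f \<in> G. \<pi> f = y} = {f \<in> G. \<pi> f = {}}"
    proof (intro set_eqI iffI)
      fix f assume "f \<in> (\<lambda>f. sym_diff f h) ` {f \<in> G. \<pi> f = y}"
      then show "f \<in> {f \<in> G. \<pi> f = {}}" using h hom xor_closedD[OF G(2)] by force
    next
      fix f assume f: "f \<in> {f \<in> G. \<pi> f = {}}"
      have "f = sym_diff (sym_diff f h) h" by blast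
      moreover have "sym_diff f h \<in> {f \<in> G. \<pi> f = y}"
        using f h hom[of f h] xor_closedD[OF G(2), of f h] by simp
      ultimately show "f \<in> (\<lambda>f. sym_diff f h) ` {f \<in> G. \<pi> f = y}" by (rule image_eqI)
    qed
    show ?thesis using card_image[OF inj, of "{f \<in> G. \<pi> f = y}"] im by simp
  qed
  have "card G = (\<Sum>f\<in>G. 1)" by simp
  also have "\<dots> = (\<Sum>y\<in>\<pi> ` G. \<Sum>f | f \<in> G \<and> \<pi> f = y. 1)"
    using G(1) by (rule sum.image_gen)
  also have "\<dots> = (\<Sum>y\<in>\<pi> ` G. card {f \<in> G. \<pi> f = {}})"
    by (rule sum.cong[OF refl]) (use fib in simp)
  finally show ?thesis by simp
qed

text \<open>\<open>P\<close> is the kernel of a linear functional; adding \<open>h\<close> exchanges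
  the kernel with its complement.\<close>

lemma card_xor_half:
  assumes G: "finite G" "xor_closed G"
    and hom: "\<And>f g. f \<in> G \<Longrightarrow> g \<in> G \<Longrightarrow> P (sym_diff f g) \<longleftrightarrow> (P f \<longleftrightarrow> P g)"
    and h: "h \<in> G" "\<not> P h"
  shows "card {f \<in> G. \<not> P f} = card {f \<in> G. P f}" "card G = 2 * card {f \<in> G. P f}"
proof -
  let ?\<pi> = "\<lambda>f. {x :: unit. \<not> P f}"
  have inj: "inj_on (\<lambda>f. sym_diff f h) X" for X :: "'a set set"
    by (rule inj_onI) blast
  have im: "(\<lambda>f. sym_diff f h) ` {f \<in> G. \<not> P f} = {f \<in> G. P f}"
  proof (intro set_eqI iffI)
    fix f assume "f \<in> (\<lambda>f. sym_diff f h) ` {f \<in> G. \<not> P f}"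
    then show "f \<in> {f \<in> G. P f}" using h hom xor_closedD[OF G(2)] by force
  next
    fix f assume f: "f \<in> {f \<in> G. P f}"
    have "f = sym_diff (sym_diff f h) h" by blast
    moreover have "sym_diff f h \<in> {f \<in> G. \<not> P f}"
      using f h hom[of f h] xor_closedD[OF G(2), of f h] by simp
    ultimately show "f \<in> (\<lambda>f. sym_diff f h) ` {f \<in> G. \<not> P f}" by (rule image_eqI)
  qed
  show 1: "card {f \<in> G. \<not> P f} = card {f \<in> G. P f}"
    using card_image[OF inj, of "{f \<in> G. \<not> P f}"] im by simp
  have "G = {f \<in> G. P f} \<union> {f \<in> G. \<not> P f}" by auto
  then have "card G = card ({f \<in> G. P f} \<union> {f \<in> G. \<not> P f})" by simp
  also have "\<dots> = card {f \<in> G. P f} + card {f \<in> G. \<not> P f}"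
    using G(1) by (intro card_Un_disjoint) auto
  finally show "card G = 2 * card {f \<in> G. P f}" using 1 by simp
qed

text \<open>Orthogonality of characters: a nontrivial one takes both values equally often.\<close>

lemma sum_xor_character:
  assumes G: "finite G" "xor_closed G"
    and hom: "\<And>f g. f \<in> G \<Longrightarrow> g \<in> G \<Longrightarrow> P (sym_diff f g) \<longleftrightarrow> (P f \<longleftrightarrow> P g)"
  shows "(\<Sum>f\<in>G. if P f then 1 else - 1 :: 'b::comm_ring_1) = (if \<forall>f\<in>G. P f then of_nat (card G) else 0)"
proof (cases "\<forall>f\<in>G. P f")
  case True
  then show ?thesis by simp
next
  case False
  then obtain h where h: "h \<in> G" "\<not> P h" by auto
  have "(\<Sum>f\<in>G. if P f then 1 else - 1 :: 'b) = (\<Sum>f | f \<in> G \<and> P f. 1) + (\<Sum>f | f \<in> G \<and> \<not> P f. - 1)"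
    using G(1) by (simp add: sum.If_cases Collect_conj_eq Collect_neg_eq Int_commute)
  also have "\<dots> = 0" using card_xor_half(1)[OF G hom h] by simp
  finally show ?thesis using False by auto
qed

lemma sum_parity_character:
  assumes "finite G" "xor_closed G"
    and hom: "\<And>f g. f \<in> G \<Longrightarrow> g \<in> G \<Longrightarrow> \<pi> (sym_diff f g) = sym_diff (\<pi> f) (\<pi> g)"
    and fin: "\<And>f. f \<in> G \<Longrightarrow> finite (\<pi> f)"
  shows "(\<Sum>f\<in>G. (- 1) ^ card (\<pi> f \<inter> y) :: 'b::comm_ring_1) =
    (if \<forall>f\<in>G. even (card (\<pi> f \<inter> y)) then of_nat (card G) else 0)"
proof -
  have "(\<Sum>f\<in>G. (- 1) ^ card (\<pi> f \<inter> y) :: 'b) = (\<Sum>f\<in>G. if even (card (\<pi> f \<inter> y)) then 1 else - 1)"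
    by (rule sum.cong[OF refl]) simp
  also have "\<dots> = (if \<forall>f\<in>G. even (card (\<pi> f \<inter> y)) then of_nat (card G) else 0)"
  proof (rule sum_xor_character[OF assms(1,2)])
    fix f g assume fg: "f \<in> G" "g \<in> G"
    have "\<pi> (sym_diff f g) \<inter> y = sym_diff (\<pi> f \<inter> y) (\<pi> g \<inter> y)"
      unfolding hom[OF fg] by blast
    then show "even (card (\<pi> (sym_diff f g) \<inter> y)) \<longleftrightarrow>
        (even (card (\<pi> f \<inter> y)) \<longleftrightarrow> even (card (\<pi> g \<inter> y)))"
      using even_card_sym_diff[of "\<pi> f \<inter> y" "\<pi> g \<inter> y"] fin fg by simp
  qed
  finally show ?thesis .
qed

section \<open>Invariant sets\<close>

text \<open>Functions to the field with two elements that are constant on the orbits of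
  \<open>p\<close>.\<close>

definition inv_sets :: "'a set \<Rightarrow> ('a \<Rightarrow> 'a) \<Rightarrow> 'a set set" where
  "inv_sets X p = {f. f \<subseteq> X \<and> (\<forall>x\<in>X. p x \<in> f \<longleftrightarrow> x \<in> f)}"

lemma inv_setsI:
  assumes "f \<subseteq> X" "\<And>x. x \<in> X \<Longrightarrow> p x \<in> f \<longleftrightarrow> x \<in> f"
  shows "f \<in> inv_sets X p"
  using assms by (auto simp: inv_sets_def)

lemma inv_setsD:
  assumes "f \<in> inv_sets X p"
  shows "f \<subseteq> X" "x \<in> X \<Longrightarrow> p x \<in> f \<longleftrightarrow> x \<in> f"
  using assms by (auto simp: inv_sets_def)

lemma xor_closed_inv_sets [simp]: "xor_closed (inv_sets X p)"
  by (auto simp: xor_closed_def inv_sets_def)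

lemma xor_closed_Int: "xor_closed G \<Longrightarrow> xor_closed H \<Longrightarrow> xor_closed (G \<inter> H)"
  by (auto simp: xor_closed_def)

lemma finite_inv_sets: "finite X \<Longrightarrow> finite (inv_sets X p)"
  by (rule finite_subset[of _ "Pow X"]) (auto simp: inv_sets_def)

lemma card_saturated:
  assumes P: "partition_on X P" and X: "finite X"
  shows "card {f. f \<subseteq> X \<and> (\<forall>K\<in>P. K \<subseteq> f \<or> K \<inter> f = {})} = 2 ^ card P"
proof -
  have un: "\<Union> P = X" and dj: "disjoint P" and ne: "{} \<notin> P"
    using P by (auto simp: partition_on_def)
  have finP: "finite P" using P X by (rule finite_elements[rotated])
  have bij: "bij_betw \<Union> (Pow P) {f. f \<subseteq> X \<and> (\<forall>K\<in>P. K \<subseteq> f \<or> K \<inter> f = {})}"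
  proof (rule bij_betwI[where g = "\<lambda>f. {K \<in> P. K \<subseteq> f}"])
    show "\<Union> \<in> Pow P \<rightarrow> {f. f \<subseteq> X \<and> (\<forall>K\<in>P. K \<subseteq> f \<or> K \<inter> f = {})}"
    proof (rule funcsetI, clarify, intro conjI ballI)
      fix Q assume Q: "Q \<subseteq> P"
      show "\<Union> Q \<subseteq> X" using Q un by auto
      fix K assume K: "K \<in> P"
      show "K \<subseteq> \<Union> Q \<or> K \<inter> \<Union> Q = {}"
      proof (cases "K \<in> Q")
        case False
        have "K \<inter> L = {}" if "L \<in> Q" for L
          using dj K Q that False by (metis disjointD subsetD)
        then show ?thesis by auto
      qed auto
    qed
    show "(\<lambda>f. {K \<in> P. K \<subseteq> f}) \<in> {f. f \<subseteq> X \<and> (\<forall>K\<in>P. K \<subseteq> f \<or> K \<inter> f = {})} \<rightarrow> Pow P"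
      by auto
    show "{K \<in> P. K \<subseteq> \<Union> Q} = Q" if "Q \<in> Pow P" for Q
    proof (intro set_eqI iffI)
      fix K assume K: "K \<in> {K \<in> P. K \<subseteq> \<Union> Q}"
      then obtain x where x: "x \<in> K" using ne by (metis (lifting) ex_in_conv mem_Collect_eq)
      with K obtain L where L: "L \<in> Q" "x \<in> L" by auto
      have "L = K" using dj K L x that by (metis (lifting) Pow_iff disjointD IntI empty_iff mem_Collect_eq subsetD)
      then show "K \<in> Q" using L by simp
    qed (use that in auto)
    show "\<Union> {K \<in> P. K \<subseteq> f} = f" if f: "f \<in> {f. f \<subseteq> X \<and> (\<forall>K\<in>P. K \<subseteq> f \<or> K \<inter> f = {})}" for f
    proof (intro set_eqI iffI)
      fix x assume x: "x \<in> f"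
      then obtain K where "K \<in> P" "x \<in> K" using f un by auto
      with x f show "x \<in> \<Union> {K \<in> P. K \<subseteq> f}" by fast
    qed auto
  qed
  show ?thesis using bij_betw_same_card[OF bij] finP by (simp add: card_Pow)
qed

lemma partition_on_orbits:
  assumes "p permutes X" "finite X"
  shows "partition_on X (orbit p ` X)"
proof (rule partition_onI)
  have perm: "permutation p" using assms by (auto simp: permutation_permutes)
  show "\<Union> (orbit p ` X) = X"
    using permutes_orbit_subset[OF assms(1)] permutation_self_in_orbit[OF perm] by blast
  show "disjnt K L" if "K \<in> orbit p ` X" "L \<in> orbit p ` X" "K \<noteq> L" for K L
    using that cyclic_on_orbit'[OF perm] orbit_cyclic_eq3[of p]
    unfolding disjnt_def by (metis disjoint_iff image_iff)
  show "{} \<notin> orbit p ` X" using orbit_nonempty[of p] by auto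
qed

lemma card_partition_Int:
  assumes "partition_on X P" "finite X" "Y \<subseteq> X"
  shows "card Y = (\<Sum>K\<in>P. card (Y \<inter> K))"
proof -
  have "Y = (\<Union>K\<in>P. Y \<inter> K)" using assms by (auto simp: partition_on_def)
  then have "card Y = card (\<Union>K\<in>P. Y \<inter> K)" by simp
  also have "\<dots> = (\<Sum>K\<in>P. card (Y \<inter> K))"
  proof (rule card_UN_disjoint)
    show "finite P" using assms(2,1) by (rule finite_elements)
    show "\<forall>K\<in>P. finite (Y \<inter> K)" using assms finite_subset by blast
    show "\<forall>K\<in>P. \<forall>L\<in>P. K \<noteq> L \<longrightarrow> (Y \<inter> K) \<inter> (Y \<inter> L) = {}"
      using assms(1) by (auto simp: partition_on_def disjoint_def)
  qed
  finally show ?thesis .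
qed

lemma even_card_involution:
  assumes "finite Y" and e: "\<And>y. y \<in> Y \<Longrightarrow> e y \<in> Y \<and> e (e y) = y \<and> e y \<noteq> y"
  shows "even (card Y)"
proof -
  have part: "partition_on Y ((\<lambda>y. {y, e y}) ` Y)"
  proof (rule partition_onI)
    show "disjnt K L" if "K \<in> (\<lambda>y. {y, e y}) ` Y" "L \<in> (\<lambda>y. {y, e y}) ` Y" "K \<noteq> L" for K L
      using that unfolding disjnt_def by (auto; metis e insert_commute)
  qed (use e in auto)
  have "card Y = (\<Sum>K\<in>(\<lambda>y. {y, e y}) ` Y. card K)"
    using part by (rule product_partition) auto
  also have "\<dots> = (\<Sum>K\<in>(\<lambda>y. {y, e y}) ` Y. 2)"
    by (rule sum.cong[OF refl]) (use e in \<open>auto simp: card_insert_if; metis\<close>)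
  finally show ?thesis by simp
qed

lemma card_inv_sets_permutes:
  assumes "p permutes X" "finite X"
  shows "card (inv_sets X p) = 2 ^ card (orbit p ` X)"
proof -
  have perm: "permutation p" using assms by (auto simp: permutation_permutes)
  note part = partition_on_orbits[OF assms]
  have "inv_sets X p = {f. f \<subseteq> X \<and> (\<forall>K\<in>orbit p ` X. K \<subseteq> f \<or> K \<inter> f = {})}"
  proof (intro set_eqI iffI)
    fix f assume f: "f \<in> inv_sets X p"
    have "y \<in> f \<longleftrightarrow> x \<in> f" if "y \<in> orbit p x" "x \<in> X" for x y
      using that(1)
    proof induction
      case (step y)
      have "y \<in> X" using step(1) that(2) permutes_orbit_subset[OF assms(1)] by auto
      then show ?case using step f by (auto dest: inv_setsD)
    qed (use that f in \<open>auto dest: inv_setsD\<close>)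
    then show "f \<in> {f. f \<subseteq> X \<and> (\<forall>K\<in>orbit p ` X. K \<subseteq> f \<or> K \<inter> f = {})}"
      using f by (auto dest: inv_setsD)
  next
    fix f assume f: "f \<in> {f. f \<subseteq> X \<and> (\<forall>K\<in>orbit p ` X. K \<subseteq> f \<or> K \<inter> f = {})}"
    show "f \<in> inv_sets X p"
    proof (rule inv_setsI)
      fix x assume "x \<in> X"
      then have "orbit p x \<subseteq> f \<or> orbit p x \<inter> f = {}" using f by auto
      moreover have "x \<in> orbit p x" "p x \<in> orbit p x"
        using permutation_self_in_orbit[OF perm] orbit.base by auto
      ultimately show "p x \<in> f \<longleftrightarrow> x \<in> f" by blast
    qed (use f in auto)
  qed
  then show ?thesis using card_saturated[OF part assms(2)] by simp
qed

text \<open>This turns a number of closed curves into a dimension. For involutions the relation is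
  symmetric, so its classes partition \<open>X\<close>, and an invariant set is a union of
  classes.\<close>

lemma card_inv_sets_quotient:
  assumes X: "finite X" and e: "\<And>x. x \<in> X \<Longrightarrow> e x \<in> X \<and> e (e x) = x"
    and j: "\<And>x. x \<in> X \<Longrightarrow> j x \<in> X \<and> j (j x) = x"
  shows "card (inv_sets X e \<inter> inv_sets X j) =
    2 ^ card (X // ({(d, e d) |d. d \<in> X} \<union> {(d, j d) |d. d \<in> X})\<^sup>*)"
proof -
  define R where "R = {(d, e d) |d. d \<in> X} \<union> {(d, j d) |d. d \<in> X}"
  have symR: "sym R"
  proof (rule symI)
    fix x y assume "(x, y) \<in> R"
    then show "(y, x) \<in> R" using e j unfolding R_def by (auto; metis)
  qed
  have symS: "sym (R\<^sup>*)" using symR by (rule sym_rtrancl)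
  have stay: "y \<in> X" if "(x, y) \<in> R\<^sup>*" "x \<in> X" for x y
    using that by induction (auto simp: R_def e j)
  have equ: "equiv X (R\<^sup>* \<inter> X \<times> X)"
    using symS by (auto intro!: equivI simp: refl_on_def sym_def trans_def)
  have quo: "X // R\<^sup>* = X // (R\<^sup>* \<inter> X \<times> X)"
  proof -
    have "R\<^sup>* `` {x} = (R\<^sup>* \<inter> X \<times> X) `` {x}" if "x \<in> X" for x
      using stay that by auto
    then show ?thesis by (auto simp: quotient_def)
  qed
  have part: "partition_on X (X // R\<^sup>*)"
    unfolding quo using equ by (rule partition_on_quotient)
  have "inv_sets X e \<inter> inv_sets X j = {f. f \<subseteq> X \<and> (\<forall>K\<in>X // R\<^sup>*. K \<subseteq> f \<or> K \<inter> f = {})}"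
  proof (intro set_eqI iffI)
    fix f assume f: "f \<in> inv_sets X e \<inter> inv_sets X j"
    have "y \<in> f \<longleftrightarrow> x \<in> f" if "(x, y) \<in> R\<^sup>*" "x \<in> X" for x y
      using that(1)
    proof induction
      case (step y z)
      have "y \<in> X" using stay step(1) that(2) by auto
      then show ?case using step f by (auto simp: R_def dest: inv_setsD)
    qed simp
    then show "f \<in> {f. f \<subseteq> X \<and> (\<forall>K\<in>X // R\<^sup>*. K \<subseteq> f \<or> K \<inter> f = {})}"
      using f by (auto simp: quotient_def dest: inv_setsD)
  next
    fix f assume f: "f \<in> {f. f \<subseteq> X \<and> (\<forall>K\<in>X // R\<^sup>*. K \<subseteq> f \<or> K \<inter> f = {})}"
    have *: "y \<in> f \<longleftrightarrow> x \<in> f" if "x \<in> X" "(x, y) \<in> R" for x y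
    proof -
      have "R\<^sup>* `` {x} \<subseteq> f \<or> R\<^sup>* `` {x} \<inter> f = {}" using f that by (auto simp: quotient_def)
      then show ?thesis using that by (auto simp: disjoint_iff)
    qed
    show "f \<in> inv_sets X e \<inter> inv_sets X j"
      using f * by (auto intro!: inv_setsI simp: R_def)
  qed
  then show ?thesis using card_saturated[OF part X] by (simp add: R_def)
qed

section \<open>Two involutions\<close>

text \<open>
  A pair of involutions, one without fixed points, decomposes a finite set into closed curves and
  paths; the fixed points of the other one are the ends of the paths.
\<close>

locale two_involutions =
  fixes X :: "'a set" and e j :: "'a \<Rightarrow> 'a"
  assumes finite_X: "finite X"
    and e_in: "x \<in> X \<Longrightarrow> e x \<in> X" and e_e: "x \<in> X \<Longrightarrow> e (e x) = x"
    and e_neq: "x \<in> X \<Longrightarrow> e x \<noteq> x"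
    and j_in: "x \<in> X \<Longrightarrow> j x \<in> X" and j_j: "x \<in> X \<Longrightarrow> j (j x) = x"
begin

definition ends :: "'a set" where "ends = {x \<in> X. j x = x}"

definition colourings :: "'a set set" where "colourings = inv_sets X e \<inter> inv_sets X j"

lemma finite_colourings: "finite colourings"
  unfolding colourings_def using finite_inv_sets[OF finite_X] by auto

lemma xor_closed_colourings: "xor_closed colourings"
  unfolding colourings_def by (intro xor_closed_Int xor_closed_inv_sets)

text \<open>The path through \<open>a\<close> is its orbit under \<open>t\<close>, that is
  \<open>e\<close> after \<open>j\<close>. Both involutions act on this cyclic orbit as reflections,
  and \<open>j\<close> fixes \<open>a\<close>; the other end is the second fixed point of
  \<open>j\<close>, halfway round the orbit.\<close>

lemma path_of_end:
  assumes a: "a \<in> ends"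
  obtains K b where "K \<in> colourings" "a \<noteq> b" "K \<inter> ends = {a, b}"
    "\<And>f. f \<in> colourings \<Longrightarrow> a \<in> f \<Longrightarrow> K \<subseteq> f"
proof -
  define t where "t = (\<lambda>x. if x \<in> X then e (j x) else x)"
  have aX: "a \<in> X" and ja: "j a = a" using a by (auto simp: ends_def)
  have tX: "t x \<in> X" if "x \<in> X" for x using that by (simp add: t_def e_in j_in)
  have inj: "inj_on t X"
    by (rule inj_onI) (metis e_e j_in j_j t_def)
  have perm: "t permutes X"
  proof (rule bij_imp_permutes)
    show "bij_betw t X X"
      using inj tX finite_X by (simp add: bij_betw_def endo_inj_surj image_subsetI)
  qed (simp add: t_def)
  have permt: "permutation t" using perm finite_X by (auto simp: permutation_permutes)
  have bij: "bij (t ^^ m)" for m using permutes_bij[OF perm] by (rule bij_betw_funpow)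
  have pX: "(t ^^ m) a \<in> X" for m by (induction m) (simp_all add: aX tX)
  \<comment> \<open>Dihedral relation: conjugation by \<open>j\<close> inverts
    \<open>t\<close>.\<close>
  have refl: "(t ^^ m) (j ((t ^^ m) a)) = a" for m
  proof (induction m)
    case (Suc m)
    let ?x = "(t ^^ m) a"
    have "t (j (t ?x)) = j ?x"
      using pX[of m] by (simp add: t_def e_in j_in j_j e_e)
    then have "(t ^^ Suc m) (j ((t ^^ Suc m) a)) = (t ^^ m) (j ?x)"
      by (simp add: funpow_swap1)
    then show ?case using Suc by simp
  qed (simp add: ja)
  define K where "K = orbit t a"
  define L where "L = funpow_dist1 t a a"
  have self: "a \<in> orbit t a" using permutation_self_in_orbit[OF permt] .
  have L: "(t ^^ L) a = a" "0 < L" unfolding L_def using funpow_dist1_prop[OF self] by auto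
  have K_eq: "K = (\<lambda>n. (t ^^ n) a) ` {0..<L}"
    unfolding K_def L_def by (rule orbit_conv_funpow_dist1[OF self])
  have dvd: "(t ^^ m) a = a \<longleftrightarrow> L dvd m" for m
  proof
    assume "(t ^^ m) a = a"
    then have "(t ^^ (m mod L)) a = a" using funpow_mod_eq[OF L(1), of m] by simp
    moreover have "m mod L < L" using L(2) by simp
    ultimately have "m mod L = 0" unfolding L_def using funpow_dist1_least[of "m mod L" t a a]
      by (metis L_def gr0I)
    then show "L dvd m" by auto
  next
    assume "L dvd m"
    then show "(t ^^ m) a = a" using funpow_mod_eq[OF L(1), of m] by simp
  qed
  have KX: "K \<subseteq> X" unfolding K_eq using pX by auto
  have fixed: "j ((t ^^ m) a) = (t ^^ m) a \<longleftrightarrow> L dvd 2 * m" for m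
  proof -
    have "j ((t ^^ m) a) = (t ^^ m) a \<longleftrightarrow> (t ^^ m) (j ((t ^^ m) a)) = (t ^^ m) ((t ^^ m) a)"
      using bij_is_inj[OF bij[of m]] by (simp add: inj_eq)
    also have "\<dots> \<longleftrightarrow> (t ^^ (2 * m)) a = a" using refl by (auto simp: funpow_add mult_2)
    finally show ?thesis using dvd by simp
  qed
  \<comment> \<open>On an orbit of odd length the reflection \<open>e\<close> would also have a
    fixed point.\<close>
  have "even L"
  proof (rule ccontr)
    assume "odd L"
    then obtain l where l: "L = 2 * l + 1" by (auto elim: oddE)
    let ?y = "(t ^^ l) a"
    have "(t ^^ l) (t ?y) = (t ^^ L) a" by (simp add: l funpow_add mult_2 funpow_swap1)
    then have "(t ^^ l) (t ?y) = (t ^^ l) (j ?y)" using L refl by simp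
    then have "t ?y = j ?y" using bij_is_inj[OF bij[of l]] by (simp add: inj_eq)
    then have "e (j ?y) = j ?y" using pX[of l] by (simp add: t_def)
    then show False using e_neq j_in pX by blast
  qed
  then obtain l where l: "L = 2 * l" by (auto elim: evenE)
  define b where "b = (t ^^ l) a"
  have "a \<noteq> b" unfolding b_def using dvd[of l] l L(2) by auto
  have jK: "j x \<in> K" if x: "x \<in> K" for x
  proof -
    obtain m where "x = (t ^^ m) a" using x by (auto simp: K_eq)
    then have "a = (t ^^ m) (j x)" using refl by simp
    then have "a \<in> orbit t (j x)" using orbit_altdef_permutation[OF permt] by blast
    then show ?thesis unfolding K_def
      using permutation_self_in_orbit[OF permt] orbit_swap by metis
  qed
  have eK: "e x \<in> K" if "x \<in> K" for x
  proof -
    have "e x = t (j x)" using that KX by (auto simp: t_def j_in j_j)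
    then show ?thesis using jK[OF that] unfolding K_def by (simp add: orbit.step)
  qed
  have "K \<in> inv_sets X p" if "\<And>x. x \<in> K \<Longrightarrow> p x \<in> K" "\<And>x. x \<in> X \<Longrightarrow> p (p x) = x" for p
  proof (rule inv_setsI[OF KX])
    show "p x \<in> K \<longleftrightarrow> x \<in> K" if "x \<in> X" for x
      using \<open>\<And>x. x \<in> K \<Longrightarrow> p x \<in> K\<close> \<open>\<And>x. x \<in> X \<Longrightarrow> p (p x) = x\<close> that by metis
  qed
  then have 1: "K \<in> colourings"
    unfolding colourings_def using jK eK e_e j_j by blast
  have 2: "K \<inter> ends = {a, b}"
  proof -
    have "x \<in> {a, b}" if x: "x \<in> K" "x \<in> ends" for x
    proof -
      obtain m where m: "x = (t ^^ m) a" "m < L" using x by (auto simp: K_eq)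
      have "L dvd 2 * m" using fixed[of m] m x by (simp add: ends_def)
      then have "l dvd m" "m < 2 * l" using l m L by auto
      then have "m = 0 \<or> m = l" by (auto elim!: dvdE)
      then show ?thesis using m by (auto simp: b_def)
    qed
    moreover have "a \<in> K" using self by (simp add: K_def)
    moreover have "b \<in> K" using L l by (auto simp: K_eq b_def)
    moreover have "b \<in> ends" unfolding ends_def b_def using pX fixed[of l] l by auto
    ultimately show ?thesis using a by blast
  qed
  have 3: "K \<subseteq> f" if "f \<in> colourings" "a \<in> f" for f
  proof
    fix x assume "x \<in> K"
    then obtain m where "x = (t ^^ m) a" by (auto simp: K_eq)
    moreover have "(t ^^ m) a \<in> f" for m
    proof (induction m)
      case (Suc m)
      then show ?case using that(1) pX[of m]
        by (auto simp: t_def colourings_def j_in dest: inv_setsD)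
    qed (use that in simp)
    ultimately show "x \<in> f" by simp
  qed
  show ?thesis using that 1 2 3 \<open>a \<noteq> b\<close> by blast
qed

text \<open>Restriction to \<open>ends\<close> is linear. Its image consists of the sets that
  contain both or neither of the two ends of each path, and its kernel of the colourings vanishing
  at the ends.\<close>

lemma card_colourings:
  "even (card ends)"
  "card colourings = card {f \<in> colourings. f \<inter> ends = {}} * 2 ^ (card ends div 2)"
proof -
  have "\<forall>a\<in>ends. \<exists>K b. K \<in> colourings \<and> a \<noteq> b \<and> K \<inter> ends = {a, b} \<and>
      (\<forall>f\<in>colourings. a \<in> f \<longrightarrow> K \<subseteq> f)"
    using path_of_end by metis
  then obtain K where "\<forall>a\<in>ends. \<exists>b. K a \<in> colourings \<and> a \<noteq> b \<and> K a \<inter> ends = {a, b} \<and>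
      (\<forall>f\<in>colourings. a \<in> f \<longrightarrow> K a \<subseteq> f)"
    by metis
  then obtain b where Kb: "\<And>a. a \<in> ends \<Longrightarrow> K a \<in> colourings" "\<And>a. a \<in> ends \<Longrightarrow> a \<noteq> b a"
      "\<And>a. a \<in> ends \<Longrightarrow> K a \<inter> ends = {a, b a}"
      "\<And>a f. a \<in> ends \<Longrightarrow> f \<in> colourings \<Longrightarrow> a \<in> f \<Longrightarrow> K a \<subseteq> f"
    by metis
  have finE: "finite ends" using finite_X by (simp add: ends_def)
  have bE: "b a \<in> ends" "b a \<in> K a" if "a \<in> ends" for a using Kb(3)[OF that] by auto
  \<comment> \<open>By minimality the path from \<open>b a\<close> is contained in the one from
    \<open>a\<close>, which has no third end.\<close>
  have bb: "b (b a) = a" if "a \<in> ends" for a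
  proof -
    have "sym_diff (K a) (K (b a)) \<in> colourings"
      using Kb(1) bE that xor_closedD[OF xor_closed_colourings] by blast
    moreover have "b a \<notin> sym_diff (K a) (K (b a))" using bE Kb(3)[of "b a"] that by auto
    moreover have "K (b a) \<subseteq> K a" using Kb(4)[of "b a" "K a"] Kb(1) bE that by blast
    ultimately have "b (b a) \<in> {a, b a}" using Kb(3)[of "b a"] Kb(3)[of a] bE that by auto
    then show ?thesis using Kb(2)[of "b a"] bE that by auto
  qed
  define P where "P = (\<lambda>a. {a, b a}) ` ends"
  have part: "partition_on ends P"
  proof (rule partition_onI)
    show "\<Union> P = ends" using bE by (auto simp: P_def)
    show "disjnt k l" if "k \<in> P" "l \<in> P" "k \<noteq> l" for k l
      using that unfolding disjnt_def P_def by (auto; metis bb insert_commute)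
    show "{} \<notin> P" by (auto simp: P_def)
  qed
  have card2: "card k = 2" if "k \<in> P" for k using that Kb(2) by (auto simp: P_def)
  have "card ends = (\<Sum>k\<in>P. card k)"
    using part by (rule product_partition) (auto simp: P_def)
  then have cardE: "card ends = card P * 2" using card2 by simp
  then show "even (card ends)" by simp
  have cP: "card P = card ends div 2" using cardE by simp
  have "(\<lambda>f. f \<inter> ends) ` colourings = {y. y \<subseteq> ends \<and> (\<forall>k\<in>P. k \<subseteq> y \<or> k \<inter> y = {})}"
  proof (intro set_eqI iffI)
    fix y assume "y \<in> (\<lambda>f. f \<inter> ends) ` colourings"
    then obtain f where f: "f \<in> colourings" "y = f \<inter> ends" by auto
    have "a \<in> f \<longleftrightarrow> b a \<in> f" if "a \<in> ends" for a
      using Kb(4)[OF that f(1)] Kb(4)[OF bE(1)[OF that] f(1)] bE that bb by (metis subsetD)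
    then show "y \<in> {y. y \<subseteq> ends \<and> (\<forall>k\<in>P. k \<subseteq> y \<or> k \<inter> y = {})}"
      using f bE by (auto simp: P_def)
  next
    fix y assume y: "y \<in> {y. y \<subseteq> ends \<and> (\<forall>k\<in>P. k \<subseteq> y \<or> k \<inter> y = {})}"
    let ?f = "\<Union>a\<in>y. K a"
    have "?f \<in> inv_sets X p" if "\<And>a. a \<in> ends \<Longrightarrow> K a \<in> inv_sets X p" for p
      using that y unfolding inv_sets_def by blast
    then have "?f \<in> colourings" using Kb(1) by (auto simp: colourings_def)
    moreover have "?f \<inter> ends = y"
    proof -
      have "K a \<inter> ends \<subseteq> y" "a \<in> K a" if "a \<in> y" for a
      proof -
        have aE: "a \<in> ends" using y that by auto
        have "{a, b a} \<subseteq> y" using y that aE by (auto simp: P_def)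
        then show "K a \<inter> ends \<subseteq> y" using Kb(3)[OF aE] by simp
        show "a \<in> K a" using Kb(3)[OF aE] by auto
      qed
      then show ?thesis using y by auto
    qed
    ultimately show "y \<in> (\<lambda>f. f \<inter> ends) ` colourings" by auto
  qed
  then have "card ((\<lambda>f. f \<inter> ends) ` colourings) = 2 ^ (card ends div 2)"
    using card_saturated[OF part finE] cP by simp
  moreover have "card colourings = card ((\<lambda>f. f \<inter> ends) ` colourings) * card {f \<in> colourings. f \<inter> ends = {}}"
    using finite_colourings xor_closed_colourings by (rule card_xor_hom) blast
  ultimately show "card colourings = card {f \<in> colourings. f \<inter> ends = {}} * 2 ^ (card ends div 2)"
    by simp
qed

end

section \<open>Genus zero\<close>

text \<open>A two-colouring of the regions is encoded by the darts with a coloured region on their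
  right. This is its coboundary, the set of edges between regions of different colour.\<close>

definition jump :: "'d axial_diagram \<Rightarrow> 'd set \<Rightarrow> 'd set" where
  "jump D g = {d \<in> darts D. d \<in> g \<longleftrightarrow> edge D d \<notin> g}"

lemma diagramD:
  assumes "diagram D"
  shows "finite (darts D)" "rot D permutes darts D" "edge D permutes darts D"
    "\<And>d. d \<in> darts D \<Longrightarrow> edge D d \<noteq> d" "\<And>d. d \<in> darts D \<Longrightarrow> edge D (edge D d) = d"
  using assms unfolding diagram_def by simp_all

lemma partition_on_vertices:
  assumes "diagram D"
  shows "partition_on (darts D) (vertices D)"
  using partition_on_orbits[OF diagramD(2,1)[OF assms]]
  by (simp add: vertices_def vertex_def[abs_def])

lemma diagram_connected:
  assumes D: "diagram D" and f: "f \<in> inv_sets (darts D) (rot D)" "f \<in> inv_sets (darts D) (edge D)"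
  shows "f = {} \<or> f = darts D"
proof (rule ccontr)
  assume "\<not> ?thesis"
  then obtain d d' where d: "d \<in> f" "d' \<in> darts D" "d' \<notin> f"
    using f(1) inv_setsD(1) by blast
  have "d \<in> darts D" using d f inv_setsD(1) by blast
  define R where "R = {(x, rot D x) |x. x \<in> darts D} \<union> {(x, edge D x) |x. x \<in> darts D}"
  have "\<forall>d\<in>darts D. \<forall>e\<in>darts D. (d, e) \<in> R\<^sup>*"
    using D unfolding diagram_def R_def by (elim conjE)
  then have "(d, d') \<in> R\<^sup>*" using \<open>d \<in> darts D\<close> d(2) by blast
  then have "d' \<in> f"
    by induction (use d f in \<open>auto simp: R_def dest: inv_setsD\<close>)
  then show False using d by simp
qed

text \<open>
  Counting with characters gives \<open>2\<^sup>V |cycles| = 2 \<cdot> 2\<^sup>E\<close>, while there are \<open>2\<^sup>F / 2\<close> boundaries; by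
  Euler's formula these numbers agree.
\<close>

lemma cycle_is_boundary:
  assumes D: "diagram D" and f: "f \<in> inv_sets (darts D) (edge D)"
    and even: "\<And>v. v \<in> vertices D \<Longrightarrow> even (card (f \<inter> v))"
  obtains g where "g \<in> inv_sets (darts D) (rot D \<circ> edge D)" "f = jump D g"
proof -
  define X r e where "X = darts D" and "r = rot D" and "e = edge D"
  have fin: "finite X" and rX: "r permutes X" and eX: "e permutes X"
    and e_neq: "\<And>d. d \<in> X \<Longrightarrow> e d \<noteq> d" and e_e: "\<And>d. d \<in> X \<Longrightarrow> e (e d) = d"
    using diagramD[OF D] by (auto simp: X_def r_def e_def)
  have e_in: "e d \<in> X" if "d \<in> X" for d using permutes_in_image[OF eX] that by simp
  have r_in: "r d \<in> X" if "d \<in> X" for d using permutes_in_image[OF rX] that by simp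
  have neX: "X \<noteq> {}"
    using D by (auto simp: diagram_def X_def curves_def quotient_def)
  define H Ed G where "H = inv_sets X r" and "Ed = inv_sets X e" and "G = inv_sets X (r \<circ> e)"
  define Cyc where "Cyc = {f \<in> Ed. \<forall>v\<in>vertices D. even (card (f \<inter> v))}"
  have finH: "finite H" "finite Ed" "finite G" "finite Cyc"
    unfolding H_def Ed_def G_def Cyc_def using finite_inv_sets[OF fin] by auto
  have finf: "finite f" if "f \<in> H \<or> f \<in> Ed" for f
    using that fin finite_subset unfolding H_def Ed_def inv_sets_def by blast
  have orbit_e: "orbit e d = {d, e d}" if "d \<in> X" for d
  proof -
    have "x \<in> {d, e d}" if "x \<in> orbit e d" for x
      using that by induction (use e_e \<open>d \<in> X\<close> in auto)
    moreover have "d \<in> orbit e d" using orbit.step[OF orbit.base, of e d] e_e that by simp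
    ultimately show ?thesis using orbit.base[of e d] by blast
  qed
  have cH: "card H = 2 ^ card (vertices D)"
    using card_inv_sets_permutes[OF rX fin]
    by (simp add: H_def vertices_def vertex_def[abs_def] X_def r_def)
  have cEd: "card Ed = 2 ^ card (edges D)"
    using card_inv_sets_permutes[OF eX fin] orbit_e
    by (simp add: Ed_def edges_def X_def e_def)
  have cG: "card G = 2 ^ card (faces D)"
    using card_inv_sets_permutes[OF permutes_compose[OF eX rX] fin]
    by (simp add: G_def faces_def X_def r_def e_def)
  have conn: "k = {} \<or> k = X" if "k \<in> H" "k \<in> Ed" for k
    using diagram_connected[OF D] that by (simp add: H_def Ed_def X_def r_def e_def)
  have triv: "{} \<in> H" "X \<in> H" "{} \<in> Ed" "X \<in> Ed" "{} \<in> G" "X \<in> G"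
    by (auto simp: H_def Ed_def G_def inv_sets_def e_in r_in)
  have jump_in: "jump D g \<in> Cyc" if g: "g \<in> G" for g
  proof -
    have "jump D g \<in> Ed"
      using e_in e_e by (auto simp: jump_def Ed_def inv_sets_def X_def e_def)
    moreover have "even (card (jump D g \<inter> v))" if v: "v \<in> vertices D" for v
    proof -
      obtain d where d: "d \<in> X" "v = orbit r d"
        using v by (auto simp: vertices_def vertex_def X_def r_def)
      have vX: "v \<subseteq> X" using d permutes_orbit_subset[OF rX] by auto
      then have finv: "finite v" using fin finite_subset by auto
      have rv: "x \<in> v \<longleftrightarrow> r x \<in> v" for x
        using d(2) rX cyclic_on_orbit[OF rX fin, of d]
        by (metis cyclic_on_f_in orbit.step)
      have "x \<in> jump D g \<longleftrightarrow> (x \<in> g \<longleftrightarrow> r x \<notin> g)" if "x \<in> v" for x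
      proof -
        have "x \<in> X" using that vX by auto
        then have "r (e (e x)) \<in> g \<longleftrightarrow> e x \<in> g"
          using g e_in inv_setsD(2)[of g X "r \<circ> e" "e x"] by (simp add: G_def)
        then show ?thesis using \<open>x \<in> X\<close> e_e by (auto simp: jump_def X_def e_def)
      qed
      \<comment> \<open>Around \<open>v\<close> the jump compares \<open>g\<close> with its shift by
        one position, two sets of equal size.\<close>
      then have "jump D g \<inter> v = sym_diff (g \<inter> v) {x \<in> v. r x \<in> g}" by auto
      moreover have "card {x \<in> v. r x \<in> g} = card (g \<inter> v)"
      proof -
        have "inj_on r {x \<in> v. r x \<in> g}" using permutes_inj[OF rX] by (auto simp: inj_on_def inj_def)
        moreover have "r ` {x \<in> v. r x \<in> g} = g \<inter> v"
          using rv permutes_surj[OF rX] by (auto simp: image_iff) (metis surj_def)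
        ultimately show ?thesis using card_image by fastforce
      qed
      ultimately show ?thesis using even_card_sym_diff[of "g \<inter> v" "{x \<in> v. r x \<in> g}"] finv by simp
    qed
    ultimately show ?thesis by (simp add: Cyc_def)
  qed
  \<comment> \<open>By connectedness only the two constant colourings have no jump.\<close>
  have "card G = card (jump D ` G) * card {g \<in> G. jump D g = {}}"
    using finH(3) by (rule card_xor_hom) (auto simp: G_def jump_def)
  moreover have "{g \<in> G. jump D g = {}} = {{}, X}"
  proof (intro set_eqI iffI)
    fix g assume g: "g \<in> {g \<in> G. jump D g = {}}"
    then have e: "e x \<in> g \<longleftrightarrow> x \<in> g" if "x \<in> X" for x
      using that by (auto simp: jump_def X_def e_def)
    have "r x \<in> g \<longleftrightarrow> x \<in> g" if "x \<in> X" for x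
    proof -
      have "r (e (e x)) \<in> g \<longleftrightarrow> e x \<in> g"
        using g e_in[OF that] inv_setsD(2)[of g X "r \<circ> e" "e x"] by (simp add: G_def)
      then show ?thesis using e e_e that by simp
    qed
    with e g conn[of g] show "g \<in> {{}, X}"
      by (auto simp: H_def Ed_def G_def inv_sets_def)
  qed (use triv e_in in \<open>auto simp: jump_def X_def e_def\<close>)
  ultimately have 1: "2 ^ card (faces D) = card (jump D ` G) * 2"
    using cG neX by simp
  have HCyc: "(\<forall>h\<in>H. even (card (h \<inter> k))) \<longleftrightarrow> k \<in> Cyc" if k: "k \<in> Ed" for k
  proof
    assume *: "\<forall>h\<in>H. even (card (h \<inter> k))"
    have "v \<in> H" if v: "v \<in> vertices D" for v
    proof -
      obtain d where d: "d \<in> X" "v = orbit r d"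
        using v by (auto simp: vertices_def vertex_def X_def r_def)
      then show ?thesis unfolding H_def
        using permutes_orbit_subset[OF rX d(1)] cyclic_on_f_in[OF rX cyclic_on_orbit[OF rX fin, of d]]
        by (auto intro!: inv_setsI orbit.step)
    qed
    then show "k \<in> Cyc" using * k by (auto simp: Cyc_def Int_commute)
  next
    assume k: "k \<in> Cyc"
    show "\<forall>h\<in>H. even (card (h \<inter> k))"
    proof
      fix h assume h: "h \<in> H"
      have "card (h \<inter> k) = (\<Sum>v\<in>vertices D. card (h \<inter> k \<inter> v))"
        by (rule card_partition_Int[OF partition_on_vertices[OF D] diagramD(1)[OF D]])
          (use h in \<open>auto simp: H_def X_def dest: inv_setsD\<close>)
      also have "even \<dots>"
      proof (rule dvd_sum)
        fix v assume v: "v \<in> vertices D"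
        obtain d where d: "d \<in> X" "v = orbit r d"
          using v by (auto simp: vertices_def vertex_def X_def r_def)
        have "y \<in> h \<longleftrightarrow> d \<in> h" if "y \<in> v" for y
          using that unfolding d(2)
        proof induction
          case (step y)
          have "y \<in> X" using step(1) d permutes_orbit_subset[OF rX] by auto
          then show ?case using step h by (auto simp: H_def dest: inv_setsD)
        qed (use d h in \<open>auto simp: H_def dest: inv_setsD\<close>)
        then have "h \<inter> k \<inter> v = (if d \<in> h then k \<inter> v else {})" by auto
        then show "even (card (h \<inter> k \<inter> v))" using k v by (auto simp: Cyc_def)
      qed
      finally show "even (card (h \<inter> k))" .
    qed
  qed
  have EdH: "(\<forall>k\<in>Ed. even (card (k \<inter> h))) \<longleftrightarrow> h \<in> {{}, X}" if h: "h \<in> H" for h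
  proof
    assume *: "\<forall>k\<in>Ed. even (card (k \<inter> h))"
    have "e d \<in> h \<longleftrightarrow> d \<in> h" if d: "d \<in> X" for d
    proof -
      have "e x \<in> {d, e d} \<longleftrightarrow> x \<in> {d, e d}" if "x \<in> X" for x
        using e_e[OF that] e_e[OF d] unfolding insert_iff empty_iff by metis
      then have "{d, e d} \<in> Ed" unfolding Ed_def using e_in d by (intro inv_setsI) auto
      then have "even (card ({d, e d} \<inter> h))" using * by auto
      then show ?thesis using e_neq[OF d] by (auto simp: Int_insert_left split: if_splits)
    qed
    then show "h \<in> {{}, X}" using conn[OF h] h by (auto simp: H_def Ed_def inv_sets_def)
  next
    assume "h \<in> {{}, X}"
    moreover have "even (card k)" if k: "k \<in> Ed" for k
    proof (rule even_card_involution[of k e])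
      show "finite k" using finf k by simp
      fix y assume y: "y \<in> k"
      then have "y \<in> X" using inv_setsD(1)[OF k[unfolded Ed_def]] by auto
      then show "e y \<in> k \<and> e (e y) = y \<and> e y \<noteq> y"
        using inv_setsD(2)[OF k[unfolded Ed_def]] y e_e e_neq by simp
    qed
    moreover have "k \<inter> X = k" if "k \<in> Ed" for k using that by (auto simp: Ed_def dest: inv_setsD)
    ultimately show "\<forall>k\<in>Ed. even (card (k \<inter> h))" by auto
  qed
  \<comment> \<open>Double count of the sum of \<open>(- 1) ^ card (h \<inter> k)\<close>: summing
    over \<open>h\<close> first detects the cycles \<open>k\<close>; summing over \<open>k\<close>
    first detects the \<open>h\<close> constant along edges, of which connectedness leaves
    two.\<close>
  have "int (card H * card Cyc) = (\<Sum>k\<in>Ed. if k \<in> Cyc then int (card H) else 0)"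
  proof -
    have "Ed \<inter> {k. k \<in> Cyc} = Cyc" by (auto simp: Cyc_def)
    then show ?thesis using finH by (simp add: sum.If_cases)
  qed
  also have "\<dots> = (\<Sum>k\<in>Ed. \<Sum>h\<in>H. (- 1) ^ card (h \<inter> k))"
  proof (rule sum.cong[OF refl])
    fix k assume k: "k \<in> Ed"
    have "(\<Sum>h\<in>H. (- 1) ^ card (h \<inter> k)) =
        (if \<forall>h\<in>H. even (card (h \<inter> k)) then of_nat (card H) else 0 :: int)"
      by (rule sum_parity_character[of H "\<lambda>h. h"]) (use finH finf in \<open>auto simp: H_def\<close>)
    then show "(if k \<in> Cyc then int (card H) else 0) = (\<Sum>h\<in>H. (- 1) ^ card (h \<inter> k))"
      using HCyc[OF k] by simp
  qed
  also have "\<dots> = (\<Sum>h\<in>H. \<Sum>k\<in>Ed. (- 1) ^ card (k \<inter> h))"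
    by (subst sum.swap) (simp add: Int_commute)
  also have "\<dots> = (\<Sum>h\<in>H. if h \<in> {{}, X} then int (card Ed) else 0)"
  proof (rule sum.cong[OF refl])
    fix h assume h: "h \<in> H"
    have "(\<Sum>k\<in>Ed. (- 1) ^ card (k \<inter> h)) =
        (if \<forall>k\<in>Ed. even (card (k \<inter> h)) then of_nat (card Ed) else 0 :: int)"
      by (rule sum_parity_character[of Ed "\<lambda>h. h"]) (use finH finf in \<open>auto simp: Ed_def\<close>)
    then show "(\<Sum>k\<in>Ed. (- 1) ^ card (k \<inter> h)) = (if h \<in> {{}, X} then int (card Ed) else 0)"
      using EdH[OF h] by simp
  qed
  also have "\<dots> = int (card Ed) * int (card (H \<inter> {{}, X}))"
    unfolding sum.inter_restrict[OF finH(1), symmetric] by simp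
  also have "H \<inter> {{}, X} = {{}, X}" using triv by auto
  finally have "card H * card Cyc = card Ed * 2" using neX by (simp flip: of_nat_mult)
  moreover have "card (vertices D) + card (faces D) = card (edges D) + 2"
    using D unfolding diagram_def by (elim conjE)
  ultimately have "2 ^ card (vertices D) * (card Cyc * 2) = 2 ^ card (vertices D) * 2 ^ card (faces D)"
    using cH cEd by (simp flip: power_add) (simp add: power_add mult.commute)
  then have "card (jump D ` G) = card Cyc" using 1 by simp
  then have "jump D ` G = Cyc"
    using jump_in finH by (intro card_subset_eq) auto
  moreover have "f \<in> Cyc" using f even by (simp add: Cyc_def Ed_def X_def e_def)
  ultimately show ?thesis using that by (auto simp: G_def X_def r_def e_def)
qed

section \<open>The two sides of the axis and the checkerboard colouring\<close>

locale reflected_diagram =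
  fixes D :: "'d axial_diagram" and \<rho> :: "'d \<Rightarrow> 'd"
  assumes symmetric: "symmetric_by D \<rho>"
begin

abbreviation r where "r \<equiv> rot D"
abbreviation r' where "r' \<equiv> inv (rot D)"
abbreviation e where "e \<equiv> edge D"
abbreviation off where "off \<equiv> off_crossings D"
abbreviation axp where "axp \<equiv> axis_points D"
abbreviation axc where "axc \<equiv> axis_crossings D"
abbreviation L where "L \<equiv> link D"
abbreviation vert where "vert \<equiv> vertex D"

lemma diag: "diagram D"
  using symmetric by (simp add: symmetric_by_def)

lemmas fin = diagramD(1)[OF diag] and r_perm = diagramD(2)[OF diag] and e_perm = diagramD(3)[OF diag]
lemmas e_neq = diagramD(4)[OF diag] and e_e = diagramD(5)[OF diag]

lemma r_in [simp]: "r d \<in> darts D \<longleftrightarrow> d \<in> darts D"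
  using permutes_in_image[OF r_perm] .

lemma e_in [simp]: "e d \<in> darts D \<longleftrightarrow> d \<in> darts D"
  using permutes_in_image[OF e_perm] .

lemma r'_in [simp]: "r' d \<in> darts D \<longleftrightarrow> d \<in> darts D"
  using permutes_in_image[OF permutes_inv[OF r_perm]] .

lemma r_r' [simp]: "r (r' d) = d" and r'_r [simp]: "r' (r d) = d"
  using permutes_inverses[OF r_perm] by auto

lemma r_eq_iff [simp]: "r x = r y \<longleftrightarrow> x = y"
  using permutes_inj[OF r_perm] by (auto simp: inj_def)

lemma axis_darts: "axis D \<subseteq> darts D" and axis_e: "a \<in> axis D \<Longrightarrow> e a \<in> axis D"
  and axis_opp: "a \<in> axis D \<Longrightarrow> opp D a \<in> axis D"
  and card_axis: "card (curves D (opp D) (axis D)) = 1"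
  and vertices_cases: "vertices D = off \<union> axp \<union> axc"
  using diag unfolding diagram_def by simp_all

lemma over_link: "over D \<subseteq> L \<inter> \<Union> (crossings D)"
  and over_opp: "d \<in> L \<inter> \<Union> (crossings D) \<Longrightarrow> opp D d \<in> over D \<longleftrightarrow> d \<in> over D"
  and over_off: "v \<in> off \<Longrightarrow> d \<in> v \<Longrightarrow> r d \<in> over D \<longleftrightarrow> d \<notin> over D"
  and over_axc: "v \<in> axc \<Longrightarrow> a \<in> v \<inter> axis D \<Longrightarrow> r (r a) \<in> over D \<longleftrightarrow> r a \<notin> over D"
  using diag unfolding diagram_def by auto

lemma axis_nonempty: "axis D \<noteq> {}"
  using card_axis by (auto simp: curves_def quotient_def)

lemma L_darts: "d \<in> L \<Longrightarrow> d \<in> darts D"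
  by (simp add: link_def)

lemma finite_L: "finite L"
  using fin by (simp add: link_def)

lemma e_axis [simp]: "e d \<in> axis D \<longleftrightarrow> d \<in> axis D"
proof
  assume a: "e d \<in> axis D"
  then have "d \<in> darts D" using axis_darts by auto
  then show "d \<in> axis D" using axis_e[OF a] e_e by simp
qed (rule axis_e)

lemma e_L [simp]: "e d \<in> L \<longleftrightarrow> d \<in> L"
  by (simp add: link_def)

subsection \<open>Local structure at the vertices\<close>

lemma permutation_r: "permutation r"
  using r_perm fin by (auto simp: permutation_permutes)

lemma vert_self: "d \<in> vert d"
  unfolding vertex_def using permutation_self_in_orbit[OF permutation_r] .

lemma vert_eq: "x \<in> vert d \<Longrightarrow> vert x = vert d"
  unfolding vertex_def using cyclic_on_orbit'[OF permutation_r] orbit_cyclic_eq3 by metis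

lemma vert_r [simp]: "vert (r d) = vert d"
  by (rule vert_eq) (simp add: vertex_def orbit.base)

lemma vert_r' [simp]: "vert (r' d) = vert d"
  using vert_r[of "r' d"] by simp

lemma vert_vertices: "d \<in> darts D \<Longrightarrow> vert d \<in> vertices D"
  by (simp add: vertices_def)

lemma vertices_vert: "v \<in> vertices D \<Longrightarrow> d \<in> v \<Longrightarrow> vert d = v"
  using vert_eq by (auto simp: vertices_def)

lemma vertices_darts: "v \<in> vertices D \<Longrightarrow> d \<in> v \<Longrightarrow> d \<in> darts D"
  using permutes_orbit_subset[OF r_perm] by (auto simp: vertices_def vertex_def)

lemma vertices_nonempty: "v \<in> vertices D \<Longrightarrow> \<exists>d. d \<in> v"
  using vert_self by (auto simp: vertices_def)

lemma finite_vertices: "finite (vertices D)"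
  using fin by (simp add: vertices_def)

lemma finite_vertex: "v \<in> vertices D \<Longrightarrow> finite v"
  by (meson fin finite_subset subsetI vertices_darts)

lemma off_vertices: "v \<in> off \<Longrightarrow> v \<in> vertices D" and axp_vertices: "v \<in> axp \<Longrightarrow> v \<in> vertices D"
  and axc_vertices: "v \<in> axc \<Longrightarrow> v \<in> vertices D"
  by (auto simp: off_crossings_def axis_points_def axis_crossings_def)

lemma off_axp: "v \<in> off \<Longrightarrow> v \<notin> axp" and off_axc: "v \<in> off \<Longrightarrow> v \<notin> axc"
  and axp_axc: "v \<in> axp \<Longrightarrow> v \<notin> axc"
  by (auto simp: off_crossings_def axis_points_def axis_crossings_def)

lemma dart_cases:
  assumes "d \<in> darts D"
  obtains "vert d \<in> off" | "vert d \<in> axp" | "vert d \<in> axc"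
  using vert_vertices[OF assms] vertices_cases by auto

lemma vert_funpow:
  "(r ^^ card (vert d)) d = d"
  "vert d = (\<lambda>i. (r ^^ i) d) ` {0..<card (vert d)}"
  "distinct (map (\<lambda>i. (r ^^ i) d) [0..<card (vert d)])"
proof -
  have self: "d \<in> orbit r d" using permutation_self_in_orbit[OF permutation_r] .
  have 1: "vert d = (\<lambda>i. (r ^^ i) d) ` {0..<funpow_dist1 r d d}"
    unfolding vertex_def by (rule orbit_conv_funpow_dist1[OF self])
  have 2: "inj_on (\<lambda>i. (r ^^ i) d) {0..<funpow_dist1 r d d}"
    by (rule inj_on_funpow_dist1[OF self])
  have 3: "card (vert d) = funpow_dist1 r d d"
    unfolding 1 using card_image[OF 2] by simp
  show "(r ^^ card (vert d)) d = d"
    unfolding 3 by (rule funpow_dist1_prop[OF self])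
  show "vert d = (\<lambda>i. (r ^^ i) d) ` {0..<card (vert d)}"
    unfolding 3 by (rule 1)
  show "distinct (map (\<lambda>i. (r ^^ i) d) [0..<card (vert d)])"
    using 2 unfolding 3 by (simp only: distinct_map distinct_upt set_upt)
qed

lemma vert4:
  assumes "card (vert d) = 4"
  shows "r (r (r (r d))) = d" "vert d = {d, r d, r (r d), r (r (r d))}" "opp D d = r (r d)"
    "distinct [d, r d, r (r d), r (r (r d))]"
proof -
  note c = vert_funpow[of d, unfolded assms]
  have s: "{0..<4::nat} = {0, 1, 2, 3}" by auto
  have p: "(r ^^ 2) d = r (r d)" "(r ^^ 3) d = r (r (r d))" "(r ^^ 4) d = r (r (r (r d)))"
    by (simp_all add: eval_nat_numeral)
  show "r (r (r (r d))) = d" using c(1) p by simp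
  show "vert d = {d, r d, r (r d), r (r (r d))}"
    unfolding c(2) s using p by simp
  show "opp D d = r (r d)" using assms p by (simp add: opp_def)
  show "distinct [d, r d, r (r d), r (r (r d))]"
    using c(3) by (simp add: upt_rec_numeral eval_nat_numeral)
qed

lemma vert6:
  assumes "card (vert d) = 6"
  shows "r (r (r (r (r (r d))))) = d"
    "vert d = {d, r d, r (r d), r (r (r d)), r (r (r (r d))), r (r (r (r (r d))))}"
    "opp D d = r (r (r d))"
    "distinct [d, r d, r (r d), r (r (r d)), r (r (r (r d))), r (r (r (r (r d))))]"
proof -
  note c = vert_funpow[of d, unfolded assms]
  have s: "{0..<6::nat} = {0, 1, 2, 3, 4, 5}" by auto
  have p: "(r ^^ 2) d = r (r d)" "(r ^^ 3) d = r (r (r d))" "(r ^^ 4) d = r (r (r (r d)))"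
    "(r ^^ 5) d = r (r (r (r (r d))))" "(r ^^ 6) d = r (r (r (r (r (r d)))))"
    by (simp_all add: eval_nat_numeral)
  show "r (r (r (r (r (r d))))) = d" using c(1) p by simp
  show "vert d = {d, r d, r (r d), r (r (r d)), r (r (r (r d))), r (r (r (r (r d))))}"
    unfolding c(2) s using p by simp
  show "opp D d = r (r (r d))" using assms p by (simp add: opp_def)
  show "distinct [d, r d, r (r d), r (r (r d)), r (r (r (r d))), r (r (r (r (r d))))]"
    using c(3) by (simp add: upt_rec_numeral eval_nat_numeral)
qed

lemma off_link:
  assumes "v \<in> off" "d \<in> v"
  shows "d \<in> L"
proof -
  have "card (v \<inter> axis D) = 0" "v \<in> vertices D" using assms by (simp_all add: off_crossings_def)
  then have "v \<inter> axis D = {}" "d \<in> darts D" using finite_vertex vertices_darts assms by simp_all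
  then show ?thesis using assms by (auto simp: link_def)
qed

lemma off4:
  assumes "vert d \<in> off"
  shows "r (r (r (r d))) = d" "vert d = {d, r d, r (r d), r (r (r d))}" "opp D d = r (r d)"
    "distinct [d, r d, r (r d), r (r (r d))]" "r' d = r (r (r d))"
proof -
  have c: "card (vert d) = 4" using assms by (simp add: off_crossings_def)
  show "r (r (r (r d))) = d" "vert d = {d, r d, r (r d), r (r (r d))}" "opp D d = r (r d)"
    "distinct [d, r d, r (r d), r (r (r d))]" by (fact vert4[OF c])+
  then show "r' d = r (r (r d))" by (metis r'_r)
qed

lemma axp_link:
  assumes "vert d \<in> axp" "d \<in> L"
  shows "r d \<in> axis D" "r' d \<in> axis D" "opp D d = r (r d)" "opp D d = r' (r' d)" "r (r d) \<in> L"
proof -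
  have c: "card (vert d) = 4" "card (vert d \<inter> axis D) = 2" using assms by (auto simp: axis_points_def)
  note 4 = vert4[OF c(1)]
  have r2: "r (r d) \<notin> axis D"
  proof
    assume "r (r d) \<in> axis D"
    then have "opp D (r (r d)) \<in> axis D" by (rule axis_opp)
    moreover have "opp D (r (r d)) = d" using vert4(3)[of "r (r d)"] c 4(1) by simp
    ultimately show False using assms by (simp add: link_def)
  qed
  have sub: "vert d \<inter> axis D \<subseteq> {r d, r (r (r d))}"
    using 4(2) r2 assms(2) by (auto simp: link_def)
  have "vert d \<inter> axis D = {r d, r (r (r d))}"
    by (rule card_subset_eq[OF _ sub]) (use c 4(4) in auto)
  moreover have "r' d = r (r (r d))" using 4(1) by (metis r'_r)
  ultimately show "r d \<in> axis D" "r' d \<in> axis D" by auto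
  show "opp D d = r (r d)" by (fact 4(3))
  then show "opp D d = r' (r' d)" using 4(1) \<open>r' d = r (r (r d))\<close> by (metis r'_r)
  show "r (r d) \<in> L" using r2 assms(2) by (simp add: link_def)
qed

lemma axp_axis:
  assumes "vert a \<in> axp" "a \<in> axis D"
  shows "r a \<in> L" "r' a \<in> L" "opp D a = r (r a)" "vert a = {a, r a, r (r a), r' a}"
proof -
  have c: "card (vert a) = 4" "card (vert a \<inter> axis D) = 2" using assms by (auto simp: axis_points_def)
  note 4 = vert4[OF c(1)]
  have "r (r a) \<in> axis D" using axis_opp[OF assms(2)] 4(3) by simp
  then have "{a, r (r a)} \<subseteq> vert a \<inter> axis D" using assms(2) 4(2) by auto
  then have *: "{a, r (r a)} = vert a \<inter> axis D"
    by (rule card_subset_eq[rotated]) (use c 4(4) card_ge_0_finite in force)+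
  have r': "r' a = r (r (r a))" using 4(1) by (metis r'_r)
  have "a \<in> darts D" using assms(2) axis_darts by auto
  moreover have n: "x \<notin> axis D" if "x \<in> vert a" "x \<noteq> a" "x \<noteq> r (r a)" for x using * that by blast
  have "r a \<notin> axis D" by (rule n) (use 4(2,4) in auto)
  moreover have "r' a \<notin> axis D" unfolding r' by (rule n) (use 4(2,4) in auto)
  ultimately show "r a \<in> L" "r' a \<in> L" by (simp_all add: link_def)
  show "opp D a = r (r a)" by (fact 4(3))
  show "vert a = {a, r a, r (r a), r' a}" unfolding r' by (fact 4(2))
qed

text \<open>Counterclockwise from \<open>a\<close> there are two link darts, the opposite axis dart
  and two more link darts. Writing the last two with \<open>r'\<close> displays the reflection in
  the axis, which exchanges \<open>r\<close> and \<open>r'\<close>.\<close>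

lemma axc_axis:
  assumes "vert a \<in> axc" "a \<in> axis D"
  shows "r a \<in> L" "r (r a) \<in> L" "r' a \<in> L" "r' (r' a) \<in> L" "r (r (r a)) \<in> axis D"
    "r' (r' (r' a)) = r (r (r a))" "opp D (r a) = r' (r' a)" "opp D (r' a) = r (r a)"
    "vert a = {a, r a, r (r a), r (r (r a)), r' (r' a), r' a}"
    "distinct [a, r a, r (r a), r (r (r a)), r' (r' a), r' a]"
proof -
  have c: "card (vert a) = 6" "card (vert a \<inter> axis D) = 2" using assms by (auto simp: axis_crossings_def)
  note 6 = vert6[OF c(1)]
  have a: "a \<in> darts D" using assms(2) axis_darts by auto
  show r3: "r (r (r a)) \<in> axis D" using axis_opp[OF assms(2)] 6(3) by simp
  have "{a, r (r (r a))} \<subseteq> vert a \<inter> axis D" using assms(2) 6(2) r3 by auto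
  then have *: "{a, r (r (r a))} = vert a \<inter> axis D"
    by (rule card_subset_eq[rotated]) (use c 6(4) card_ge_0_finite in force)+
  have r5: "r' a = r (r (r (r (r a))))" using 6(1) by (metis r'_r)
  then have r4: "r' (r' a) = r (r (r (r a)))" by simp
  then show "r' (r' (r' a)) = r (r (r a))" by simp
  have n: "x \<notin> axis D" if "x \<in> vert a" "x \<noteq> a" "x \<noteq> r (r (r a))" for x using * that by blast
  have "r a \<notin> axis D" by (rule n) (use 6(2,4) in auto)
  moreover have "r (r a) \<notin> axis D" by (rule n) (use 6(2,4) in auto)
  moreover have "r' a \<notin> axis D" unfolding r5 by (rule n) (use 6(2,4) in auto)
  moreover have "r' (r' a) \<notin> axis D" unfolding r4 by (rule n) (use 6(2,4) in auto)
  ultimately show "r a \<in> L" "r (r a) \<in> L" "r' a \<in> L" "r' (r' a) \<in> L"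
    using a by (simp_all add: link_def)
  show "opp D (r a) = r' (r' a)" using vert6(3)[of "r a"] c r4 by simp
  show "opp D (r' a) = r (r a)" using vert6(3)[of "r' a"] c by simp
  show "vert a = {a, r a, r (r a), r (r (r a)), r' (r' a), r' a}"
    unfolding r4 unfolding r5 by (fact 6(2))
  show "distinct [a, r a, r (r a), r (r (r a)), r' (r' a), r' a]"
    unfolding r4 unfolding r5 by (fact 6(4))
qed

lemma axis_in_vertex:
  assumes "v \<in> axp \<union> axc"
  obtains a where "a \<in> v" "a \<in> axis D" "v = vert a"
proof -
  have "card (v \<inter> axis D) = 2" using assms by (auto simp: axis_points_def axis_crossings_def)
  then have "v \<inter> axis D \<noteq> {}" by auto
  then obtain a where a: "a \<in> v" "a \<in> axis D" by auto
  have "v \<in> vertices D" using assms axp_vertices axc_vertices by auto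
  then show ?thesis using that[OF a] vertices_vert[of v a] a by simp
qed

lemma axc_link:
  assumes "vert d \<in> axc" "d \<in> L"
  obtains (before) "r d \<in> axis D" "r' d \<in> L" | (after) "r' d \<in> axis D" "r d \<in> L"
proof -
  obtain a where a: "a \<in> vert d" "a \<in> axis D" "vert d = vert a"
    using axis_in_vertex assms(1) by blast
  note A = axc_axis[of a, unfolded a(3)[symmetric], OF assms(1) a(2)]
  have "d \<in> {a, r a, r (r a), r (r (r a)), r' (r' a), r' a}" using A(9) vert_self by blast
  moreover have "d \<noteq> a" "d \<noteq> r (r (r a))" using assms(2) a(2) A(5) by (auto simp: link_def)
  ultimately consider "d = r a" | "d = r (r a)" | "d = r' (r' a)" | "d = r' a" by blast
  then show ?thesis
  proof cases
    case 1
    then show ?thesis using that(2) a A(2) by simp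
  next
    case 2
    then show ?thesis using that(1) a A(1,5) by simp
  next
    case 3
    then show ?thesis using that(2) A(3,5,6) by simp
  next
    case 4
    then show ?thesis using that(1) a A(4) by simp
  qed
qed

subsection \<open>The reflection\<close>

lemma \<rho>_perm: "\<rho> permutes darts D"
  and \<rho>_\<rho>: "d \<in> darts D \<Longrightarrow> \<rho> (\<rho> d) = d" and \<rho>_e: "d \<in> darts D \<Longrightarrow> e (\<rho> d) = \<rho> (e d)"
  and r_\<rho>_r: "d \<in> darts D \<Longrightarrow> r (\<rho> (r d)) = \<rho> d" and \<rho>_axis: "a \<in> axis D \<Longrightarrow> \<rho> a = a"
  and \<rho>_over: "v \<in> off \<Longrightarrow> d \<in> v \<Longrightarrow> \<rho> d \<in> over D \<longleftrightarrow> d \<in> over D"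
  using symmetric by (auto simp: symmetric_by_def axial_reflection_def)

lemma \<rho>_in [simp]: "\<rho> d \<in> darts D \<longleftrightarrow> d \<in> darts D"
  using permutes_in_image[OF \<rho>_perm] .

lemma \<rho>_in_axis [simp]: "\<rho> d \<in> axis D \<longleftrightarrow> d \<in> axis D"
proof
  assume a: "\<rho> d \<in> axis D"
  then have "d \<in> darts D" using axis_darts \<rho>_in by blast
  then show "d \<in> axis D" using \<rho>_axis[OF a] \<rho>_\<rho> a by metis
qed (simp add: \<rho>_axis)

lemma \<rho>_L [simp]: "\<rho> d \<in> L \<longleftrightarrow> d \<in> L"
  by (simp add: link_def)

lemma \<rho>_r: "d \<in> darts D \<Longrightarrow> \<rho> (r d) = r' (\<rho> d)"
  using r_\<rho>_r by (metis r'_r)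

lemma \<rho>_r': "d \<in> darts D \<Longrightarrow> \<rho> (r' d) = r (\<rho> d)"
  using r_\<rho>_r[of "r' d"] by simp

lemma vert_\<rho>: "d \<in> darts D \<Longrightarrow> vert (\<rho> d) = \<rho> ` vert d"
proof -
  assume d: "d \<in> darts D"
  have "vert (\<rho> d) = orbit r' (\<rho> d)"
    unfolding vertex_def using orbit_inv_eq[OF permutation_r] by simp
  also have "\<dots> = \<rho> ` orbit r d"
  proof (rule orbit_inverse[symmetric])
    show "d \<in> orbit r d" using permutation_self_in_orbit[OF permutation_r] .
    show "r' (\<rho> x) = \<rho> (r x)" if "x \<in> orbit r d" for x
      using that permutes_orbit_subset[OF r_perm d] \<rho>_r by auto
  qed
  finally show ?thesis by (simp add: vertex_def)
qed

lemma card_\<rho>_image: "card (\<rho> ` Y) = card Y"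
  using permutes_inj[OF \<rho>_perm] by (intro card_image) (auto simp: inj_on_def inj_def)

lemma card_\<rho>_image_axis: "card (\<rho> ` Y \<inter> axis D) = card (Y \<inter> axis D)"
proof -
  have "\<rho> ` Y \<inter> axis D = \<rho> ` (Y \<inter> axis D)" by auto
  then show ?thesis using card_\<rho>_image by simp
qed

lemma vert_\<rho>_cases:
  assumes "d \<in> darts D"
  shows "vert (\<rho> d) \<in> off \<longleftrightarrow> vert d \<in> off"
    "vert d \<in> axp \<union> axc \<Longrightarrow> vert (\<rho> d) = vert d"
proof -
  show "vert (\<rho> d) \<in> off \<longleftrightarrow> vert d \<in> off"
    using assms vert_vertices[of d] vert_vertices[of "\<rho> d"]
    by (simp add: off_crossings_def vert_\<rho> card_\<rho>_image card_\<rho>_image_axis)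
  assume "vert d \<in> axp \<union> axc"
  then obtain a where a: "a \<in> vert d" "a \<in> axis D" "vert d = vert a" by (rule axis_in_vertex)
  have "a \<in> \<rho> ` vert d" using a \<rho>_axis by (metis imageI)
  then have "a \<in> vert (\<rho> d)" using assms vert_\<rho> by simp
  then show "vert (\<rho> d) = vert d" using vert_eq[of a "\<rho> d"] a by simp
qed

lemma \<rho>_at_axis:
  assumes "a \<in> axis D"
  shows "\<rho> (r a) = r' a" "\<rho> (r' a) = r a" "\<rho> (r (r a)) = r' (r' a)" "\<rho> (r' (r' a)) = r (r a)"
  using assms axis_darts \<rho>_axis by (auto simp: \<rho>_r \<rho>_r' subset_iff)

subsection \<open>Potentials of the axis and of the link\<close>

lemma potential_step:
  assumes "g \<in> inv_sets (darts D) (r \<circ> e)" "d \<in> darts D"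
  shows "r d \<in> g \<longleftrightarrow> e d \<in> g"
  using inv_setsD(2)[OF assms(1), of "e d"] assms(2) e_e by simp

text \<open>Reflection carries the region to the right of \<open>d\<close> to the one to the left of
  \<open>\<rho> d\<close>, whence \<open>e (\<rho> d)\<close>. The reflected potential has the same
  jumps, so by connectedness the two differ by a constant.\<close>

lemma potential_reflect:
  assumes g: "g \<in> inv_sets (darts D) (r \<circ> e)" and J: "\<And>d. d \<in> jump D g \<Longrightarrow> \<rho> d \<in> jump D g"
  shows "(\<forall>d\<in>darts D. e (\<rho> d) \<in> g \<longleftrightarrow> d \<in> g) \<or> (\<forall>d\<in>darts D. e (\<rho> d) \<in> g \<longleftrightarrow> d \<notin> g)"
proof -
  define m where "m = {d \<in> darts D. e (\<rho> d) \<in> g}"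
  have mG: "r d \<in> m \<longleftrightarrow> e d \<in> m" if d: "d \<in> darts D" for d
  proof -
    have "e (\<rho> (r d)) \<in> g \<longleftrightarrow> \<rho> d \<in> g"
      using potential_step[OF g, of "r' (\<rho> d)"] d by (simp add: \<rho>_r)
    moreover have "e (\<rho> (e d)) = \<rho> d"
      using d e_e[of "\<rho> d"] by (simp flip: \<rho>_e)
    ultimately show ?thesis using d by (simp add: m_def)
  qed
  have mJ: "(d \<in> m \<longleftrightarrow> e d \<notin> m) \<longleftrightarrow> (d \<in> g \<longleftrightarrow> e d \<notin> g)" if d: "d \<in> darts D" for d
  proof -
    have "d \<in> jump D g \<longleftrightarrow> \<rho> d \<in> jump D g" using J[of d] J[of "\<rho> d"] \<rho>_\<rho> d by auto
    moreover have "e (\<rho> (e d)) = \<rho> d"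
      using d e_e[of "\<rho> d"] by (simp flip: \<rho>_e)
    ultimately show ?thesis using d by (auto simp: m_def jump_def)
  qed
  define k where "k = sym_diff m g"
  have "k \<subseteq> darts D" using g by (auto simp: k_def m_def dest: inv_setsD)
  moreover have ek: "e d \<in> k \<longleftrightarrow> d \<in> k" if "d \<in> darts D" for d
    using mJ[OF that] by (auto simp: k_def)
  moreover have "r d \<in> k \<longleftrightarrow> d \<in> k" if "d \<in> darts D" for d
    using mG[OF that] potential_step[OF g that] ek[OF that] by (auto simp: k_def)
  ultimately have "k = {} \<or> k = darts D"
    by (intro diagram_connected[OF diag] inv_setsI)
  then show ?thesis
  proof
    assume "k = {}"
    then have "m = g" by (auto simp: k_def)
    then show ?thesis by (auto simp: m_def)
  next
    assume "k = darts D"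
    then have "d \<in> m \<longleftrightarrow> d \<notin> g" if "d \<in> darts D" for d using that by (auto simp: k_def)
    then show ?thesis by (auto simp: m_def)
  qed
qed

lemma vertex_axis_even:
  assumes "v \<in> vertices D"
  shows "even (card v)" "even (card (v \<inter> axis D))"
  using assms unfolding vertices_cases
  by (auto simp: off_crossings_def axis_points_def axis_crossings_def)

lemma ex_side: "\<exists>g. g \<in> inv_sets (darts D) (r \<circ> e) \<and> axis D = jump D g"
proof (rule cycle_is_boundary[OF diag])
  show "axis D \<in> inv_sets (darts D) e" using axis_darts by (intro inv_setsI) auto
  show "even (card (axis D \<inter> v))" if "v \<in> vertices D" for v
    using vertex_axis_even(2)[OF that] by (simp add: Int_commute)
qed blast

lemma ex_checkerboard: "\<exists>g. g \<in> inv_sets (darts D) (r \<circ> e) \<and> L = jump D g"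
proof (rule cycle_is_boundary[OF diag])
  show "L \<in> inv_sets (darts D) e" by (intro inv_setsI) (auto simp: link_def)
  show "even (card (L \<inter> v))" if v: "v \<in> vertices D" for v
  proof -
    have "L \<inter> v = v - (v \<inter> axis D)" using vertices_darts[OF v] by (auto simp: link_def)
    then have "card (L \<inter> v) = card v - card (v \<inter> axis D)"
      using finite_vertex[OF v] by (simp add: card_Diff_subset)
    then show ?thesis using vertex_axis_even[OF v] by simp
  qed
qed blast

text \<open>A potential whose jumps are the axis: the darts with one of the two half-planes on their
  right, the choice fixing which one. A link dart has the same half-plane on both sides, so there it
  tells where the dart lies.\<close>

definition side where
  "side = (SOME g. g \<in> inv_sets (darts D) (r \<circ> e) \<and> axis D = jump D g)"

definition black where
  "black = (SOME g. g \<in> inv_sets (darts D) (r \<circ> e) \<and> L = jump D g)"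

lemma side: "side \<in> inv_sets (darts D) (r \<circ> e)" "jump D side = axis D"
  using someI_ex[OF ex_side] by (auto simp: side_def)

lemma black: "black \<in> inv_sets (darts D) (r \<circ> e)" "jump D black = L"
  using someI_ex[OF ex_checkerboard] by (auto simp: black_def)

lemma side_link:
  assumes "d \<in> L"
  shows "e d \<in> side \<longleftrightarrow> d \<in> side" "r d \<in> side \<longleftrightarrow> d \<in> side"
proof -
  have "d \<in> darts D" "d \<notin> jump D side" using assms side(2) by (auto simp: link_def)
  then show "e d \<in> side \<longleftrightarrow> d \<in> side" by (auto simp: jump_def)
  then show "r d \<in> side \<longleftrightarrow> d \<in> side" using potential_step[OF side(1) \<open>d \<in> darts D\<close>] by simp
qed

lemma side_axis:
  assumes "a \<in> axis D"
  shows "e a \<in> side \<longleftrightarrow> a \<notin> side" "r a \<in> side \<longleftrightarrow> a \<notin> side"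
proof -
  have "a \<in> darts D" "a \<in> jump D side" using assms side(2) axis_darts by auto
  then show "e a \<in> side \<longleftrightarrow> a \<notin> side" by (auto simp: jump_def)
  then show "r a \<in> side \<longleftrightarrow> a \<notin> side" using potential_step[OF side(1) \<open>a \<in> darts D\<close>] by simp
qed

lemma black_link:
  assumes "d \<in> L"
  shows "e d \<in> black \<longleftrightarrow> d \<notin> black" "r d \<in> black \<longleftrightarrow> d \<notin> black"
proof -
  have "d \<in> darts D" "d \<in> jump D black" using assms black(2) by (auto simp: link_def)
  then show "e d \<in> black \<longleftrightarrow> d \<notin> black" by (auto simp: jump_def)
  then show "r d \<in> black \<longleftrightarrow> d \<notin> black" using potential_step[OF black(1) \<open>d \<in> darts D\<close>] by simp
qed

lemma black_axis:
  assumes "a \<in> axis D"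
  shows "e a \<in> black \<longleftrightarrow> a \<in> black" "r a \<in> black \<longleftrightarrow> a \<in> black"
proof -
  have "a \<in> darts D" "a \<notin> jump D black" using assms black(2) axis_darts by (auto simp: link_def)
  then show "e a \<in> black \<longleftrightarrow> a \<in> black" by (auto simp: jump_def)
  then show "r a \<in> black \<longleftrightarrow> a \<in> black" using potential_step[OF black(1) \<open>a \<in> darts D\<close>] by simp
qed

text \<open>An axis dart is fixed by the reflection, while the regions on its two sides belong to
  different half-planes. This decides between the two alternatives of
  \<open>potential_reflect\<close>.\<close>

lemma side_\<rho>:
  assumes "d \<in> L"
  shows "\<rho> d \<in> side \<longleftrightarrow> d \<notin> side"
proof -
  obtain a where a: "a \<in> axis D" using axis_nonempty by auto
  have "\<not> (e (\<rho> a) \<in> side \<longleftrightarrow> a \<in> side)" using side_axis[OF a] \<rho>_axis[OF a] by simp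
  then have "e (\<rho> d) \<in> side \<longleftrightarrow> d \<notin> side"
    using potential_reflect[OF side(1)] side(2) a axis_darts L_darts[OF assms] by auto
  then show ?thesis using side_link(1)[of "\<rho> d"] assms by simp
qed

text \<open>The checkerboard colouring is mirror symmetric, since both sides of an axis edge have
  the same colour. But right and left are exchanged, so a link dart and its image see opposite
  colours on their right.\<close>

lemma black_\<rho>:
  assumes "d \<in> L"
  shows "\<rho> d \<in> black \<longleftrightarrow> d \<notin> black"
proof -
  obtain a where a: "a \<in> axis D" using axis_nonempty by auto
  have "e (\<rho> a) \<in> black \<longleftrightarrow> a \<in> black" using black_axis[OF a] \<rho>_axis[OF a] by simp
  then have "e (\<rho> d) \<in> black \<longleftrightarrow> d \<in> black"
    using potential_reflect[OF black(1)] black(2) a axis_darts L_darts[OF assms] by auto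
  then show ?thesis using black_link(1)[of "\<rho> d"] assms by auto
qed

end

section \<open>Colourings of states\<close>

context reflected_diagram
begin

text \<open>
  The checkerboard colouring singles out, at every crossing off the axis, the smoothing \<open>bs\<close>
  following the boundary of the black regions and the smoothing \<open>ws\<close> following that of the white
  ones; \<open>black\<close> consists of the darts with a black region to the right.
\<close>

definition bs where "bs d = (if d \<in> black then r' d else r d)"
definition ws where "ws d = (if d \<in> black then r d else r' d)"

abbreviation sv where "sv \<equiv> smooth_v D"

lemma r'_link:
  assumes "r' d \<in> L"
  shows "r' d \<in> side \<longleftrightarrow> d \<in> side" "r' d \<in> black \<longleftrightarrow> d \<notin> black"
  using side_link(2)[OF assms] black_link(2)[OF assms] by auto

lemma off_r:
  assumes "vert d \<in> off"
  shows "d \<in> L" "r d \<in> L" "r' d \<in> L"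
  using off_link[OF assms] vert_self[of d] vert_self[of "r d"] vert_self[of "r' d"] by auto

text \<open>The reflection exchanges \<open>r\<close> with \<open>r'\<close> and, at the same time,
  membership in \<open>black\<close> with its negation; therefore it commutes with \<open>bs\<close>
  and \<open>ws\<close>.\<close>

lemma off_smoothings:
  assumes v: "vert d \<in> off"
  shows "vert (bs d) = vert d" "bs (bs d) = d" "bs d \<in> L" "bs d \<in> black \<longleftrightarrow> d \<notin> black"
    "bs d \<in> side \<longleftrightarrow> d \<in> side" "\<rho> (bs d) = bs (\<rho> d)"
    "vert (ws d) = vert d" "ws (ws d) = d" "ws d \<in> L" "ws d \<in> black \<longleftrightarrow> d \<notin> black"
    "ws d \<in> side \<longleftrightarrow> d \<in> side" "\<rho> (ws d) = ws (\<rho> d)"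
proof -
  note L = off_r[OF v] and d = L_darts[OF off_r(1)[OF v]]
  note b = black_link(2)[OF L(1)] r'_link(2)[OF L(3)]
  note s = side_link(2)[OF L(1)] r'_link(1)[OF L(3)]
  show "vert (bs d) = vert d" "vert (ws d) = vert d" by (auto simp: bs_def ws_def)
  show "bs (bs d) = d" "ws (ws d) = d" using b by (auto simp: bs_def ws_def)
  show "bs d \<in> L" "ws d \<in> L" using L by (auto simp: bs_def ws_def)
  show "bs d \<in> black \<longleftrightarrow> d \<notin> black" "ws d \<in> black \<longleftrightarrow> d \<notin> black"
    using b by (auto simp: bs_def ws_def)
  show "bs d \<in> side \<longleftrightarrow> d \<in> side" "ws d \<in> side \<longleftrightarrow> d \<in> side"
    using s by (auto simp: bs_def ws_def)
  show "\<rho> (bs d) = bs (\<rho> d)" "\<rho> (ws d) = ws (\<rho> d)"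
    using black_\<rho>[OF L(1)] d by (auto simp: bs_def ws_def \<rho>_r \<rho>_r')
qed

text \<open>The two smoothings and their composite, going straight on, act on the four darts as
  Klein's four-group.\<close>

lemma off_opp:
  assumes v: "vert d \<in> off"
  shows "opp D d = bs (ws d)" "opp D d = ws (bs d)" "vert d = {d, bs d, ws d, opp D d}"
    "distinct [d, bs d, ws d, opp D d]"
proof -
  note L = off_r[OF v]
  note b = black_link(2)[OF L(1)] r'_link(2)[OF L(3)]
  note 4 = off4[OF v]
  have r'r': "r' (r' d) = r (r d)" using 4(5) by simp
  show "opp D d = bs (ws d)" "opp D d = ws (bs d)"
    using b 4(3) r'r' by (auto simp: bs_def ws_def)
  show "vert d = {d, bs d, ws d, opp D d}"
    using 4(2) unfolding 4(3) bs_def ws_def 4(5) by auto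
  show "distinct [d, bs d, ws d, opp D d]"
    using 4(4) unfolding 4(3) bs_def ws_def 4(5) by auto
qed

lemma axp_opp:
  assumes "vert d \<in> axp" "d \<in> L"
  shows "opp D d = \<rho> d"
  using axp_link[OF assms] \<rho>_at_axis(2)[of "r d"] by simp

lemma axc_smooth_h:
  assumes "vert d \<in> axc" "d \<in> L"
  shows "smooth_h D d = \<rho> d"
  using assms
proof (cases rule: axc_link)
  case before
  then show ?thesis using \<rho>_at_axis(2)[of "r d"] by (simp add: smooth_h_def)
next
  case after
  then show ?thesis using \<rho>_at_axis(1)[of "r' d"] by (simp add: smooth_h_def link_def)
qed

text \<open>As off the axis, the three matchings of the link darts form Klein's four-group:
  \<open>h\<close> is \<open>\<rho>\<close>, and going straight on is the composite of
  \<open>h\<close> and \<open>v\<close>.\<close>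

lemma axc_smooth_v:
  assumes v: "vert d \<in> axc" and d: "d \<in> L"
  shows "vert (sv d) = vert d" "sv (sv d) = d" "sv d \<in> L" "sv d \<in> black \<longleftrightarrow> d \<notin> black"
    "sv d \<in> side \<longleftrightarrow> d \<in> side" "\<rho> (sv d) = sv (\<rho> d)" "opp D d = \<rho> (sv d)"
proof -
  have "vert (sv d) = vert d \<and> sv (sv d) = d \<and> sv d \<in> L \<and> (sv d \<in> black \<longleftrightarrow> d \<notin> black) \<and>
    (sv d \<in> side \<longleftrightarrow> d \<in> side) \<and> \<rho> (sv d) = sv (\<rho> d) \<and> opp D d = \<rho> (sv d)"
    using assms
  proof (cases rule: axc_link)
    case before
    let ?a = "r d"
    have va: "vert ?a \<in> axc" using v by simp
    note A = axc_axis[OF va before(1)]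
    have s: "sv d = r' d" using before by (simp add: smooth_v_def)
    have "r (r' d) \<notin> axis D" using d by (simp add: link_def)
    then have "sv (r' d) = d" by (simp add: smooth_v_def)
    moreover have "\<rho> d = r ?a" using \<rho>_at_axis(2)[OF before(1)] by simp
    moreover have "\<rho> (r' d) = r (r ?a)" using \<rho>_at_axis(4)[OF before(1)] by simp
    moreover have "sv (r ?a) = r (r ?a)" using A(2) by (simp add: smooth_v_def link_def)
    ultimately show ?thesis
      using s r'_link[OF before(2)] A(8) before by simp
  next
    case after
    let ?a = "r' d"
    have va: "vert ?a \<in> axc" using v by simp
    note A = axc_axis[OF va after(1)]
    have s: "sv d = r d" using after by (simp add: smooth_v_def link_def)
    have "r (r d) \<in> axis D" using A(5) by simp
    then have "sv (r d) = d" by (simp add: smooth_v_def)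
    moreover have "\<rho> d = r' ?a" using \<rho>_at_axis(1)[OF after(1)] by simp
    moreover have "\<rho> (r d) = r' (r' ?a)" using \<rho>_at_axis(3)[OF after(1)] by simp
    moreover have "sv (r' ?a) = r' (r' ?a)" using after(1) by (simp add: smooth_v_def link_def)
    ultimately show ?thesis
      using s side_link(2)[OF d] black_link(2)[OF d] A(7) after by simp
  qed
  then show "vert (sv d) = vert d" "sv (sv d) = d" "sv d \<in> L" "sv d \<in> black \<longleftrightarrow> d \<notin> black"
    "sv d \<in> side \<longleftrightarrow> d \<in> side" "\<rho> (sv d) = sv (\<rho> d)" "opp D d = \<rho> (sv d)" by blast+
qed

text \<open>
  \<open>T\<close> are the crossings on the axis with the smoothing \<open>h\<close>, where the matching of the ends is the
  reflection itself, as it is at the axis points.  The elements of \<open>flat T U\<close> are the unions of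
  circles of the state.
\<close>

definition jn where
  "jn T U d =
    (if vert d \<in> off then (if vert d \<in> U then ws d else bs d)
     else if vert d \<in> axp \<or> vert d \<in> T then \<rho> d
     else sv d)"

definition flat where
  "flat T U = inv_sets L e \<inter> inv_sets L (jn T U)"

lemma L_cases:
  assumes "d \<in> L"
  obtains "vert d \<in> off" | "vert d \<in> axp" "vert d \<notin> off"
    | "vert d \<in> axc" "vert d \<notin> off" "vert d \<notin> axp"
  using dart_cases[OF L_darts[OF assms]] off_axp off_axc axp_axc by metis

lemma \<rho>_vert_axis: "d \<in> L \<Longrightarrow> vert d \<notin> off \<Longrightarrow> vert (\<rho> d) = vert d"
  using vert_\<rho>_cases(2)[of d] L_cases[of d] L_darts[of d] by blast

text \<open>The last property orients the circles of all states coherently: \<open>e\<close> and the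
  matching both exchange the darts with black on the right and those with white on the
  right.\<close>

lemma jn_props:
  assumes d: "d \<in> L"
  shows "vert (jn T U d) = vert d" "jn T U (jn T U d) = d" "jn T U d \<in> L"
    "jn T U d \<in> black \<longleftrightarrow> d \<notin> black"
proof -
  have "vert (jn T U d) = vert d \<and> jn T U (jn T U d) = d \<and> jn T U d \<in> L \<and>
    (jn T U d \<in> black \<longleftrightarrow> d \<notin> black)"
  proof (cases "vert d \<in> off")
    case True
    then show ?thesis using off_smoothings[OF True] by (simp add: jn_def)
  next
    case False
    show ?thesis
    proof (cases "vert d \<in> axp \<or> vert d \<in> T")
      case True
      then show ?thesis
        using False d black_\<rho>[OF d] \<rho>_vert_axis[OF d False] \<rho>_\<rho>[OF L_darts[OF d]]
        by (simp add: jn_def)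
    next
      case F: False
      then have "vert d \<in> axc" using False L_cases[OF d] by auto
      then show ?thesis using F False axc_smooth_v[OF _ d] by (simp add: jn_def)
    qed
  qed
  then show "vert (jn T U d) = vert d" "jn T U (jn T U d) = d" "jn T U d \<in> L"
    "jn T U d \<in> black \<longleftrightarrow> d \<notin> black" by blast+
qed

lemma jn_neq: "d \<in> L \<Longrightarrow> jn T U d \<noteq> d"
  using jn_props(4) by metis

lemma finite_flat: "finite (flat T U)"
  unfolding flat_def using finite_inv_sets[OF finite_L] by simp

lemma xor_closed_flat: "xor_closed (flat T U)"
  unfolding flat_def by (intro xor_closed_Int xor_closed_inv_sets)

lemma flatD:
  assumes "f \<in> flat T U"
  shows "f \<subseteq> L" "d \<in> L \<Longrightarrow> e d \<in> f \<longleftrightarrow> d \<in> f" "d \<in> L \<Longrightarrow> jn T U d \<in> f \<longleftrightarrow> d \<in> f"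
  using assms by (auto simp: flat_def dest: inv_setsD)

lemma flatI:
  assumes "f \<subseteq> L" "\<And>d. d \<in> L \<Longrightarrow> e d \<in> f \<longleftrightarrow> d \<in> f" "\<And>d. d \<in> L \<Longrightarrow> jn T U d \<in> f \<longleftrightarrow> d \<in> f"
  shows "f \<in> flat T U"
  using assms by (auto simp: flat_def intro!: inv_setsI)

text \<open>
  A colouring is the set of jumps of a two-colouring of the regions; its values on the black
  regions and those on the white regions give the two summands.
\<close>

lemma flat_decompose:
  assumes f: "f \<in> flat T U"
  obtains f1 f2 where "f1 \<in> flat T {}" "f2 \<in> flat T off" "f = sym_diff f1 f2"
proof -
  note fD = flatD[OF f]
  have fe: "f \<in> inv_sets (darts D) e"
  proof (rule inv_setsI)
    show "f \<subseteq> darts D" using fD(1) L_darts by auto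
    show "e d \<in> f \<longleftrightarrow> d \<in> f" if "d \<in> darts D" for d
      using fD(1) fD(2)[of d] e_L[of d] by (cases "d \<in> L") auto
  qed
  \<comment> \<open>The matching pairs the darts of \<open>f\<close> at \<open>v\<close>, so
    \<open>f\<close> is a cycle and bounds.\<close>
  have "even (card (f \<inter> v))" if v: "v \<in> vertices D" for v
  proof (rule even_card_involution[of _ "jn T U"])
    show "finite (f \<inter> v)" using finite_vertex[OF v] by simp
    fix d assume d: "d \<in> f \<inter> v"
    then have "d \<in> L" using fD(1) by auto
    moreover have "vert d = v" using vertices_vert[OF v] d by simp
    moreover have "jn T U d \<in> v"
      using jn_props(1)[OF \<open>d \<in> L\<close>, of T U] vert_self[of "jn T U d"] \<open>vert d = v\<close> by simp
    ultimately show "jn T U d \<in> f \<inter> v \<and> jn T U (jn T U d) = d \<and> jn T U d \<noteq> d"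
      using d fD(3) jn_props(2) jn_neq by simp
  qed
  then obtain g where g: "g \<in> inv_sets (darts D) (r \<circ> e)" "f = jump D g"
    using cycle_is_boundary[OF diag fe] by blast
  have step: "r d \<in> g \<longleftrightarrow> e d \<in> g" if "d \<in> darts D" for d using potential_step[OF g(1) that] .
  have stepa: "r a \<in> g \<longleftrightarrow> a \<in> g" if "a \<in> axis D" for a
  proof -
    have "a \<in> darts D" "a \<notin> jump D g" using that axis_darts fD(1) g(2) by (auto simp: link_def)
    then show ?thesis using step[of a] by (auto simp: jump_def)
  qed
  \<comment> \<open>On a link edge \<open>f1\<close> records the value of \<open>g\<close> on the
    adjacent black region, \<open>f2\<close> that on the white one.\<close>
  define f1 where "f1 = {d \<in> L. if d \<in> black then d \<in> g else e d \<in> g}"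
  define f2 where "f2 = {d \<in> L. if d \<in> black then e d \<in> g else d \<in> g}"
  have e_iff: "e d \<in> f1 \<longleftrightarrow> d \<in> f1" "e d \<in> f2 \<longleftrightarrow> d \<in> f2" if "d \<in> L" for d
    using that black_link(1)[OF that] e_e[OF L_darts[OF that]] by (auto simp: f1_def f2_def)
  have f12: "f = sym_diff f1 f2"
  proof (intro set_eqI)
    fix d
    show "d \<in> f \<longleftrightarrow> d \<in> sym_diff f1 f2"
    proof (cases "d \<in> L")
      case True
      then have "d \<in> f \<longleftrightarrow> (d \<in> g \<longleftrightarrow> e d \<notin> g)" using L_darts g(2) by (auto simp: jump_def)
      then show ?thesis using True by (auto simp: f1_def f2_def)
    qed (use fD(1) in \<open>auto simp: f1_def f2_def\<close>)
  qed
  \<comment> \<open>The potential agrees on the left of \<open>x\<close> and the right of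
    \<open>y\<close>, so the part belonging to that colour takes equal values.\<close>
  have adj: "(x \<notin> black \<longrightarrow> (y \<in> f1 \<longleftrightarrow> x \<in> f1)) \<and> (x \<in> black \<longrightarrow> (y \<in> f2 \<longleftrightarrow> x \<in> f2))"
    if "x \<in> L" "y \<in> L" "y \<in> black \<longleftrightarrow> x \<notin> black" "y \<in> g \<longleftrightarrow> e x \<in> g" for x y
    using that by (auto simp: f1_def f2_def)
  have adj1: "(x \<notin> black \<longrightarrow> (r x \<in> f1 \<longleftrightarrow> x \<in> f1)) \<and> (x \<in> black \<longrightarrow> (r x \<in> f2 \<longleftrightarrow> x \<in> f2))"
    if "x \<in> L" "r x \<in> L" for x
    using adj[OF that black_link(2)[OF that(1)] step[OF L_darts[OF that(1)]]] .
  have adj2: "(x \<notin> black \<longrightarrow> (r (r x) \<in> f1 \<longleftrightarrow> x \<in> f1)) \<and> (x \<in> black \<longrightarrow> (r (r x) \<in> f2 \<longleftrightarrow> x \<in> f2))"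
    if "x \<in> L" "r x \<in> axis D" "r (r x) \<in> L" for x
  proof (rule adj[OF that(1,3)])
    show "r (r x) \<in> black \<longleftrightarrow> x \<notin> black" using black_axis(2)[OF that(2)] black_link(2)[OF that(1)] by simp
    show "r (r x) \<in> g \<longleftrightarrow> e x \<in> g" using stepa[OF that(2)] step[OF L_darts[OF that(1)]] by simp
  qed
  \<comment> \<open>At the axis adjacency makes only one of the parts invariant under the matching;
    the other follows because \<open>f\<close> is their sum.\<close>
  have both: "(j d \<in> f1 \<longleftrightarrow> d \<in> f1) \<and> (j d \<in> f2 \<longleftrightarrow> d \<in> f2)"
    if "(j d \<in> f1 \<longleftrightarrow> d \<in> f1) \<or> (j d \<in> f2 \<longleftrightarrow> d \<in> f2)" "j d \<in> f \<longleftrightarrow> d \<in> f" for j :: "'d \<Rightarrow> 'd" and d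
    using that unfolding f12 by blast
  have r_case: "(\<rho> d \<in> f1 \<longleftrightarrow> d \<in> f1) \<or> (\<rho> d \<in> f2 \<longleftrightarrow> d \<in> f2)"
    if d: "d \<in> L" "r d \<in> axis D \<or> r' d \<in> axis D" for d
    using d(2)
  proof
    assume a: "r d \<in> axis D"
    then have "\<rho> d = r (r d)" using \<rho>_at_axis(2)[OF a] by simp
    then show ?thesis using adj2[OF d(1) a] \<rho>_L[of d] d(1) by auto
  next
    assume a: "r' d \<in> axis D"
    then have "\<rho> d = r' (r' d)" using \<rho>_at_axis(1)[OF a] by simp
    then show ?thesis using adj2[of "r' (r' d)"] a \<rho>_L[of d] d(1) by auto
  qed
  have axis_both: "(jn T U d \<in> f1 \<longleftrightarrow> d \<in> f1) \<and> (jn T U d \<in> f2 \<longleftrightarrow> d \<in> f2)"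
    if d: "d \<in> L" "vert d \<notin> off" for d
  proof (rule both)
    show "jn T U d \<in> f \<longleftrightarrow> d \<in> f" using fD(3)[OF d(1)] .
    have ax: "r d \<in> axis D \<or> r' d \<in> axis D"
      using axp_link(1) axc_link d L_cases[OF d(1)] by metis
    show "(jn T U d \<in> f1 \<longleftrightarrow> d \<in> f1) \<or> (jn T U d \<in> f2 \<longleftrightarrow> d \<in> f2)"
    proof (cases "vert d \<in> axp \<or> vert d \<in> T")
      case True
      then show ?thesis using r_case[OF d(1) ax] d by (simp add: jn_def)
    next
      case False
      then have v: "vert d \<in> axc" using d L_cases[OF d(1)] by auto
      have j: "jn T U d = sv d" using False d by (simp add: jn_def)
      have "(sv d \<in> f1 \<longleftrightarrow> d \<in> f1) \<or> (sv d \<in> f2 \<longleftrightarrow> d \<in> f2)"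
        using v d(1)
      proof (cases rule: axc_link)
        case before
        then have "sv d = r' d" by (simp add: smooth_v_def)
        then show ?thesis using adj1[of "r' d"] before d(1) by auto
      next
        case after
        then have "sv d = r d" by (simp add: smooth_v_def link_def)
        then show ?thesis using adj1[of d] after d(1) by auto
      qed
      then show ?thesis unfolding j .
    qed
  qed
  have "f1 \<in> flat T {}"
  proof (rule flatI)
    show "jn T {} d \<in> f1 \<longleftrightarrow> d \<in> f1" if d: "d \<in> L" for d
    proof (cases "vert d \<in> off")
      case True
      note L = off_r[OF True]
      show ?thesis
        using True adj1[OF L(1,2)] adj1[of "r' d"] L r'_link(2)[OF L(3)] by (auto simp: jn_def bs_def)
    next
      case False
      then have "jn T {} d = jn T U d" by (simp add: jn_def)
      then show ?thesis using axis_both[OF d False] by simp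
    qed
  qed (use e_iff in \<open>auto simp: f1_def\<close>)
  moreover have "f2 \<in> flat T off"
  proof (rule flatI)
    show "jn T off d \<in> f2 \<longleftrightarrow> d \<in> f2" if d: "d \<in> L" for d
    proof (cases "vert d \<in> off")
      case True
      note L = off_r[OF True]
      show ?thesis
        using True adj1[OF L(1,2)] adj1[of "r' d"] L r'_link(2)[OF L(3)] by (auto simp: jn_def ws_def)
    next
      case False
      then have "jn T off d = jn T U d" by (simp add: jn_def)
      then show ?thesis using axis_both[OF d False] by simp
    qed
  qed (use e_iff in \<open>auto simp: f2_def\<close>)
  ultimately show ?thesis using that f12 by blast
qed

subsection \<open>Counting colourings\<close>

definition varies where "varies f = {c \<in> off. \<not> (c \<subseteq> f \<or> c \<inter> f = {})}"

lemma varies_off: "varies f \<subseteq> off"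
  by (auto simp: varies_def)

lemma finite_off: "finite off"
  using finite_vertices off_vertices by (meson finite_subset subsetI)

lemma finite_varies: "finite (varies f)"
  using varies_off finite_off by (rule finite_subset)

lemma off_vert: "c \<in> off \<Longrightarrow> d \<in> c \<Longrightarrow> vert d = c"
  using vertices_vert off_vertices by blast

lemma off_nonempty: "c \<in> off \<Longrightarrow> \<exists>d. d \<in> c"
  using vertices_nonempty off_vertices by blast

text \<open>Under \<open>bs\<close> the four darts fall into two classes, represented by
  \<open>d\<close> and \<open>ws d\<close>.\<close>

lemma varies_bs:
  assumes c: "c \<in> off" "d \<in> c" and inv: "\<And>x. x \<in> c \<Longrightarrow> bs x \<in> f \<longleftrightarrow> x \<in> f"
  shows "c \<in> varies f \<longleftrightarrow> (ws d \<in> f \<longleftrightarrow> d \<notin> f)"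
proof -
  have v: "vert d = c" using off_vert[OF c] .
  note o = off_opp[of d, unfolded v, OF c(1)]
  have "bs d \<in> f \<longleftrightarrow> d \<in> f" using inv c by simp
  moreover have "opp D d \<in> f \<longleftrightarrow> ws d \<in> f" using inv[of "ws d"] o(1,3) by auto
  ultimately show ?thesis using c(1) unfolding varies_def by (simp add: o(3)) blast
qed

lemma varies_ws:
  assumes c: "c \<in> off" "d \<in> c" and inv: "\<And>x. x \<in> c \<Longrightarrow> ws x \<in> f \<longleftrightarrow> x \<in> f"
  shows "c \<in> varies f \<longleftrightarrow> (bs d \<in> f \<longleftrightarrow> d \<notin> f)"
proof -
  have v: "vert d = c" using off_vert[OF c] .
  note o = off_opp[of d, unfolded v, OF c(1)]
  have "ws d \<in> f \<longleftrightarrow> d \<in> f" using inv c by simp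
  moreover have "opp D d \<in> f \<longleftrightarrow> bs d \<in> f" using inv[of "bs d"] o(2,3) by auto
  ultimately show ?thesis using c(1) unfolding varies_def by (simp add: o(3)) blast
qed

lemma flat_bs: "f \<in> flat T U \<Longrightarrow> c \<in> off \<Longrightarrow> c \<notin> U \<Longrightarrow> d \<in> c \<Longrightarrow> bs d \<in> f \<longleftrightarrow> d \<in> f"
  using flatD(3)[of f T U d] off_link[of c d] off_vert[of c d] by (simp add: jn_def)

lemma flat_ws: "f \<in> flat T U \<Longrightarrow> c \<in> off \<Longrightarrow> c \<in> U \<Longrightarrow> d \<in> c \<Longrightarrow> ws d \<in> f \<longleftrightarrow> d \<in> f"
  using flatD(3)[of f T U d] off_link[of c d] off_vert[of c d] by (simp add: jn_def)

lemma not_varies: "c \<in> off \<Longrightarrow> c \<notin> varies f \<Longrightarrow> x \<in> c \<Longrightarrow> y \<in> c \<Longrightarrow> x \<in> f \<longleftrightarrow> y \<in> f"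
  by (auto simp: varies_def)

lemma off_closed: "c \<in> off \<Longrightarrow> d \<in> c \<Longrightarrow> bs d \<in> c \<and> ws d \<in> c \<and> opp D d \<in> c"
  using off_opp(3)[of d] off_vert[of c d] by auto

text \<open>Invariance under one smoothing leaves two classes at \<open>c\<close>, so varying means
  that two values differ, which is a linear condition. For arbitrary sets of darts additivity would
  fail.\<close>

lemma varies_sym_diff1:
  assumes f: "f \<in> flat T U" "g \<in> flat T U" and c: "c \<in> off"
  shows "c \<in> varies (sym_diff f g) \<longleftrightarrow> (c \<in> varies f \<longleftrightarrow> c \<notin> varies g)"
proof -
  obtain d where d: "d \<in> c" using off_nonempty[OF c] by auto
  show ?thesis
  proof (cases "c \<in> U")
    case True
    note w = flat_ws[OF _ c True]
    have "ws x \<in> sym_diff f g \<longleftrightarrow> x \<in> sym_diff f g" if "x \<in> c" for x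
      using w[OF f(1) that] w[OF f(2) that] by blast
    from varies_ws[OF c d this] varies_ws[OF c d w[OF f(1)]] varies_ws[OF c d w[OF f(2)]]
    show ?thesis by blast
  next
    case False
    note w = flat_bs[OF _ c False]
    have "bs x \<in> sym_diff f g \<longleftrightarrow> x \<in> sym_diff f g" if "x \<in> c" for x
      using w[OF f(1) that] w[OF f(2) that] by blast
    from varies_bs[OF c d this] varies_bs[OF c d w[OF f(1)]] varies_bs[OF c d w[OF f(2)]]
    show ?thesis by blast
  qed
qed

lemma varies_sym_diff:
  assumes "f \<in> flat T U" "g \<in> flat T U"
  shows "varies (sym_diff f g) = sym_diff (varies f) (varies g)"
proof (rule set_eqI)
  fix c show "c \<in> varies (sym_diff f g) \<longleftrightarrow> c \<in> sym_diff (varies f) (varies g)"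
    using varies_sym_diff1[OF assms, of c] varies_off by blast
qed

text \<open>A colouring constant at a crossing is compatible with either smoothing there.\<close>

lemma flat_change:
  assumes f: "f \<in> flat T U" and same: "\<And>c. c \<in> off \<Longrightarrow> (c \<in> U \<longleftrightarrow> c \<in> U') \<or> c \<notin> varies f"
  shows "f \<in> flat T U'"
proof (rule flatI)
  show "f \<subseteq> L" "\<And>d. d \<in> L \<Longrightarrow> e d \<in> f \<longleftrightarrow> d \<in> f" using flatD[OF f] by auto
  fix d assume d: "d \<in> L"
  show "jn T U' d \<in> f \<longleftrightarrow> d \<in> f"
  proof (cases "vert d \<in> off \<and> vert d \<in> varies f")
    case True
    then have "jn T U' d = jn T U d" using same by (auto simp: jn_def)
    then show ?thesis using flatD(3)[OF f d] by simp
  next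
    case False
    show ?thesis
    proof (cases "vert d \<in> off")
      case True
      then have "jn T U' d \<in> vert d" using off_closed[OF True vert_self] by (auto simp: jn_def)
      then show ?thesis using not_varies[OF True _ _ vert_self, of f] False True by simp
    next
      case F: False
      then have "jn T U' d = jn T U d" by (auto simp: jn_def)
      then show ?thesis using flatD(3)[OF f d] by simp
    qed
  qed
qed

text \<open>
  Outside the darts at the crossings in \<open>Z\<close> both colourings are invariant under the same
  matching, so the number of their common darts is even there; it is even altogether because of
  \<open>e\<close>.
\<close>

lemma pairing:
  assumes f: "f \<in> flat T U" and g: "g \<in> flat T U'"
    and Z: "Z \<subseteq> off" "\<And>c. c \<in> off \<Longrightarrow> c \<notin> Z \<Longrightarrow> c \<in> U \<longleftrightarrow> c \<in> U'"
  shows "even (card (f \<inter> g \<inter> \<Union> Z))"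
proof -
  have fing: "finite (f \<inter> g)" using flatD(1)[OF f] finite_L finite_subset by blast
  have "even (card (f \<inter> g))"
  proof (rule even_card_involution[OF fing, of e])
    fix d assume d: "d \<in> f \<inter> g"
    then have "d \<in> L" using flatD(1)[OF f] by auto
    then show "e d \<in> f \<inter> g \<and> e (e d) = d \<and> e d \<noteq> d"
      using d flatD(2)[OF f] flatD(2)[OF g] e_e e_neq L_darts by simp
  qed
  moreover have "even (card (f \<inter> g - \<Union> Z))"
  proof (rule even_card_involution[of _ "jn T U"])
    show "finite (f \<inter> g - \<Union> Z)" using fing by simp
    fix d assume d: "d \<in> f \<inter> g - \<Union> Z"
    then have dL: "d \<in> L" using flatD(1)[OF f] by auto
    have "vert d \<notin> Z" using d vert_self by auto
    then have j: "jn T U d = jn T U' d" using Z(2) by (auto simp: jn_def)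
    have "jn T U d \<notin> \<Union> Z"
    proof
      assume "jn T U d \<in> \<Union> Z"
      then obtain c where c: "c \<in> Z" "jn T U d \<in> c" by auto
      then have "vert d = c" using off_vert[of c "jn T U d"] Z(1) jn_props(1)[OF dL] by auto
      then show False using c \<open>vert d \<notin> Z\<close> by simp
    qed
    then show "jn T U d \<in> f \<inter> g - \<Union> Z \<and> jn T U (jn T U d) = d \<and> jn T U d \<noteq> d"
      using d flatD(3)[OF f dL] flatD(3)[OF g dL, folded j] jn_props(2)[OF dL] jn_neq[OF dL] by simp
  qed
  moreover have "card (f \<inter> g) = card (f \<inter> g \<inter> \<Union> Z) + card (f \<inter> g - \<Union> Z)"
    using fing by (metis Int_Diff_Un Int_Diff_disjoint card_Un_disjoint finite_Diff finite_Int)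
  ultimately show ?thesis by auto
qed

lemma card_flip:
  assumes "finite K" and p: "\<And>x. x \<in> K \<Longrightarrow> p x \<in> K \<and> p (p x) = x \<and> (p x \<in> B \<longleftrightarrow> x \<notin> B)"
  shows "card (K \<inter> B) = card (K - B)"
proof (rule bij_betw_same_card[of p])
  show "bij_betw p (K \<inter> B) (K - B)"
    by (rule bij_betwI[where g = p]) (use p in auto)
qed

text \<open>Cut the state open at \<open>c\<close>, which leaves paths between its four darts. The
  coherent orientation by \<open>black\<close> prevents a path from joining opposite darts, so one
  of the two smoothings closes the path from \<open>a\<close> to a circle that misses the other two
  darts.\<close>

lemma varying_colouring:
  assumes c: "c \<in> off" "c \<notin> U"
  obtains f where "f \<in> flat T U \<or> f \<in> flat T (insert c U)" "c \<in> varies f"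
proof -
  let ?j = "\<lambda>d. if vert d = c then d else jn T U d"
  interpret t: two_involutions L e ?j
  proof
    show "finite L" by (rule finite_L)
    fix d assume d: "d \<in> L"
    show "e d \<in> L" "e (e d) = d" "e d \<noteq> d" using d e_e e_neq L_darts by auto
    show "?j d \<in> L" "?j (?j d) = d" using d jn_props[OF d] by auto
  qed
  obtain a where a: "a \<in> c" using off_nonempty[OF c(1)] by auto
  have va: "vert a = c" using off_vert[OF c(1) a] .
  have ends: "t.ends = c"
    using off_link[OF c(1)] off_vert[OF c(1)] vert_self jn_neq by (auto simp: t.ends_def)
  obtain K b where K: "K \<in> t.colourings" "a \<noteq> b" "K \<inter> c = {a, b}"
    using t.path_of_end[of a] a ends by metis
  have KL: "K \<subseteq> L" using K(1) unfolding t.colourings_def by (auto dest: inv_setsD)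
  have Ke: "e d \<in> K \<longleftrightarrow> d \<in> K" and Kj: "?j d \<in> K \<longleftrightarrow> d \<in> K" if "d \<in> L" for d
    using K(1) inv_setsD[of K L e] inv_setsD[of K L ?j] that unfolding t.colourings_def by blast+
  have finK: "finite K" using KL finite_L finite_subset by blast
  \<comment> \<open>Edges balance the two kinds of darts on the whole path, the matching balances
    them away from \<open>c\<close>; hence the two ends are of different kinds.\<close>
  have "card (K \<inter> black) = card (K - black)"
  proof (rule card_flip[OF finK])
    fix d assume d: "d \<in> K"
    then have "d \<in> L" using K(1) unfolding t.colourings_def by (auto dest: inv_setsD)
    then show "e d \<in> K \<and> e (e d) = d \<and> (e d \<in> black \<longleftrightarrow> d \<notin> black)"
      using d Ke e_e L_darts black_link(1) by simp
  qed
  moreover have "card ((K - c) \<inter> black) = card ((K - c) - black)"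
  proof (rule card_flip[of _ "jn T U"])
    fix d assume d: "d \<in> K - c"
    then have dL: "d \<in> L" using K(1) unfolding t.colourings_def by (auto dest: inv_setsD)
    have v: "vert d \<noteq> c" using d vert_self by auto
    have "jn T U d \<notin> c" using off_vert[OF c(1), of "jn T U d"] jn_props(1)[OF dL] v by auto
    then show "jn T U d \<in> K - c \<and> jn T U (jn T U d) = d \<and> (jn T U d \<in> black \<longleftrightarrow> d \<notin> black)"
      using d v Kj[OF dL] jn_props[OF dL] by simp
  qed (use finK in simp)
  moreover have "card (K \<inter> black) = card ((K - c) \<inter> black) + card ({a, b} \<inter> black)"
  proof -
    have "K \<inter> black = ((K - c) \<inter> black) \<union> ({a, b} \<inter> black)" using K(3) by blast
    moreover have "((K - c) \<inter> black) \<inter> ({a, b} \<inter> black) = {}" using K(3) by blast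
    ultimately show ?thesis using finK by (metis card_Un_disjoint finite.emptyI finite.insertI finite_Diff finite_Int)
  qed
  moreover have "card (K - black) = card ((K - c) - black) + card ({a, b} - black)"
  proof -
    have "K - black = ((K - c) - black) \<union> ({a, b} - black)" using K(3) by blast
    moreover have "((K - c) - black) \<inter> ({a, b} - black) = {}" using K(3) by blast
    ultimately show ?thesis using finK by (metis card_Un_disjoint finite.emptyI finite.insertI finite_Diff)
  qed
  ultimately have "card ({a, b} \<inter> black) = card ({a, b} - black)" by simp
  then have ab: "b \<in> black \<longleftrightarrow> a \<notin> black"
    using K(2) by (auto simp: Int_insert_left insert_Diff_if split: if_splits)
  note o = off_opp[of a, unfolded va, OF c(1)] and s = off_smoothings[of a, unfolded va, OF c(1)]
  have "b \<in> c" using K(3) by auto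
  \<comment> \<open>Each of the two smoothings changes membership in \<open>black\<close>, so their
    composite preserves it.\<close>
  moreover have "b \<noteq> opp D a"
    using ab s(4) off_smoothings(10)[of "bs a"] s(1) c(1) o(2) by auto
  ultimately have "b = bs a \<or> b = ws a" using o(3) K(2) by auto
  then show ?thesis
  proof
    assume b: "b = bs a"
    have bsK: "bs d \<in> K \<longleftrightarrow> d \<in> K" if d: "d \<in> c" for d
    proof -
      have v: "vert d = c" using off_vert[OF c(1) d] .
      have "bs d \<in> c" "d \<in> c" using off_closed[OF c(1) d] d by auto
      then have "(bs d \<in> K \<longleftrightarrow> bs d \<in> {a, bs a}) \<and> (d \<in> K \<longleftrightarrow> d \<in> {a, bs a})"
        using K(3) b by blast
      moreover have "bs d = bs a \<longleftrightarrow> d = a" "bs d = a \<longleftrightarrow> d = bs a"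
        using s(2) off_smoothings(2)[of d] v c(1) by auto
      ultimately show ?thesis by auto
    qed
    have "K \<in> flat T U"
    proof (rule flatI)
      show "jn T U d \<in> K \<longleftrightarrow> d \<in> K" if d: "d \<in> L" for d
      proof (cases "vert d = c")
        case True
        then have "jn T U d = bs d" using c by (simp add: jn_def)
        then show ?thesis using bsK vert_self[of d] True by simp
      qed (use Kj[OF d] in simp)
    qed (use KL Ke in auto)
    moreover have "c \<in> varies K"
    proof -
      have "ws a \<notin> {a, bs a}" "ws a \<in> c" using o(4) off_closed[OF c(1) a] by auto
      then have "ws a \<notin> K" using K(3) b by blast
      moreover have "a \<in> K" using K(3) by auto
      ultimately show ?thesis using varies_bs[OF c(1) a bsK] by simp
    qed
    ultimately show ?thesis using that by blast
  next
    assume b: "b = ws a"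
    have bsK: "ws d \<in> K \<longleftrightarrow> d \<in> K" if d: "d \<in> c" for d
    proof -
      have v: "vert d = c" using off_vert[OF c(1) d] .
      have "ws d \<in> c" "d \<in> c" using off_closed[OF c(1) d] d by auto
      then have "(ws d \<in> K \<longleftrightarrow> ws d \<in> {a, ws a}) \<and> (d \<in> K \<longleftrightarrow> d \<in> {a, ws a})"
        using K(3) b by blast
      moreover have "ws d = ws a \<longleftrightarrow> d = a" "ws d = a \<longleftrightarrow> d = ws a"
        using s(8) off_smoothings(8)[of d] v c(1) by auto
      ultimately show ?thesis by auto
    qed
    have "K \<in> flat T (insert c U)"
    proof (rule flatI)
      show "jn T (insert c U) d \<in> K \<longleftrightarrow> d \<in> K" if d: "d \<in> L" for d
      proof (cases "vert d = c")
        case True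
        then have "jn T (insert c U) d = ws d" using c by (simp add: jn_def)
        then show ?thesis using bsK vert_self[of d] True by simp
      next
        case False
        then have "jn T (insert c U) d = jn T U d" by (simp add: jn_def)
        then show ?thesis using Kj[OF d] False by simp
      qed
    qed (use KL Ke in auto)
    moreover have "c \<in> varies K"
    proof -
      have "bs a \<notin> {a, ws a}" "bs a \<in> c" using o(4) off_closed[OF c(1) a] by auto
      then have "bs a \<notin> K" using K(3) b by blast
      moreover have "a \<in> K" using K(3) by auto
      ultimately show ?thesis using varies_ws[OF c(1) a bsK] by simp
    qed
    ultimately show ?thesis using that by blast
  qed
qed

text \<open>The two colourings would have exactly one common dart at \<open>c\<close>, contrary to
  \<open>pairing\<close> with \<open>Z = {c}\<close>.\<close>

lemma varying_exclusive:
  assumes c: "c \<in> off" "c \<notin> U" and f: "f \<in> flat T U" "c \<in> varies f"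
    and g: "g \<in> flat T (insert c U)" "c \<in> varies g"
  shows False
proof -
  obtain d where d: "d \<in> c" using off_nonempty[OF c(1)] by auto
  have v: "vert d = c" using off_vert[OF c(1) d] .
  note o = off_opp[of d, unfolded v, OF c(1)]
  have fb: "bs x \<in> f \<longleftrightarrow> x \<in> f" if "x \<in> c" for x using flat_bs[OF f(1) c that] .
  have gw: "ws x \<in> g \<longleftrightarrow> x \<in> g" if "x \<in> c" for x using flat_ws[OF g(1) c(1) _ that] by simp
  have in_c: "bs d \<in> c" "ws d \<in> c" using off_closed[OF c(1) d] by auto
  have 1: "bs d \<in> f \<longleftrightarrow> d \<in> f" "ws d \<in> f \<longleftrightarrow> d \<notin> f" "opp D d \<in> f \<longleftrightarrow> d \<notin> f"
    using fb[OF d] varies_bs[OF c(1) d fb] f(2) fb[OF in_c(2)] o(1) by simp_all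
  have 2: "ws d \<in> g \<longleftrightarrow> d \<in> g" "bs d \<in> g \<longleftrightarrow> d \<notin> g" "opp D d \<in> g \<longleftrightarrow> d \<notin> g"
    using gw[OF d] varies_ws[OF c(1) d gw] g(2) gw[OF in_c(1)] o(2) by simp_all
  \<comment> \<open>A pair matched by \<open>bs\<close> and a pair matched by \<open>ws\<close> meet
    in one dart.\<close>
  have "f \<inter> g \<inter> c = {if d \<in> f then if d \<in> g then d else bs d else if d \<in> g then ws d else opp D d}"
    using 1 2 o(3,4) by auto
  then have "card (f \<inter> g \<inter> \<Union> {c}) = 1" by simp
  moreover have "even (card (f \<inter> g \<inter> \<Union> {c}))"
    by (rule pairing[OF f(1) g(1)]) (use c in auto)
  ultimately show False by simp
qed

text \<open>Switching one smoothing splits a circle or merges two. Both states have the same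
  colourings constant at \<open>c\<close>; by the two preceding lemmas exactly one of the states has
  others, which doubles its number.\<close>

lemma card_flat_insert:
  assumes c: "c \<in> off" "c \<notin> U"
  shows "(\<exists>f\<in>flat T U. c \<in> varies f) \<Longrightarrow> card (flat T U) = 2 * card (flat T (insert c U))"
    "\<not> (\<exists>f\<in>flat T U. c \<in> varies f) \<Longrightarrow> card (flat T (insert c U)) = 2 * card (flat T U)"
proof -
  have eq: "{f \<in> flat T U. c \<notin> varies f} = {f \<in> flat T (insert c U). c \<notin> varies f}"
  proof (intro set_eqI iffI)
    fix f assume "f \<in> {f \<in> flat T U. c \<notin> varies f}"
    then show "f \<in> {f \<in> flat T (insert c U). c \<notin> varies f}"
      using flat_change[of f T U "insert c U"] by auto
  next
    fix f assume "f \<in> {f \<in> flat T (insert c U). c \<notin> varies f}"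
    then show "f \<in> {f \<in> flat T U. c \<notin> varies f}"
      using flat_change[of f T "insert c U" U] by auto
  qed
  have half: "card (flat T V) = 2 * card {f \<in> flat T V. c \<notin> varies f}"
    if "h \<in> flat T V" "c \<in> varies h" for h V
    by (rule card_xor_half(2)[OF finite_flat xor_closed_flat _ that(1)])
      (use varies_sym_diff1[OF _ _ c(1)] that in auto)
  have const: "card {f \<in> flat T V. c \<notin> varies f} = card (flat T V)"
    if "\<not> (\<exists>f\<in>flat T V. c \<in> varies f)" for V
    by (rule arg_cong[where f = card]) (use that in auto)
  show "card (flat T U) = 2 * card (flat T (insert c U))" if "\<exists>f\<in>flat T U. c \<in> varies f"
  proof -
    have "\<not> (\<exists>f\<in>flat T (insert c U). c \<in> varies f)" using that varying_exclusive[OF c] by blast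
    then show ?thesis using that half[of _ U] const[of "insert c U"] eq by auto
  qed
  show "card (flat T (insert c U)) = 2 * card (flat T U)" if n: "\<not> (\<exists>f\<in>flat T U. c \<in> varies f)"
  proof -
    obtain f where "f \<in> flat T (insert c U)" "c \<in> varies f"
      using n varying_colouring[OF c, of T] by blast
    then show ?thesis using half[of f "insert c U"] const[OF n] eq by simp
  qed
qed

text \<open>In exponents, enlarging \<open>U\<close> by \<open>c\<close> adds 1 on the right and
  subtracts 2 if some black colouring constant on \<open>U\<close> varies at \<open>c\<close>. The
  left side changes by the same amount by \<open>card_flat_insert\<close>, once varying colourings
  of the state \<open>U\<close> are known to come from such black ones; this is what
  \<open>flat_decompose\<close> gives.\<close>

lemma card_flat:
  assumes "U \<subseteq> off"
  shows "card (flat T U) * card (flat T {}) = (card {f \<in> flat T {}. varies f \<inter> U = {}})\<^sup>2 * 2 ^ card U"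
proof -
  have "finite U" using assms finite_off finite_subset by blast
  then show ?thesis using assms
  proof (induction U)
    case empty
    then show ?case by (simp add: power2_eq_square)
  next
    case (insert c U)
    have c: "c \<in> off" "c \<notin> U" using insert by auto
    define G where "G = {f \<in> flat T {}. varies f \<inter> U = {}}"
    have finG: "finite G" using finite_flat by (simp add: G_def)
    have xorG: "xor_closed G"
    proof -
      have "{} \<in> G" using xor_closed_flat[of T "{}"] by (auto simp: G_def xor_closed_def varies_def)
      moreover have "sym_diff f g \<in> G" if "f \<in> G" "g \<in> G" for f g
        using that xor_closedD[OF xor_closed_flat[of T "{}"]] varies_sym_diff[of f T "{}" g]
        by (auto simp: G_def)
      ultimately show ?thesis by (simp add: xor_closed_def)
    qed
    have GU: "f \<in> flat T U" if "f \<in> G" for f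
      using that flat_change[of f T "{}" U] by (auto simp: G_def)
    have G': "{f \<in> flat T {}. varies f \<inter> insert c U = {}} = {f \<in> G. c \<notin> varies f}"
      by (auto simp: G_def)
    have IH: "card (flat T U) * card (flat T {}) = (card G)\<^sup>2 * 2 ^ card U"
      using insert by (simp add: G_def)
    show ?case
    proof (cases "\<exists>f\<in>flat T U. c \<in> varies f")
      case True
      then obtain f where f: "f \<in> flat T U" "c \<in> varies f" by auto
      obtain f1 f2 where f12: "f1 \<in> flat T {}" "f2 \<in> flat T off" "f = sym_diff f1 f2"
        using flat_decompose[OF f(1)] by blast
      have b1: "bs d \<in> f1 \<longleftrightarrow> d \<in> f1" if "d \<in> k" "k \<in> off" for d k
        using flat_bs[OF f12(1) that(2) _ that(1)] by simp
      have w2: "ws d \<in> f2 \<longleftrightarrow> d \<in> f2" if "d \<in> k" "k \<in> off" for d k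
        using flat_ws[OF f12(2) that(2,2,1)] .
      \<comment> \<open>The white part is invariant under \<open>ws\<close>, so the difference of
        \<open>f\<close> between \<open>d\<close> and \<open>ws d\<close> comes from the black
        part.\<close>
      have "c \<in> varies f1"
      proof -
        obtain d where d: "d \<in> c" using off_nonempty[OF c(1)] by auto
        have "ws d \<in> f \<longleftrightarrow> d \<notin> f"
          using varies_bs[OF c(1) d flat_bs[OF f(1) c]] f(2) by simp
        then have "ws d \<in> f1 \<longleftrightarrow> d \<notin> f1" using w2[OF d c(1)] unfolding f12(3) by blast
        then show ?thesis using varies_bs[OF c(1) d b1[OF _ c(1)]] by simp
      qed
      moreover have "k \<notin> varies f1" if k: "k \<in> U" for k
      proof -
        have ko: "k \<in> off" using k insert by auto
        obtain d where d: "d \<in> k" using off_nonempty[OF ko] by auto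
        have "ws d \<in> f \<longleftrightarrow> d \<in> f" using flat_ws[OF f(1) ko k d] .
        then have "ws d \<in> f1 \<longleftrightarrow> d \<in> f1" using w2[OF d ko] unfolding f12(3) by blast
        then show ?thesis using varies_bs[OF ko d b1[OF _ ko]] by simp
      qed
      ultimately have "f1 \<in> G" "c \<in> varies f1" using f12(1) by (auto simp: G_def)
      then have 1: "card G = 2 * card {f \<in> G. c \<notin> varies f}"
        by (intro card_xor_half(2)[OF finG xorG, of _ f1])
          (use varies_sym_diff1[OF _ _ c(1), of _ T "{}"] in \<open>auto simp: G_def\<close>)
      have 2: "card (flat T U) = 2 * card (flat T (insert c U))"
        using card_flat_insert(1)[OF c True] .
      from IH have "card (flat T (insert c U)) * card (flat T {}) =
          2 * (card {f \<in> G. c \<notin> varies f})\<^sup>2 * 2 ^ card U"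
        unfolding 1 2 by (simp add: power2_eq_square mult_ac)
      then show ?thesis unfolding G' using insert by simp
    next
      case False
      have "{f \<in> G. c \<notin> varies f} = G" using False GU by auto
      then show ?thesis unfolding G' using card_flat_insert(2)[OF c False] IH insert by simp
    qed
  qed
qed

end

section \<open>Duality of the two checkerboard colourings\<close>

context reflected_diagram
begin

text \<open>Planar duality: the variation sets of black colourings and those of white colourings are
  orthogonal complements. \<open>pairing\<close> gives one inclusion, \<open>V\<close> in
  \<open>P\<close>; equality follows by counting, from \<open>card_flat\<close> with
  \<open>U = off\<close> on one side and characters on the other.\<close>

lemma ws_colouring_of_orthogonal:
  assumes y: "y \<subseteq> off" and orth: "\<And>f. f \<in> flat T {} \<Longrightarrow> even (card (varies f \<inter> y))"
  obtains f where "f \<in> flat T off" "varies f = y"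
proof -
  define V where "V = varies ` flat T off"
  define P where "P = {y \<in> Pow off. \<forall>f\<in>flat T {}. even (card (varies f \<inter> y))}"
  define N where "N = card {f \<in> flat T {}. varies f = {}}"
  have const: "{f \<in> flat T off. varies f = {}} = {f \<in> flat T {}. varies f = {}}"
  proof (intro set_eqI iffI)
    fix f assume "f \<in> {f \<in> flat T off. varies f = {}}"
    then show "f \<in> {f \<in> flat T {}. varies f = {}}" using flat_change[of f T off "{}"] by simp
  next
    fix f assume "f \<in> {f \<in> flat T {}. varies f = {}}"
    then show "f \<in> {f \<in> flat T off. varies f = {}}" using flat_change[of f T "{}" off] by simp
  qed
  have cw: "card (flat T off) = card V * N"
    unfolding V_def N_def const[symmetric]
    by (rule card_xor_hom[OF finite_flat xor_closed_flat varies_sym_diff])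
  have "{f \<in> flat T {}. varies f \<inter> off = {}} = {f \<in> flat T {}. varies f = {}}"
    using varies_off by blast
  then have "card (flat T off) * card (flat T {}) = N\<^sup>2 * 2 ^ card off"
    using card_flat[of off T] by (simp add: N_def)
  moreover have "{} \<in> {f \<in> flat T {}. varies f = {}}"
    using xor_closed_flat[of T "{}"] by (auto simp: xor_closed_def varies_def)
  then have "N > 0" unfolding N_def using finite_flat by (auto simp: card_gt_0_iff)
  ultimately have 1: "card V * card (flat T {}) = N * 2 ^ card off"
    using cw by (simp add: power2_eq_square mult_ac)
  have fin: "finite z" if "z \<in> Pow off" for z using that finite_off finite_subset by auto
  \<comment> \<open>Double count of the sum of \<open>(- 1) ^ card (varies f \<inter> z)\<close>:
    over \<open>f\<close> first it detects membership of \<open>z\<close> in \<open>P\<close>, over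
    \<open>z\<close> first the condition \<open>varies f = {}\<close>.\<close>
  have "int (card P * card (flat T {})) =
      (\<Sum>z\<in>Pow off. if \<forall>f\<in>flat T {}. even (card (varies f \<inter> z)) then int (card (flat T {})) else 0)"
  proof -
    have "Pow off \<inter> {z. \<forall>f\<in>flat T {}. even (card (varies f \<inter> z))} = P" by (auto simp: P_def)
    then show ?thesis using finite_off by (simp add: sum.If_cases)
  qed
  also have "\<dots> = (\<Sum>z\<in>Pow off. \<Sum>f\<in>flat T {}. (- 1) ^ card (varies f \<inter> z))"
  proof (rule sum.cong[OF refl])
    fix z
    have "(\<Sum>f\<in>flat T {}. (- 1) ^ card (varies f \<inter> z)) =
        (if \<forall>f\<in>flat T {}. even (card (varies f \<inter> z)) then of_nat (card (flat T {})) else 0 :: int)"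
      using varies_sym_diff finite_varies
      by (intro sum_parity_character[OF finite_flat xor_closed_flat]) blast+
    then show "(if \<forall>f\<in>flat T {}. even (card (varies f \<inter> z)) then int (card (flat T {})) else 0) =
        (\<Sum>f\<in>flat T {}. (- 1) ^ card (varies f \<inter> z))"
      by simp
  qed
  also have "\<dots> = (\<Sum>f\<in>flat T {}. \<Sum>z\<in>Pow off. (- 1) ^ card (z \<inter> varies f))"
    by (subst sum.swap) (simp add: Int_commute)
  also have "\<dots> = (\<Sum>f\<in>flat T {}. if varies f = {} then 2 ^ card off else 0)"
  proof (rule sum.cong[OF refl])
    fix f
    have "(\<forall>z\<in>Pow off. even (card (z \<inter> varies f))) \<longleftrightarrow> varies f = {}"
    proof
      assume *: "\<forall>z\<in>Pow off. even (card (z \<inter> varies f))"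
      show "varies f = {}"
      proof (rule ccontr)
        assume "varies f \<noteq> {}"
        then obtain c where c: "c \<in> varies f" by auto
        then have "even (card ({c} \<inter> varies f))" using * varies_off by blast
        then show False using c by simp
      qed
    qed simp
    moreover have "(\<Sum>z\<in>Pow off. (- 1) ^ card (z \<inter> varies f)) =
        (if \<forall>z\<in>Pow off. even (card (z \<inter> varies f)) then of_nat (card (Pow off)) else 0 :: int)"
      by (rule sum_parity_character[of _ "\<lambda>z. z"]) (use finite_off fin in auto)
    ultimately show "(\<Sum>z\<in>Pow off. (- 1) ^ card (z \<inter> varies f)) =
        (if varies f = {} then 2 ^ card off else 0 :: int)"
      by (simp add: card_Pow finite_off)
  qed
  also have "\<dots> = int (N * 2 ^ card off)"
  proof -
    have "flat T {} \<inter> {f. varies f = {}} = {f \<in> flat T {}. varies f = {}}" by auto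
    then show ?thesis using finite_flat by (simp add: sum.If_cases N_def)
  qed
  finally have "card P * card (flat T {}) = N * 2 ^ card off" by (simp only: of_nat_eq_iff)
  moreover have "card (flat T {}) > 0"
    using finite_flat xor_closed_flat[of T "{}"] by (auto simp: card_gt_0_iff xor_closed_def)
  ultimately have "card V = card P" using 1 by (metis mult_right_cancel nat_less_le)
  moreover have "V \<subseteq> P"
  proof
    fix z assume "z \<in> V"
    then obtain g where g: "g \<in> flat T off" "z = varies g" by (auto simp: V_def)
    have "even (card (varies f \<inter> z))" if f: "f \<in> flat T {}" for f
    proof -
      have "card (f \<inter> g \<inter> \<Union> off) = (\<Sum>c\<in>off. card (f \<inter> g \<inter> c))"
      proof -
        have "f \<inter> g \<inter> \<Union> off = (\<Union>c\<in>off. f \<inter> g \<inter> c)" by auto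
        moreover have "card (\<Union>c\<in>off. f \<inter> g \<inter> c) = (\<Sum>c\<in>off. card (f \<inter> g \<inter> c))"
        proof (rule card_UN_disjoint[OF finite_off])
          show "\<forall>c\<in>off. finite (f \<inter> g \<inter> c)" using finite_vertex off_vertices by simp
          show "\<forall>c\<in>off. \<forall>c'\<in>off. c \<noteq> c' \<longrightarrow> f \<inter> g \<inter> c \<inter> (f \<inter> g \<inter> c') = {}"
            using off_vert by blast
        qed
        ultimately show ?thesis by simp
      qed
      moreover have "even (card (f \<inter> g \<inter> \<Union> off))"
        by (rule pairing[OF f g(1)]) auto
      ultimately have ev: "even (\<Sum>c\<in>off. card (f \<inter> g \<inter> c))" by simp
      \<comment> \<open>Two values determine each colouring at \<open>c\<close>. Modulo 2 the number
        of common darts factors into the difference of \<open>f\<close> between \<open>d\<close> and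
        \<open>ws d\<close> and that of \<open>g\<close> between \<open>d\<close> and
        \<open>bs d\<close>.\<close>
      have "odd (card (f \<inter> g \<inter> c)) \<longleftrightarrow> c \<in> varies f \<inter> z" if c: "c \<in> off" for c
      proof -
        obtain d where d: "d \<in> c" using off_nonempty[OF c] by auto
        note o = off_opp[of d, unfolded off_vert[OF c d], OF c]
        have fb: "bs x \<in> f \<longleftrightarrow> x \<in> f" if "x \<in> c" for x using flat_bs[OF f c _ that] by simp
        have gw: "ws x \<in> g \<longleftrightarrow> x \<in> g" if "x \<in> c" for x using flat_ws[OF g(1) c c that] .
        have in_c: "bs d \<in> c" "ws d \<in> c" using off_closed[OF c d] by auto
        have f1: "bs d \<in> f \<longleftrightarrow> d \<in> f" "opp D d \<in> f \<longleftrightarrow> ws d \<in> f" "c \<in> varies f \<longleftrightarrow> (ws d \<in> f \<longleftrightarrow> d \<notin> f)"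
          using fb[OF d] fb[OF in_c(2)] o(1) varies_bs[OF c d fb] by simp_all
        have g1: "ws d \<in> g \<longleftrightarrow> d \<in> g" "opp D d \<in> g \<longleftrightarrow> bs d \<in> g" "c \<in> z \<longleftrightarrow> (bs d \<in> g \<longleftrightarrow> d \<notin> g)"
          using gw[OF d] gw[OF in_c(1)] o(2) varies_ws[OF c d gw] g(2) by simp_all
        have ne: "d \<noteq> bs d" "d \<noteq> ws d" "d \<noteq> opp D d" "bs d \<noteq> ws d" "bs d \<noteq> opp D d" "ws d \<noteq> opp D d"
          using o(4) by auto
        have "card (f \<inter> g \<inter> c) = (\<Sum>x\<in>c. if x \<in> f \<and> x \<in> g then 1 else 0)"
        proof -
          have "c \<inter> {x. x \<in> f \<and> x \<in> g} = f \<inter> g \<inter> c" by auto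
          then show ?thesis using finite_vertex[OF off_vertices[OF c]] by (simp add: sum.If_cases)
        qed
        also have "\<dots> = (\<Sum>x\<in>{d, bs d, ws d, opp D d}. if x \<in> f \<and> x \<in> g then 1 else 0)"
          using o(3) by simp
        also have "\<dots> = (if d \<in> f \<and> d \<in> g then 1 else 0) + (if d \<in> f \<and> bs d \<in> g then 1 else 0) +
            (if ws d \<in> f \<and> d \<in> g then 1 else 0) + (if ws d \<in> f \<and> bs d \<in> g then 1 else 0)"
          using ne f1(1,2) g1(1,2) by simp
        finally show ?thesis using f1(3) g1(3) by auto
      qed
      then have "{c \<in> off. odd (card (f \<inter> g \<inter> c))} = {c \<in> off. c \<in> varies f \<inter> z}" by blast
      then have "even (\<Sum>c\<in>off. card (f \<inter> g \<inter> c)) \<longleftrightarrow> even (card {c \<in> off. c \<in> varies f \<inter> z})"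
        by (simp only: even_sum_iff[OF finite_off])
      moreover have "{c \<in> off. c \<in> varies f \<inter> z} = varies f \<inter> z" using varies_off by blast
      ultimately show ?thesis using ev by simp
    qed
    then show "z \<in> P" using g varies_off by (auto simp: P_def)
  qed
  ultimately have "V = P"
    using finite_off by (intro card_subset_eq) (auto simp: P_def)
  moreover have "y \<in> P" using y orth by (simp add: P_def)
  ultimately show ?thesis using that by (auto simp: V_def)
qed

section \<open>Folding along the axis\<close>

definition mirror where
  "mirror \<sigma> f = {d \<in> L. if d \<in> \<sigma> then d \<in> f else \<rho> d \<in> f}"

definition mirror_inv where "mirror_inv f \<longleftrightarrow> (\<forall>d\<in>L. \<rho> d \<in> f \<longleftrightarrow> d \<in> f)"

text \<open>At every vertex on the axis the reflection exchanges the link darts of the two sides, so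
  half of the two resp. four link darts count.\<close>

lemma card_half_side:
  assumes "V \<subseteq> axp \<union> axc"
  shows "card {d \<in> L - side. vert d \<in> V} = card (V \<inter> axp) + 2 * card (V \<inter> axc)"
proof -
  have V: "V \<subseteq> vertices D" using assms axp_vertices axc_vertices by blast
  then have finV: "finite V" using finite_vertices finite_subset by blast
  have half: "card (v \<inter> (L - side)) = (if v \<in> axp then 1 else 2)" if v: "v \<in> V" for v
  proof -
    have vv: "v \<in> vertices D" using v V by auto
    have "card (v \<inter> L \<inter> side) = card (v \<inter> L - side)"
    proof (rule card_flip)
      show "finite (v \<inter> L)" using finite_vertex[OF vv] by simp
      fix d assume d: "d \<in> v \<inter> L"
      have "vert d = v" using vertices_vert[OF vv] d by simp
      then have "vert (\<rho> d) = v" using vert_\<rho>_cases(2)[of d] d v assms L_darts by auto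
      then have "\<rho> d \<in> v" using vert_self[of "\<rho> d"] by simp
      then show "\<rho> d \<in> v \<inter> L \<and> \<rho> (\<rho> d) = d \<and> (\<rho> d \<in> side \<longleftrightarrow> d \<notin> side)"
        using d side_\<rho> \<rho>_\<rho> L_darts by simp
    qed
    moreover have "card (v \<inter> L) = card (v \<inter> L \<inter> side) + card (v \<inter> L - side)"
      using finite_vertex[OF vv]
      by (metis Int_Diff_Un Int_Diff_disjoint card_Un_disjoint finite_Diff finite_Int)
    moreover have "card (v \<inter> L) = card v - card (v \<inter> axis D)"
    proof -
      have "v \<inter> L = v - (v \<inter> axis D)" using vertices_darts[OF vv] by (auto simp: link_def)
      then show ?thesis using finite_vertex[OF vv] by (simp add: card_Diff_subset)
    qed
    moreover have "card v = (if v \<in> axp then 4 else 6)" "card (v \<inter> axis D) = 2"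
      using v assms by (auto simp: axis_points_def axis_crossings_def)
    ultimately have "2 * card (v \<inter> L - side) = (if v \<in> axp then 2 else 4)" by (auto split: if_splits)
    moreover have "v \<inter> L - side = v \<inter> (L - side)" by auto
    ultimately show ?thesis by (simp split: if_splits)
  qed
  have "{d \<in> L - side. vert d \<in> V} = (\<Union>v\<in>V. v \<inter> (L - side))"
    using vertices_vert V vert_self by blast
  then have "card {d \<in> L - side. vert d \<in> V} = card (\<Union>v\<in>V. v \<inter> (L - side))" by simp
  also have "\<dots> = (\<Sum>v\<in>V. card (v \<inter> (L - side)))"
  proof (rule card_UN_disjoint[OF finV])
    show "\<forall>v\<in>V. finite (v \<inter> (L - side))" using finite_L by simp
    show "\<forall>v\<in>V. \<forall>w\<in>V. v \<noteq> w \<longrightarrow> v \<inter> (L - side) \<inter> (w \<inter> (L - side)) = {}"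
      using vertices_vert V by blast
  qed
  also have "\<dots> = (\<Sum>v\<in>V. if v \<in> axp then 1 else 2)" using half by simp
  also have "\<dots> = card (V \<inter> axp) + 2 * card (V \<inter> - axp)" using finV by (simp add: sum.If_cases)
  also have "V \<inter> - axp = V \<inter> axc" using assms axp_axc by blast
  finally show ?thesis .
qed

end

text \<open>Applied to two matchings: the states with \<open>bs\<close> at all crossings off the
  axis, and, for counting components, the matching that goes straight on there.
  \<open>j_side\<close> says that a matched pair changes sides only if it consists of mirror
  images.\<close>

locale reflected_matching = reflected_diagram D \<rho>
    for D :: "'d axial_diagram" and \<rho> :: "'d \<Rightarrow> 'd" +
  fixes j :: "'d \<Rightarrow> 'd"
  assumes j_L: "d \<in> L \<Longrightarrow> j d \<in> L" and j_j: "d \<in> L \<Longrightarrow> j (j d) = d"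
    and j_\<rho>: "d \<in> L \<Longrightarrow> j (\<rho> d) = \<rho> (j d)" and j_neq: "d \<in> L \<Longrightarrow> j d \<noteq> d"
    and j_side: "d \<in> L \<Longrightarrow> j d = \<rho> d \<or> (j d \<in> side \<longleftrightarrow> d \<in> side)"
begin

definition inv_j where "inv_j = inv_sets L e \<inter> inv_sets L j"

definition sym_part where "sym_part = {f \<in> inv_j. mirror_inv f}"

definition half_part where "half_part = {f \<in> inv_j. f \<inter> side = {}}"

lemma inv_jD:
  assumes "f \<in> inv_j"
  shows "f \<subseteq> L" "d \<in> L \<Longrightarrow> e d \<in> f \<longleftrightarrow> d \<in> f" "d \<in> L \<Longrightarrow> j d \<in> f \<longleftrightarrow> d \<in> f"
  using assms by (auto simp: inv_j_def dest: inv_setsD)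

lemma inv_jI:
  assumes "f \<subseteq> L" "\<And>d. d \<in> L \<Longrightarrow> e d \<in> f \<longleftrightarrow> d \<in> f" "\<And>d. d \<in> L \<Longrightarrow> j d \<in> f \<longleftrightarrow> d \<in> f"
  shows "f \<in> inv_j"
  using assms by (auto simp: inv_j_def intro!: inv_setsI)

lemma xor_closed_inv_j: "xor_closed inv_j"
  unfolding inv_j_def by (intro xor_closed_Int xor_closed_inv_sets)

text \<open>Invariance is required inside \<open>\<sigma>\<close> only: the values elsewhere are
  copied by reflection, which commutes with \<open>e\<close> and \<open>j\<close>, and pairs of
  mirror images agree after copying. \<open>p\<close> selects the side.\<close>

lemma mirror_sym_part:
  assumes \<sigma>: "\<And>d. d \<in> L \<Longrightarrow> d \<in> \<sigma> \<longleftrightarrow> (d \<in> side) = p"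
    and e: "\<And>d. d \<in> L \<Longrightarrow> d \<in> \<sigma> \<Longrightarrow> e d \<in> f \<longleftrightarrow> d \<in> f"
    and j: "\<And>d. d \<in> L \<Longrightarrow> d \<in> \<sigma> \<Longrightarrow> j d \<in> \<sigma> \<Longrightarrow> j d \<in> f \<longleftrightarrow> d \<in> f"
  shows "mirror \<sigma> f \<in> sym_part"
proof -
  have \<rho>\<sigma>: "\<rho> d \<in> \<sigma> \<longleftrightarrow> d \<notin> \<sigma>" if "d \<in> L" for d
    using \<sigma>[OF that] \<sigma>[of "\<rho> d"] side_\<rho>[OF that] that by auto
  have e\<sigma>: "e d \<in> \<sigma> \<longleftrightarrow> d \<in> \<sigma>" if "d \<in> L" for d
    using \<sigma>[OF that] \<sigma>[of "e d"] side_link(1)[OF that] that by auto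
  have j\<sigma>: "j d = \<rho> d \<or> (j d \<in> \<sigma> \<longleftrightarrow> d \<in> \<sigma>)" if "d \<in> L" for d
    using \<sigma>[OF that] \<sigma>[of "j d"] j_side[OF that] j_L[OF that] that by auto
  have "mirror \<sigma> f \<in> inv_j"
  proof (rule inv_jI)
    show "mirror \<sigma> f \<subseteq> L" by (auto simp: mirror_def)
    fix d assume d: "d \<in> L"
    have \<rho>e: "\<rho> (e d) = e (\<rho> d)" using \<rho>_e[OF L_darts[OF d]] by simp
    show "e d \<in> mirror \<sigma> f \<longleftrightarrow> d \<in> mirror \<sigma> f"
      using d e[OF d] e[of "\<rho> d"] e\<sigma>[OF d] \<rho>\<sigma>[OF d] by (simp add: mirror_def \<rho>e)
    have \<rho>\<rho>: "\<rho> (\<rho> d) = d" using \<rho>_\<rho>[OF L_darts[OF d]] .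
    show "j d \<in> mirror \<sigma> f \<longleftrightarrow> d \<in> mirror \<sigma> f"
    proof (cases "j d = \<rho> d")
      case True
      then show ?thesis using d \<rho>\<sigma>[OF d] \<rho>\<rho> by (simp add: mirror_def)
    next
      case False
      then have same: "j d \<in> \<sigma> \<longleftrightarrow> d \<in> \<sigma>" using j\<sigma>[OF d] by simp
      have "\<rho> (j d) \<in> f \<longleftrightarrow> \<rho> d \<in> f" if "d \<notin> \<sigma>"
      proof -
        have "\<rho> d \<in> \<sigma>" "\<rho> (j d) \<in> \<sigma>" using that same \<rho>\<sigma>[OF d] \<rho>\<sigma>[OF j_L[OF d]] by auto
        then show ?thesis using j[of "\<rho> d"] j_\<rho>[OF d] d by simp
      qed
      then show ?thesis using d j[OF d] same j_L[OF d] by (simp add: mirror_def)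
    qed
  qed
  moreover have "mirror_inv (mirror \<sigma> f)"
    using \<rho>\<sigma> \<rho>_\<rho> L_darts by (simp add: mirror_inv_def mirror_def)
  ultimately show ?thesis by (simp add: sym_part_def)
qed

lemma mirror_side:
  assumes "f \<in> inv_j"
  shows "mirror side f \<in> sym_part" "mirror (- side) f \<in> sym_part"
  by (rule mirror_sym_part[of _ True]; use inv_jD[OF assms] in simp)
    (rule mirror_sym_part[of _ False]; use inv_jD[OF assms] in simp)

text \<open>The symmetric summand has to agree with \<open>f\<close> on \<open>side\<close> and is
  determined by these values; the remainder is supported on the other side.\<close>

lemma bij_sym_half:
  "bij_betw (\<lambda>(s, t). sym_diff s t) (sym_part \<times> half_part) inv_j"
proof (rule bij_betwI[where g = "\<lambda>f. (mirror side f, sym_diff f (mirror side f))"])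
  show "(\<lambda>(s, t). sym_diff s t) \<in> sym_part \<times> half_part \<rightarrow> inv_j"
    using xor_closedD[OF xor_closed_inv_j] by (auto simp: sym_part_def half_part_def)
  show "(\<lambda>f. (mirror side f, sym_diff f (mirror side f))) \<in> inv_j \<rightarrow> sym_part \<times> half_part"
  proof (rule funcsetI)
    fix f assume f: "f \<in> inv_j"
    have m: "mirror side f \<in> sym_part" using mirror_side(1)[OF f] .
    then have "sym_diff f (mirror side f) \<in> inv_j"
      using xor_closedD[OF xor_closed_inv_j f] by (simp add: sym_part_def)
    moreover have "sym_diff f (mirror side f) \<inter> side = {}"
      using inv_jD(1)[OF f] by (auto simp: mirror_def)
    ultimately show "(mirror side f, sym_diff f (mirror side f)) \<in> sym_part \<times> half_part"
      using m by (simp add: half_part_def)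
  qed
  show "(mirror side (case x of (s, t) \<Rightarrow> sym_diff s t),
      sym_diff (case x of (s, t) \<Rightarrow> sym_diff s t) (mirror side (case x of (s, t) \<Rightarrow> sym_diff s t))) = x"
    if x: "x \<in> sym_part \<times> half_part" for x
  proof -
    obtain s t where st: "x = (s, t)" "s \<in> sym_part" "t \<in> half_part" using x by auto
    have "s \<subseteq> L" "mirror_inv s" "t \<inter> side = {}"
      using st inv_jD(1) by (auto simp: sym_part_def half_part_def)
    have "d \<in> mirror side (sym_diff s t) \<longleftrightarrow> d \<in> s" for d
    proof (cases "d \<in> L")
      case True
      then have "\<rho> d \<in> side \<longleftrightarrow> d \<notin> side" "\<rho> d \<in> s \<longleftrightarrow> d \<in> s"
        using side_\<rho> \<open>mirror_inv s\<close> by (auto simp: mirror_inv_def)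
      then show ?thesis using True \<open>t \<inter> side = {}\<close> by (auto simp: mirror_def)
    qed (use \<open>s \<subseteq> L\<close> in \<open>auto simp: mirror_def\<close>)
    then have "mirror side (sym_diff s t) = s" by blast
    then show ?thesis using st(1) by auto
  qed
  show "(case (mirror side f, sym_diff f (mirror side f)) of (s, t) \<Rightarrow> sym_diff s t) = f"
    if "f \<in> inv_j" for f by auto
qed

text \<open>Folding: a symmetric colouring is a colouring of one half, in which every arc through
  the axis is cut and becomes an end. Colourings of the half that vanish at the ends extend by zero
  to the other half, so \<open>card_colourings\<close> applies.\<close>

lemma card_sym_part:
  defines "E \<equiv> {d \<in> L - side. j d = \<rho> d}"
  shows "even (card E)" "card sym_part = card half_part * 2 ^ (card E div 2)"
proof -
  \<comment> \<open>A partner on the other side is replaced by the dart itself, so fixed points are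
    the cut arcs.\<close>
  let ?q = "\<lambda>d. if j d \<in> side then d else j d"
  have jE: "j d = \<rho> d \<longleftrightarrow> j d \<in> side" if "d \<in> L" "d \<notin> side" for d
    using j_side[OF that(1)] side_\<rho>[OF that(1)] that by auto
  interpret t: two_involutions "L - side" e ?q
  proof
    show "finite (L - side)" using finite_L by simp
    fix d assume d: "d \<in> L - side"
    then show "e d \<in> L - side" "e (e d) = d" "e d \<noteq> d"
      using side_link(1) e_e e_neq L_darts by auto
    show "?q d \<in> L - side" "?q (?q d) = d" using d j_L j_j by auto
  qed
  have ends: "t.ends = E"
    using jE j_neq by (auto simp: t.ends_def E_def)
  have tD: "f \<subseteq> L - side" "d \<in> L \<Longrightarrow> d \<notin> side \<Longrightarrow> e d \<in> f \<longleftrightarrow> d \<in> f"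
    "d \<in> L \<Longrightarrow> d \<notin> side \<Longrightarrow> j d \<notin> side \<Longrightarrow> j d \<in> f \<longleftrightarrow> d \<in> f" if f: "f \<in> t.colourings" for f d
    using f inv_setsD(1)[of f "L - side" e] inv_setsD(2)[of f "L - side" e d]
      inv_setsD(2)[of f "L - side" ?q d]
    unfolding t.colourings_def by auto
  have tI: "f \<in> t.colourings" if "f \<subseteq> L - side" "\<And>d. d \<in> L - side \<Longrightarrow> e d \<in> f \<longleftrightarrow> d \<in> f"
    "\<And>d. d \<in> L - side \<Longrightarrow> j d \<notin> side \<Longrightarrow> j d \<in> f \<longleftrightarrow> d \<in> f" for f
    using that unfolding t.colourings_def by (auto intro!: inv_setsI split: if_splits)
  have "bij_betw (\<lambda>f. f - side) sym_part t.colourings"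
  proof (rule bij_betwI[where g = "mirror (- side)"])
    show "(\<lambda>f. f - side) \<in> sym_part \<rightarrow> t.colourings"
    proof (rule funcsetI)
      fix f assume "f \<in> sym_part"
      then have f: "f \<in> inv_j" by (simp add: sym_part_def)
      show "f - side \<in> t.colourings"
        by (rule tI) (use inv_jD[OF f] side_link(1) in auto)
    qed
    show "mirror (- side) \<in> t.colourings \<rightarrow> sym_part"
    proof (rule funcsetI)
      fix f assume f: "f \<in> t.colourings"
      show "mirror (- side) f \<in> sym_part"
        by (rule mirror_sym_part[of _ False]) (use tD[OF f] in auto)
    qed
    show "mirror (- side) (f - side) = f" if "f \<in> sym_part" for f
    proof -
      have "f \<subseteq> L" "mirror_inv f" using that inv_jD(1) by (auto simp: sym_part_def)
      then show ?thesis using side_\<rho> by (auto simp: mirror_def mirror_inv_def split: if_splits)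
    qed
    show "mirror (- side) f - side = f" if "f \<in> t.colourings" for f
      using tD(1)[OF that] by (auto simp: mirror_def split: if_splits)
  qed
  then have 1: "card sym_part = card t.colourings" by (rule bij_betw_same_card)
  have "half_part = {f \<in> t.colourings. f \<inter> t.ends = {}}"
  proof (intro set_eqI iffI)
    fix f assume "f \<in> half_part"
    then have f: "f \<in> inv_j" "f \<inter> side = {}" by (auto simp: half_part_def)
    have "f \<in> t.colourings"
      by (rule tI) (use inv_jD[OF f(1)] f(2) in auto)
    moreover have "d \<notin> f" if "d \<in> E" for d
      using that inv_jD(3)[OF f(1), of d] f(2) side_\<rho>[of d] by (auto simp: E_def)
    ultimately show "f \<in> {f \<in> t.colourings. f \<inter> t.ends = {}}" using ends by auto
  next
    fix f assume "f \<in> {f \<in> t.colourings. f \<inter> t.ends = {}}"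
    then have f: "f \<in> t.colourings" "f \<inter> E = {}" using ends by auto
    have fL: "f \<subseteq> L - side" using tD(1)[OF f(1)] .
    have "f \<in> inv_j"
    proof (rule inv_jI)
      fix d assume d: "d \<in> L"
      show "e d \<in> f \<longleftrightarrow> d \<in> f"
        using tD(2)[OF f(1) d] side_link(1)[OF d] fL by blast
      show "j d \<in> f \<longleftrightarrow> d \<in> f"
      proof (cases "j d = \<rho> d")
        case True
        have "j (\<rho> d) = d" using j_\<rho>[OF d] True \<rho>_\<rho>[OF L_darts[OF d]] by simp
        then have "j (\<rho> d) = \<rho> (\<rho> d)" using \<rho>_\<rho>[OF L_darts[OF d]] by simp
        then have "d \<in> side \<or> d \<in> E" "\<rho> d \<in> side \<or> \<rho> d \<in> E" using True d by (auto simp: E_def)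
        then show ?thesis using f(2) fL True by auto
      next
        case False
        then have "j d \<in> side \<longleftrightarrow> d \<in> side" using j_side[OF d] by simp
        then show ?thesis using tD(3)[OF f(1) d] fL by blast
      qed
    qed (use fL in auto)
    then show "f \<in> half_part" using fL by (auto simp: half_part_def)
  qed
  then show "even (card E)" "card sym_part = card half_part * 2 ^ (card E div 2)"
    using t.card_colourings 1 ends by simp_all
qed

end

section \<open>Symmetric unions\<close>

locale reflected_union = reflected_diagram D \<rho>
  for D :: "'d axial_diagram" and \<rho> :: "'d \<Rightarrow> 'd" +
  assumes reverse: "d \<in> L \<Longrightarrow> \<rho> d \<in> orbit (travel D) (e d)"
begin

lemma opp_props:
  assumes d: "d \<in> L"
  shows "vert (opp D d) = vert d" "opp D d \<in> L" "opp D (opp D d) = d" "opp D (\<rho> d) = \<rho> (opp D d)"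
proof -
  note \<rho>\<rho> = \<rho>_\<rho>[OF L_darts]
  have "vert (opp D d) = vert d \<and> opp D d \<in> L \<and> opp D (opp D d) = d \<and> opp D (\<rho> d) = \<rho> (opp D d)"
    using d
  proof (cases rule: L_cases)
    case 1
    note s = off_smoothings[OF 1] and o = off_opp[OF 1]
    have w: "vert (ws d) \<in> off" using 1 s(7) by simp
    have v: "vert (opp D d) = vert d" using off_smoothings(1)[OF w] s(7) o(1) by simp
    have "opp D (opp D d) = bs (ws (ws (bs d)))"
      using off_opp(1)[of "opp D d"] v 1 o(2) by simp
    also have "\<dots> = d" using off_smoothings(8)[of "bs d"] s(1,2) 1 by simp
    finally have oo: "opp D (opp D d) = d" .
    have "vert (\<rho> d) \<in> off" using 1 vert_\<rho>_cases(1) L_darts[OF d] by simp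
    then have "opp D (\<rho> d) = \<rho> (opp D d)"
      using off_opp(1)[of "\<rho> d"] s(12) off_smoothings(6)[OF w] o(1) by simp
    then show ?thesis using v oo off_smoothings(3)[OF w] o(1) by simp
  next
    case 2
    have v: "vert (\<rho> d) = vert d" using \<rho>_vert_axis[OF d 2(2)] .
    show ?thesis
      using axp_opp[OF 2(1) d] axp_opp[of "\<rho> d"] v 2 d \<rho>\<rho>[OF d] by simp
  next
    case 3
    note s = axc_smooth_v[OF 3(1) d]
    have v: "vert (\<rho> d) = vert d" using \<rho>_vert_axis[OF d 3(2)] .
    have v': "vert (\<rho> (sv d)) = vert d" using \<rho>_vert_axis[OF s(3)] s(1) 3 by simp
    have "opp D (\<rho> (sv d)) = \<rho> (sv (\<rho> (sv d)))"
      using axc_smooth_v(7)[of "\<rho> (sv d)"] v' 3 s(3) by simp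
    also have "sv (\<rho> (sv d)) = \<rho> (sv (sv d))"
      using axc_smooth_v(6)[of "sv d"] s(1,3) 3 by simp
    also have "\<rho> (\<rho> (sv (sv d))) = d" using s(2) \<rho>\<rho>[OF d] by simp
    finally have oo: "opp D (\<rho> (sv d)) = d" .
    have "opp D (\<rho> d) = \<rho> (sv (\<rho> d))" using axc_smooth_v(7)[of "\<rho> d"] v 3 d by simp
    moreover have "sv (\<rho> d) \<in> L" using axc_smooth_v(3)[of "\<rho> d"] v 3 d by simp
    ultimately show ?thesis using oo v' s by simp
  qed
  then show "vert (opp D d) = vert d" "opp D d \<in> L" "opp D (opp D d) = d" "opp D (\<rho> d) = \<rho> (opp D d)"
    by blast+
qed

lemma travel_funpow_L: "d \<in> L \<Longrightarrow> (travel D ^^ k) d \<in> L"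
  by (induction k) (auto simp: travel_def opp_props)

text \<open>
  A component that is mapped to itself with reversed orientation contains a fixed edge or a fixed
  passage through a vertex; by the position of the two sides it can only be a passage through an
  axis point.
\<close>

lemma reaches_axis_point_aux:
  "d \<in> L \<Longrightarrow> \<rho> d = (travel D ^^ k) (e d) \<Longrightarrow>
    \<exists>x\<in>L. vert x \<in> axp \<and> (\<forall>f\<in>inv_sets L e \<inter> inv_sets L (opp D). d \<in> f \<longleftrightarrow> x \<in> f)"
proof (induction k arbitrary: d rule: induct_nat_012)
  case 0
  \<comment> \<open>The two halves of this edge would lie on different sides, but a link edge does
    not cross the axis.\<close>
  then have "\<rho> d = e d" by simp
  then show ?case using side_\<rho>[of d] side_link(1)[of d] 0 by simp
next
  case 1
  have \<rho>: "\<rho> d = opp D d" using 1 e_e L_darts by (simp add: travel_def)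
  have s: "opp D d \<in> side \<longleftrightarrow> d \<notin> side" using side_\<rho>[of d] 1(1) \<rho> by simp
  have "vert d \<in> axp"
    using 1(1)
  proof (cases rule: L_cases)
    case c: 1
    have "vert (ws d) \<in> off" using c off_smoothings(7) by simp
    then have "opp D d \<in> side \<longleftrightarrow> d \<in> side"
      using off_opp(1)[OF c] off_smoothings(5)[of "ws d"] off_smoothings(11)[OF c] by simp
    then show ?thesis using s by simp
  next
    case c: 3
    note v = axc_smooth_v[OF c(1) 1(1)]
    have "\<rho> (\<rho> (sv d)) = \<rho> (\<rho> d)" using v(7) \<rho> by simp
    then have "sv d = d" using \<rho>_\<rho>[OF L_darts[OF v(3)]] \<rho>_\<rho>[OF L_darts[OF 1(1)]] by simp
    then show ?thesis using v(4) by simp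
  qed
  then show ?case using 1(1) by blast
next
  case (ge2 k)
  \<comment> \<open>Moving \<open>d\<close> back through its vertex removes one step at the
    beginning and, by symmetry, one at the end of the way from \<open>e d\<close> to
    \<open>\<rho> d\<close>.\<close>
  define y where "y = e (opp D d)"
  define w where "w = (travel D ^^ Suc k) (e d)"
  have d: "d \<in> L" by (fact ge2(3))
  have y: "y \<in> L" using opp_props(2)[OF d] by (simp add: y_def)
  have w: "w \<in> L" unfolding w_def by (rule travel_funpow_L) (simp add: d)
  have "\<rho> d = travel D w" using ge2(4) by (simp add: w_def)
  then have "opp D (\<rho> d) = e w" using opp_props(3)[of "e w"] w by (simp add: travel_def)
  then have "\<rho> y = w"
    using \<rho>_e[OF L_darts[OF opp_props(2)[OF d]]] opp_props(4)[OF d] e_e[OF L_darts[OF w]]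
    by (simp add: y_def)
  also have "w = (travel D ^^ k) (travel D (e d))" by (simp add: w_def funpow_swap1)
  also have "travel D (e d) = e y"
    using e_e L_darts d opp_props(2)[OF d] by (simp add: travel_def y_def)
  finally obtain x where x: "x \<in> L" "vert x \<in> axp"
    "\<And>f. f \<in> inv_sets L e \<inter> inv_sets L (opp D) \<Longrightarrow> y \<in> f \<longleftrightarrow> x \<in> f"
    using ge2(1)[OF y] by blast
  have "y \<in> f \<longleftrightarrow> d \<in> f" if "f \<in> inv_sets L e \<inter> inv_sets L (opp D)" for f
    using that inv_setsD(2)[of f L e "opp D d"] inv_setsD(2)[of f L "opp D" d] d opp_props(2)[OF d]
    by (simp add: y_def)
  then show ?case using x by blast
qed

text \<open>The hypotheses make \<open>f\<close> a union of components, and each component passes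
  through an axis point.\<close>

lemma vanish:
  assumes "f \<subseteq> L" "\<And>d. d \<in> L \<Longrightarrow> e d \<in> f \<longleftrightarrow> d \<in> f" "\<And>d. d \<in> L \<Longrightarrow> opp D d \<in> f \<longleftrightarrow> d \<in> f"
    and "\<And>d. d \<in> L \<Longrightarrow> vert d \<in> axp \<Longrightarrow> d \<notin> f"
  shows "f = {}"
proof (rule ccontr)
  assume "f \<noteq> {}"
  then obtain d where d: "d \<in> f" by auto
  then have dL: "d \<in> L" using assms(1) by auto
  have "f \<in> inv_sets L e \<inter> inv_sets L (opp D)" using assms(1-3) by (auto intro!: inv_setsI)
  moreover obtain k where "\<rho> d = (travel D ^^ k) (e d)"
    using reverse[OF dL] by (auto simp: orbit_altdef)
  then obtain x where "x \<in> L" "vert x \<in> axp"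
    "\<forall>f\<in>inv_sets L e \<inter> inv_sets L (opp D). d \<in> f \<longleftrightarrow> x \<in> f"
    using reaches_axis_point_aux[OF dL] by blast
  ultimately show False using assms(4) d by blast
qed

text \<open>\<open>vanish\<close> is applied to the asymmetry of \<open>f\<close>, the darts where
  \<open>f\<close> differs from its mirror image. Only this defect has to continue along the
  strands, not \<open>f\<close> itself.\<close>

lemma sym_if_opp_inv:
  assumes f: "f \<subseteq> L" "\<And>d. d \<in> L \<Longrightarrow> e d \<in> f \<longleftrightarrow> d \<in> f"
    and axp: "\<And>d. d \<in> L \<Longrightarrow> vert d \<in> axp \<Longrightarrow> \<rho> d \<in> f \<longleftrightarrow> d \<in> f"
    and opp: "\<And>d. d \<in> L \<Longrightarrow> (opp D d \<in> f \<longleftrightarrow> \<rho> (opp D d) \<in> f) \<longleftrightarrow> (d \<in> f \<longleftrightarrow> \<rho> d \<in> f)"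
  shows "mirror_inv f"
proof -
  define u where "u = {d \<in> L. \<not> (d \<in> f \<longleftrightarrow> \<rho> d \<in> f)}"
  have "u = {}"
  proof (rule vanish)
    show "u \<subseteq> L" by (auto simp: u_def)
    fix d assume d: "d \<in> L"
    show "e d \<in> u \<longleftrightarrow> d \<in> u"
      using f(2)[OF d] f(2)[of "\<rho> d"] \<rho>_e[OF L_darts[OF d]] d by (simp add: u_def)
    show "opp D d \<in> u \<longleftrightarrow> d \<in> u" using opp[OF d] d opp_props(2)[OF d] by (auto simp: u_def)
    show "d \<notin> u" if "vert d \<in> axp" using axp[OF d that] by (simp add: u_def)
  qed
  then show ?thesis unfolding u_def mirror_inv_def by blast
qed

text \<open>At the axis invariance under the matching is enough. With \<open>h\<close> the defect
  vanishes outright; with \<open>v\<close> it passes through, because going straight on is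
  \<open>v\<close> followed by the reflection.\<close>

lemma sym_if_opp_inv_off:
  assumes f: "f \<subseteq> L" "\<And>d. d \<in> L \<Longrightarrow> e d \<in> f \<longleftrightarrow> d \<in> f"
    and jn: "\<And>d. d \<in> L \<Longrightarrow> vert d \<notin> off \<Longrightarrow> jn T U d \<in> f \<longleftrightarrow> d \<in> f"
    and opp: "\<And>d. d \<in> L \<Longrightarrow> vert d \<in> off \<Longrightarrow>
      (opp D d \<in> f \<longleftrightarrow> \<rho> (opp D d) \<in> f) \<longleftrightarrow> (d \<in> f \<longleftrightarrow> \<rho> d \<in> f)"
  shows "mirror_inv f"
proof (rule sym_if_opp_inv[OF f])
  fix d assume d: "d \<in> L"
  show "\<rho> d \<in> f \<longleftrightarrow> d \<in> f" if "vert d \<in> axp"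
    using jn[OF d] that off_axp by (auto simp: jn_def)
  show "(opp D d \<in> f \<longleftrightarrow> \<rho> (opp D d) \<in> f) \<longleftrightarrow> (d \<in> f \<longleftrightarrow> \<rho> d \<in> f)"
    using d
  proof (cases rule: L_cases)
    case 1
    then show ?thesis using opp d by simp
  next
    case 2
    then have "opp D d = \<rho> d" using axp_opp d by simp
    then show ?thesis using \<rho>_\<rho>[OF L_darts[OF d]] by auto
  next
    case 3
    note s = axc_smooth_v[OF 3(1) d]
    have v: "vert (\<rho> d) = vert d" using \<rho>_vert_axis[OF d 3(2)] .
    have v': "vert (\<rho> (sv d)) = vert d" using \<rho>_vert_axis[OF s(3)] s(1) 3 by simp
    have \<rho>\<rho>: "\<rho> (opp D d) = sv d" using s(7) \<rho>_\<rho>[OF L_darts[OF s(3)]] by simp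
    show ?thesis
    proof (cases "vert d \<in> T")
      case True
      then have "\<rho> d \<in> f \<longleftrightarrow> d \<in> f" "\<rho> (sv d) \<in> f \<longleftrightarrow> sv d \<in> f"
        using jn[OF d] jn[OF s(3)] 3 s(1) by (auto simp: jn_def)
      then show ?thesis using \<rho>\<rho> s(7) by simp
    next
      case False
      then have "sv d \<in> f \<longleftrightarrow> d \<in> f" "sv (\<rho> d) \<in> f \<longleftrightarrow> \<rho> d \<in> f"
        using jn[OF d] jn[of "\<rho> d"] 3 v d by (auto simp: jn_def)
      then show ?thesis using \<rho>\<rho> s(6,7) by auto
    qed
  qed
qed

lemma axis_point_exists: "axp \<noteq> {}"
proof -
  obtain a where a: "a \<in> axis D" using axis_nonempty by auto
  then have "a \<in> darts D" using axis_darts by auto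
  then have "r a \<in> L"
  proof (cases rule: dart_cases)
    case 1
    then show ?thesis using off_r(1)[of a] a by (simp add: link_def)
  next
    case 2
    then show ?thesis using axp_axis(1) a by blast
  next
    case 3
    then show ?thesis using axc_axis(1) a by blast
  qed
  moreover obtain k where "\<rho> (r a) = (travel D ^^ k) (e (r a))"
    using reverse[OF \<open>r a \<in> L\<close>] by (auto simp: orbit_altdef)
  ultimately show ?thesis using reaches_axis_point_aux[of "r a"] by blast
qed

subsection \<open>Each component has two axis points\<close>

text \<open>Unions of components are automatically symmetric by \<open>sym_if_opp_inv\<close>.
  Counting them once by components and once by folding, where the ends are the axis points and the
  half part is trivial, gives the two exponents.\<close>

lemma components_axis_points: "card axp = 2 * components D"
proof -
  \<comment> \<open>Crossings on the axis get the smoothing \<open>v\<close>, so that arcs traverse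
    the axis only at axis points. On symmetric sets \<open>v\<close> imposes the same condition as
    going straight on.\<close>
  let ?j = "\<lambda>d. if vert d \<in> off then opp D d else jn {} {} d"
  interpret m: reflected_matching D \<rho> ?j
  proof unfold_locales
    fix d assume d: "d \<in> L"
    have vo: "vert (\<rho> d) \<in> off \<longleftrightarrow> vert d \<in> off" using vert_\<rho>_cases(1)[OF L_darts[OF d]] .
    note J = jn_props[OF d, of "{}" "{}"]
    show "?j d \<in> L" "?j (?j d) = d" using opp_props[OF d] J by auto
    show "?j (\<rho> d) = \<rho> (?j d)"
    proof (cases "vert d \<in> off")
      case False
      then have v: "vert (\<rho> d) = vert d" using \<rho>_vert_axis d by simp
      have "sv (\<rho> d) = \<rho> (sv d)" if "vert d \<notin> axp"
        using that False axc_smooth_v(6)[OF _ d] L_cases[OF d] by metis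
      then show ?thesis using False v by (simp add: jn_def)
    qed (use vo opp_props[OF d] in simp)
    show "?j d \<noteq> d" using off_opp(4)[of d] jn_neq[OF d] by auto
    show "?j d = \<rho> d \<or> (?j d \<in> side \<longleftrightarrow> d \<in> side)"
    proof (cases "vert d \<in> off")
      case True
      have "vert (ws d) \<in> off" using True off_smoothings(7) by simp
      then have "opp D d \<in> side \<longleftrightarrow> d \<in> side"
        using off_opp(1)[OF True] off_smoothings(5)[of "ws d"] off_smoothings(11)[OF True] by simp
      then show ?thesis using True by simp
    next
      case False
      have "sv d \<in> side \<longleftrightarrow> d \<in> side" if "vert d \<notin> axp"
        using that False axc_smooth_v(5)[OF _ d] L_cases[OF d] by metis
      then show ?thesis using False by (simp add: jn_def)
    qed
  qed
  have jsym: "?j d \<in> f \<longleftrightarrow> opp D d \<in> f" if "mirror_inv f" "d \<in> L" for f d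
    using that(2)
  proof (cases rule: L_cases)
    case 2
    then show ?thesis using axp_opp that by (simp add: jn_def)
  next
    case 3
    then have "opp D d = \<rho> (sv d)" "sv d \<in> L" using axc_smooth_v that by auto
    then show ?thesis using 3 that(1) by (simp add: jn_def mirror_inv_def)
  qed simp
  have "inv_sets L e \<inter> inv_sets L (opp D) = m.sym_part"
  proof (intro set_eqI iffI)
    fix f assume f: "f \<in> inv_sets L e \<inter> inv_sets L (opp D)"
    then have fL: "f \<subseteq> L" and fe: "\<And>d. d \<in> L \<Longrightarrow> e d \<in> f \<longleftrightarrow> d \<in> f"
      and fo: "\<And>d. d \<in> L \<Longrightarrow> opp D d \<in> f \<longleftrightarrow> d \<in> f"
      by (auto dest: inv_setsD)
    have s: "mirror_inv f"
    proof (rule sym_if_opp_inv[OF fL fe])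
      fix d assume d: "d \<in> L"
      show "\<rho> d \<in> f \<longleftrightarrow> d \<in> f" if "vert d \<in> axp" using fo[OF d] axp_opp[OF that d] by simp
      show "(opp D d \<in> f \<longleftrightarrow> \<rho> (opp D d) \<in> f) \<longleftrightarrow> (d \<in> f \<longleftrightarrow> \<rho> d \<in> f)"
        using fo[OF d] fo[of "\<rho> d"] opp_props(4)[OF d] d by simp
    qed
    have "f \<in> m.inv_j"
      by (rule m.inv_jI[OF fL fe]) (use jsym[OF s] fo in auto)
    then show "f \<in> m.sym_part" using s by (simp add: m.sym_part_def)
  next
    fix f assume "f \<in> m.sym_part"
    then have f: "f \<in> m.inv_j" "mirror_inv f" by (auto simp: m.sym_part_def)
    show "f \<in> inv_sets L e \<inter> inv_sets L (opp D)"
      using m.inv_jD[OF f(1)] jsym[OF f(2)] by (auto intro!: inv_setsI)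
  qed
  moreover have "card (inv_sets L e \<inter> inv_sets L (opp D)) = 2 ^ components D"
    unfolding components_def curves_def
    by (rule card_inv_sets_quotient[OF finite_L]) (use e_e L_darts opp_props in auto)
  moreover have "m.half_part = {{}}"
  proof -
    have "f = {}" if "f \<in> m.half_part" for f
    proof -
      have f: "f \<in> m.inv_j" "f \<inter> side = {}" using that by (auto simp: m.half_part_def)
      \<comment> \<open>The symmetrization is a union of components; it misses all axis points,
        since there \<open>f\<close> would meet both sides.\<close>
      define u where "u = {d \<in> L. d \<in> f \<or> \<rho> d \<in> f}"
      have us: "mirror_inv u" using \<rho>_\<rho> L_darts by (auto simp: u_def mirror_inv_def)
      have "u = {}"
      proof (rule vanish)
        show "u \<subseteq> L" by (auto simp: u_def)
        fix d assume d: "d \<in> L"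
        note F = m.inv_jD(2,3)[OF f(1)]
        have dL: "\<rho> d \<in> L" using d by simp
        show "e d \<in> u \<longleftrightarrow> d \<in> u"
          using F(1)[OF d] F(1)[OF dL] \<rho>_e[OF L_darts[OF d]] d by (simp add: u_def)
        have "?j d \<in> u \<longleftrightarrow> d \<in> u"
          using F(2)[OF d] F(2)[OF dL] m.j_\<rho>[OF d] m.j_L[OF d] d by (simp only: u_def mem_Collect_eq)
        then show "opp D d \<in> u \<longleftrightarrow> d \<in> u" using jsym[OF us d] by simp
        show "d \<notin> u" if v: "vert d \<in> axp"
        proof -
          have "vert d \<notin> off" using v off_axp by blast
          then have "\<rho> d \<in> f \<longleftrightarrow> d \<in> f" using F(2)[OF d] v by (simp add: jn_def)
          then show ?thesis using f(2) side_\<rho>[OF d] by (auto simp: u_def)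
        qed
      qed
      then show ?thesis using m.inv_jD(1)[OF f(1)] by (auto simp: u_def)
    qed
    moreover have "{} \<in> m.half_part"
      using m.xor_closed_inv_j by (simp add: m.half_part_def xor_closed_def)
    ultimately show ?thesis by blast
  qed
  moreover have "{d \<in> L - side. ?j d = \<rho> d} = {d \<in> L - side. vert d \<in> axp}"
  proof -
    have "?j d = \<rho> d \<longleftrightarrow> vert d \<in> axp" if d: "d \<in> L" for d
      using d
    proof (cases rule: L_cases)
      case 1
      have "vert (ws d) \<in> off" using 1 off_smoothings(7) by simp
      then have "opp D d \<in> side \<longleftrightarrow> d \<in> side"
        using off_opp(1)[OF 1] off_smoothings(5)[of "ws d"] off_smoothings(11)[OF 1] by simp
      then show ?thesis using 1 side_\<rho>[OF d] off_axp by auto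
    next
      case 3
      then have "sv d \<in> side \<longleftrightarrow> d \<in> side" using axc_smooth_v d by blast
      then show ?thesis using 3 side_\<rho>[OF d] by (auto simp: jn_def)
    qed (simp add: jn_def)
    then show ?thesis by blast
  qed
  moreover have "card {d \<in> L - side. vert d \<in> axp} = card axp"
    using card_half_side[of axp] axp_axc by (simp add: disjoint_iff[THEN iffD2] Int_absorb)
  ultimately have "even (card axp)" "card axp div 2 = components D" using m.card_sym_part by simp_all
  then show ?thesis by (metis dvd_mult_div_cancel)
qed

subsection \<open>The smoothed diagrams\<close>

lemma matching_jn: "reflected_matching D \<rho> (jn T {})"
proof unfold_locales
  fix d assume d: "d \<in> L"
  show "jn T {} d \<in> L" "jn T {} (jn T {} d) = d" "jn T {} d \<noteq> d"
    using jn_props[OF d] jn_neq[OF d] by auto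
  show "jn T {} (\<rho> d) = \<rho> (jn T {} d)"
  proof (cases "vert d \<in> off")
    case True
    then show ?thesis using vert_\<rho>_cases(1)[OF L_darts[OF d]] off_smoothings(6)[OF True]
      by (simp add: jn_def)
  next
    case False
    then have v: "vert (\<rho> d) = vert d" using \<rho>_vert_axis d by simp
    have "sv (\<rho> d) = \<rho> (sv d)" if "vert d \<notin> axp"
      using that False axc_smooth_v(6)[OF _ d] L_cases[OF d] by metis
    then show ?thesis using False v by (simp add: jn_def)
  qed
  show "jn T {} d = \<rho> d \<or> (jn T {} d \<in> side \<longleftrightarrow> d \<in> side)"
  proof (cases "vert d \<in> off")
    case True
    then show ?thesis using off_smoothings(5)[OF True] by (simp add: jn_def)
  next
    case False
    have "sv d \<in> side \<longleftrightarrow> d \<in> side" if "vert d \<notin> axp"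
      using that False axc_smooth_v(5)[OF _ d] L_cases[OF d] by metis
    then show ?thesis using False by (simp add: jn_def)
  qed
qed

definition flat_sym where "flat_sym T = {f \<in> flat T {}. mirror_inv f}"
definition flat_half where "flat_half T = {f \<in> flat T {}. f \<inter> side = {}}"

lemma flat_parts:
  "reflected_matching.inv_j D (jn T {}) = flat T {}"
  "reflected_matching.sym_part D \<rho> (jn T {}) = flat_sym T"
  "reflected_matching.half_part D (jn T {}) = flat_half T"
proof -
  interpret m: reflected_matching D \<rho> "jn T {}" by (rule matching_jn)
  show "m.inv_j = flat T {}" by (simp add: m.inv_j_def flat_def)
  then show "m.sym_part = flat_sym T" "m.half_part = flat_half T"
    by (simp_all add: m.sym_part_def m.half_part_def flat_sym_def flat_half_def)
qed

lemma bij_flat: "bij_betw (\<lambda>(s, t). sym_diff s t) (flat_sym T \<times> flat_half T) (flat T {})"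
  using reflected_matching.bij_sym_half[OF matching_jn] by (simp add: flat_parts)

text \<open>After folding there is one end for each axis point and two for each smoothing
  \<open>h\<close>. Half of their number, \<open>components D + card T\<close>, is the number
  \<open>m\<close> of strings.\<close>

lemma card_flat_sym:
  assumes T: "T \<subseteq> axc"
  shows "card (flat_sym T) = card (flat_half T) * 2 ^ (components D + card T)"
proof -
  have "{d \<in> L - side. jn T {} d = \<rho> d} = {d \<in> L - side. vert d \<in> axp \<union> T}"
  proof -
    have "jn T {} d = \<rho> d \<longleftrightarrow> vert d \<in> axp \<union> T" if d: "d \<in> L" for d
      using d
    proof (cases rule: L_cases)
      case 1
      then show ?thesis using off_smoothings(5)[OF 1] side_\<rho>[OF d] off_axp off_axc T
        by (auto simp: jn_def)
    next
      case 3
      then have "sv d \<in> side \<longleftrightarrow> d \<in> side" using axc_smooth_v d by blast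
      then show ?thesis using 3 side_\<rho>[OF d] by (auto simp: jn_def)
    qed (simp add: jn_def)
    then show ?thesis by blast
  qed
  moreover have "card {d \<in> L - side. vert d \<in> axp \<union> T} = card axp + 2 * card T"
  proof -
    have "(axp \<union> T) \<inter> axp = axp" "(axp \<union> T) \<inter> axc = T" using T axp_axc by blast+
    then show ?thesis using card_half_side[of "axp \<union> T"] T by auto
  qed
  ultimately show ?thesis
    using reflected_matching.card_sym_part(2)[OF matching_jn, of T] components_axis_points
    by (simp add: flat_parts)
qed

text \<open>Duality supplies a white colouring \<open>g\<close> that varies exactly where
  \<open>t\<close> does. Then \<open>t + g\<close> continues straight through the crossings off the
  axis and so is symmetric; this lets the asymmetry of \<open>t\<close> itself continue along the
  strands. So \<open>t\<close> is symmetric, yet supported on one half.\<close>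

lemma half_orthogonal:
  assumes t: "t \<in> flat_half T"
    and orth: "\<And>s. s \<in> flat_sym T \<Longrightarrow> even (card (varies s \<inter> varies t))"
  shows "t = {}"
proof -
  interpret m: reflected_matching D \<rho> "jn T {}" by (rule matching_jn)
  have tf: "t \<in> flat T {}" "t \<inter> side = {}" using t by (auto simp: flat_half_def)
  have "even (card (varies f \<inter> varies t))" if f: "f \<in> flat T {}" for f
  proof -
    \<comment> \<open>The crossings in \<open>varies t\<close> lie off \<open>side\<close>, where
      \<open>f\<close> and this symmetric colouring agree; so \<open>t\<close> is orthogonal to all
      black colourings.\<close>
    let ?s = "mirror (- side) f"
    have "?s \<in> flat_sym T" using m.mirror_side(2)[of f] f by (simp add: flat_parts)
    moreover have "c \<in> varies f \<longleftrightarrow> c \<in> varies ?s" if c: "c \<in> varies t" for c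
    proof -
      have co: "c \<in> off" using c varies_off by blast
      obtain d where d: "d \<in> c" "d \<in> t" using c by (auto simp: varies_def)
      have v: "vert d = c" using off_vert[OF co d(1)] .
      note s = off_smoothings[of d, unfolded v, OF co]
      have "opp D d \<in> side \<longleftrightarrow> d \<in> side"
        using off_opp(1)[of d] off_smoothings(5)[of "ws d"] s(7,11) v co by simp
      then have "x \<notin> side" if "x \<in> c" for x
        using that off_opp(3)[of d, unfolded v, OF co] s(5,11) d tf(2) by auto
      then have "c \<inter> ?s = c \<inter> f" using off_link[OF co] by (auto simp: mirror_def)
      then have "c \<subseteq> f \<longleftrightarrow> c \<subseteq> ?s" "c \<inter> f = {} \<longleftrightarrow> c \<inter> ?s = {}" by blast+
      then show ?thesis by (simp add: varies_def)
    qed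
    then have "varies f \<inter> varies t = varies ?s \<inter> varies t" by blast
    ultimately show ?thesis using orth by simp
  qed
  then obtain g where g: "g \<in> flat T off" "varies g = varies t"
    using ws_colouring_of_orthogonal[OF varies_off] by metis
  note tD = flatD[OF tf(1)] and gD = flatD[OF g(1)]
  have axis: "jn T {} d = jn T off d" if "vert d \<notin> off" for d using that by (simp add: jn_def)
  \<comment> \<open>Going straight on changes either colouring exactly where it varies, and these
    crossings coincide.\<close>
  have opp_inv: "opp D d \<in> sym_diff t g \<longleftrightarrow> d \<in> sym_diff t g" if v: "vert d \<in> off" for d
  proof -
    let ?c = "vert d"
    have tb: "bs x \<in> t \<longleftrightarrow> x \<in> t" if "x \<in> ?c" for x using flat_bs[OF tf(1) v _ that] by simp
    have gw: "ws x \<in> g \<longleftrightarrow> x \<in> g" if "x \<in> ?c" for x using flat_ws[OF g(1) v v that] .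
    note cl = off_closed[OF v vert_self]
    have "opp D d \<in> t \<longleftrightarrow> ws d \<in> t" using tb[of "ws d"] cl off_opp(1)[OF v] by simp
    moreover have "opp D d \<in> g \<longleftrightarrow> bs d \<in> g" using gw[of "bs d"] cl off_opp(2)[OF v] by simp
    moreover have "?c \<in> varies t \<longleftrightarrow> (ws d \<in> t \<longleftrightarrow> d \<notin> t)" using varies_bs[OF v vert_self tb] .
    moreover have "?c \<in> varies g \<longleftrightarrow> (bs d \<in> g \<longleftrightarrow> d \<notin> g)" using varies_ws[OF v vert_self gw] .
    ultimately show ?thesis using g(2) by auto
  qed
  have tg: "mirror_inv (sym_diff t g)"
  proof (rule sym_if_opp_inv_off[of _ T "{}"])
    show "sym_diff t g \<subseteq> L" using tD(1) gD(1) by auto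
    fix d assume d: "d \<in> L"
    show "e d \<in> sym_diff t g \<longleftrightarrow> d \<in> sym_diff t g" using tD(2)[OF d] gD(2)[OF d] by auto
    show "jn T {} d \<in> sym_diff t g \<longleftrightarrow> d \<in> sym_diff t g" if "vert d \<notin> off"
      using tD(3)[OF d] gD(3)[OF d] axis[OF that] by auto
    show "(opp D d \<in> sym_diff t g \<longleftrightarrow> \<rho> (opp D d) \<in> sym_diff t g) \<longleftrightarrow>
        (d \<in> sym_diff t g \<longleftrightarrow> \<rho> d \<in> sym_diff t g)" if v: "vert d \<in> off"
    proof -
      have "vert (\<rho> d) \<in> off" using v vert_\<rho>_cases(1)[OF L_darts[OF d]] by simp
      then show ?thesis using opp_inv[OF v] opp_inv[of "\<rho> d"] opp_props(4)[OF d] by simp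
    qed
  qed
  have diff: "(d \<in> t \<longleftrightarrow> \<rho> d \<in> t) \<longleftrightarrow> (d \<in> g \<longleftrightarrow> \<rho> d \<in> g)" if "d \<in> L" for d
    using tg that unfolding mirror_inv_def by blast
  have "mirror_inv t"
  proof (rule sym_if_opp_inv_off[of _ T "{}"])
    show "t \<subseteq> L" by (fact tD(1))
    fix d assume d: "d \<in> L"
    show "e d \<in> t \<longleftrightarrow> d \<in> t" using tD(2)[OF d] .
    show "jn T {} d \<in> t \<longleftrightarrow> d \<in> t" using tD(3)[OF d] .
    assume v: "vert d \<in> off"
    note s = off_smoothings[OF v]
    have v': "vert (\<rho> d) \<in> off" using v vert_\<rho>_cases(1)[OF L_darts[OF d]] by simp
    have vb: "vert (bs d) = vert d" "vert (bs (\<rho> d)) = vert (\<rho> d)" "vert (ws d) = vert d"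
      using s(1,7) off_smoothings(1)[OF v'] by auto
    have 1: "bs x \<in> t \<longleftrightarrow> x \<in> t" if "vert x \<in> off" for x
      using flat_bs[OF tf(1) that _ vert_self] by simp
    have 2: "ws x \<in> g \<longleftrightarrow> x \<in> g" if "vert x \<in> off" for x
      using flat_ws[OF g(1) that that vert_self] .
    \<comment> \<open>\<open>t\<close> and \<open>g\<close> have the same asymmetry. It is carried
      along \<open>bs\<close> by \<open>t\<close> and along \<open>ws\<close> by \<open>g\<close>,
      hence straight on.\<close>
    have "(opp D d \<in> t \<longleftrightarrow> \<rho> (opp D d) \<in> t) \<longleftrightarrow> (ws d \<in> t \<longleftrightarrow> ws (\<rho> d) \<in> t)"
      using 1[of "ws d"] 1[of "ws (\<rho> d)"] off_opp(1)[OF v] off_opp(1)[OF v'] opp_props(4)[OF d] v v' vb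
        off_smoothings(7)[OF v'] by simp
    also have "\<dots> \<longleftrightarrow> (ws d \<in> g \<longleftrightarrow> ws (\<rho> d) \<in> g)" using diff[of "ws d"] s(9,12) by simp
    also have "\<dots> \<longleftrightarrow> (d \<in> g \<longleftrightarrow> \<rho> d \<in> g)" using 2[OF v] 2[OF v'] by simp
    also have "\<dots> \<longleftrightarrow> (d \<in> t \<longleftrightarrow> \<rho> d \<in> t)" using diff[OF d] by simp
    finally show "(opp D d \<in> t \<longleftrightarrow> \<rho> (opp D d) \<in> t) \<longleftrightarrow> (d \<in> t \<longleftrightarrow> \<rho> d \<in> t)" .
  qed
  show ?thesis
  proof (rule ccontr)
    assume "t \<noteq> {}"
    then obtain d where d: "d \<in> t" by auto
    then have "d \<in> L" "d \<notin> side" "\<rho> d \<in> t" using tD(1) tf(2) \<open>mirror_inv t\<close> by (auto simp: mirror_inv_def)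
    then show False using side_\<rho>[of d] tf(2) by auto
  qed
qed

end

section \<open>Gauss sums\<close>

lemma neg_one_power_sym_diff:
  assumes "finite X" "finite Y"
  shows "(- 1 :: 'a::comm_ring_1) ^ card (sym_diff X Y) = (- 1) ^ card X * (- 1) ^ card Y"
  using even_card_sym_diff[OF assms] by (cases "even (card X)"; cases "even (card Y)") auto

context reflected_union
begin

lemma off_side: "c \<in> off \<Longrightarrow> c \<subseteq> side \<or> c \<inter> side = {}"
proof -
  assume c: "c \<in> off"
  obtain d where d: "d \<in> c" using off_nonempty[OF c] by auto
  note v = off_vert[OF c d]
  note s = off_smoothings[of d, unfolded v, OF c]
  have "opp D d \<in> side \<longleftrightarrow> d \<in> side"
    using off_opp(1)[of d] off_smoothings(5)[of "ws d"] s(7,11) v c by simp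
  then have "x \<in> side \<longleftrightarrow> d \<in> side" if "x \<in> c" for x
    using that off_opp(3)[of d, unfolded v, OF c] s(5,11) by auto
  then show ?thesis by blast
qed

lemma \<rho>_off:
  assumes "c \<in> off"
  shows "\<rho> ` c \<in> off" "\<rho> ` \<rho> ` c = c" "\<rho> ` c \<subseteq> side \<longleftrightarrow> c \<inter> side = {}"
proof -
  obtain d where d: "d \<in> c" using off_nonempty[OF assms] by auto
  note v = off_vert[OF assms d]
  have cL: "c \<subseteq> L" using off_link[OF assms] by auto
  then have dD: "d \<in> darts D" using d L_darts by auto
  show "\<rho> ` c \<in> off" using vert_\<rho>_cases(1)[OF dD] vert_\<rho>[OF dD] v assms by simp
  have "\<rho> (\<rho> x) = x" if "x \<in> c" for x using \<rho>_\<rho> L_darts cL that by blast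
  then show "\<rho> ` \<rho> ` c = c" by (force simp: image_image)
  have "\<rho> x \<in> side \<longleftrightarrow> x \<notin> side" if "x \<in> c" for x using side_\<rho> cL that by blast
  then show "\<rho> ` c \<subseteq> side \<longleftrightarrow> c \<inter> side = {}" by blast
qed

text \<open>A crossing off the axis lies on one side and its mirror image on the other, so
  \<open>Y\<close> splits into two-element orbits whose factors cancel.\<close>

lemma prod_pairs:
  fixes h :: "'d set \<Rightarrow> 'a::comm_ring_1"
  assumes Y: "Y \<subseteq> off" "\<And>c. c \<in> Y \<Longrightarrow> \<rho> ` c \<in> Y"
    and h: "\<And>c. c \<in> off \<Longrightarrow> h c * h (\<rho> ` c) = 1"
  shows "(\<Prod>c\<in>Y. h c) = 1"
proof -
  define Y1 where "Y1 = {c \<in> Y. c \<subseteq> side}"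
  define Y2 where "Y2 = {c \<in> Y. \<not> c \<subseteq> side}"
  have fin: "finite Y1" "finite Y2" using finite_subset[OF Y(1) finite_off] by (simp_all add: Y1_def Y2_def)
  have flip: "\<rho> ` c \<subseteq> side \<longleftrightarrow> \<not> c \<subseteq> side" if "c \<in> Y" for c
  proof -
    have "c \<noteq> {}" using that Y(1) off_nonempty by blast
    then show ?thesis using \<rho>_off(3)[of c] off_side[of c] that Y(1) by blast
  qed
  have bij: "bij_betw (image \<rho>) Y1 Y2"
  proof (rule bij_betwI[where g = "image \<rho>"])
    show "image \<rho> \<in> Y1 \<rightarrow> Y2" "image \<rho> \<in> Y2 \<rightarrow> Y1"
      unfolding Y1_def Y2_def using Y(2) flip by blast+
    show "\<rho> ` \<rho> ` c = c" if "c \<in> Y1" for c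
      by (rule \<rho>_off(2)) (use that Y(1) in \<open>auto simp: Y1_def\<close>)
    show "\<rho> ` \<rho> ` c = c" if "c \<in> Y2" for c
      by (rule \<rho>_off(2)) (use that Y(1) in \<open>auto simp: Y2_def\<close>)
  qed
  have "Y = Y1 \<union> Y2" by (auto simp: Y1_def Y2_def)
  then have "(\<Prod>c\<in>Y. h c) = (\<Prod>c\<in>Y1 \<union> Y2. h c)" by simp
  also have "\<dots> = (\<Prod>c\<in>Y1. h c) * (\<Prod>c\<in>Y2. h c)"
    using fin by (intro prod.union_disjoint) (auto simp: Y1_def Y2_def)
  also have "(\<Prod>c\<in>Y2. h c) = (\<Prod>c\<in>Y1. h (\<rho> ` c))"
    using prod.reindex_bij_betw[OF bij, of h] by simp
  also have "(\<Prod>c\<in>Y1. h c) * (\<Prod>c\<in>Y1. h (\<rho> ` c)) = (\<Prod>c\<in>Y1. h c * h (\<rho> ` c))"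
    by (simp add: prod.distrib)
  also have "\<dots> = 1" using h Y(1) by (intro prod.neutral) (auto simp: Y1_def)
  finally show ?thesis .
qed

lemma varies_\<rho>:
  assumes "mirror_inv f" "c \<in> varies f"
  shows "\<rho> ` c \<in> varies f"
proof -
  have c: "c \<in> off" using assms varies_off by blast
  have "\<rho> x \<in> f \<longleftrightarrow> x \<in> f" if "x \<in> c" for x
    using assms(1) off_link[OF c that] unfolding mirror_inv_def by blast
  then have "\<rho> ` c \<subseteq> f \<longleftrightarrow> c \<subseteq> f" "\<rho> ` c \<inter> f = {} \<longleftrightarrow> c \<inter> f = {}" by blast+
  then show ?thesis using assms(2) \<rho>_off(1)[OF c] unfolding varies_def by blast
qed

lemma flat_symD: "s \<in> flat_sym T \<Longrightarrow> s \<in> flat T {}" and flat_halfD: "t \<in> flat_half T \<Longrightarrow> t \<in> flat T {}"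
  by (auto simp: flat_sym_def flat_half_def)

lemma finite_flat_parts: "finite (flat_sym T)" "finite (flat_half T)"
  using finite_flat by (simp_all add: flat_sym_def flat_half_def)

lemma empty_parts: "{} \<in> flat_sym T" "{} \<in> flat_half T"
  using xor_closed_flat[of T "{}"] by (auto simp: flat_sym_def flat_half_def xor_closed_def mirror_inv_def)

lemma varies_empty [simp]: "varies {} = {}"
  by (auto simp: varies_def)

lemma sum_flat:
  fixes h :: "'d set set \<Rightarrow> 'a::comm_ring_1"
  shows "(\<Sum>f\<in>flat T {}. h (varies f)) =
    (\<Sum>t\<in>flat_half T. \<Sum>s\<in>flat_sym T. h (sym_diff (varies s) (varies t)))"
proof -
  have "(\<Sum>f\<in>flat T {}. h (varies f)) =
      (\<Sum>x\<in>flat_sym T \<times> flat_half T. h (varies (case x of (s, t) \<Rightarrow> sym_diff s t)))"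
    using sum.reindex_bij_betw[OF bij_flat, of "\<lambda>f. h (varies f)" T] by simp
  also have "\<dots> = (\<Sum>s\<in>flat_sym T. \<Sum>t\<in>flat_half T. h (varies (sym_diff s t)))"
    by (simp add: sum.cartesian_product case_prod_unfold)
  also have "\<dots> = (\<Sum>s\<in>flat_sym T. \<Sum>t\<in>flat_half T. h (sym_diff (varies s) (varies t)))"
    by (intro sum.cong refl arg_cong[of _ _ h] varies_sym_diff) (auto dest: flat_symD flat_halfD)
  finally show ?thesis by (subst sum.swap)
qed

lemma sum_flat_sym_character:
  assumes "t \<in> flat_half T"
  shows "(\<Sum>s\<in>flat_sym T. (- 1 :: 'a::comm_ring_1) ^ card (varies s \<inter> varies t)) =
    (if t = {} then of_nat (card (flat_sym T)) else 0)"
proof -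
  have xor: "xor_closed (flat_sym T)"
  proof -
    have "sym_diff f g \<in> flat_sym T" if "f \<in> flat_sym T" "g \<in> flat_sym T" for f g
      using that xor_closedD[OF xor_closed_flat, of f T "{}" g] by (auto simp: flat_sym_def mirror_inv_def)
    then show ?thesis using empty_parts by (simp add: xor_closed_def)
  qed
  have "(\<Sum>s\<in>flat_sym T. (- 1 :: 'a) ^ card (varies s \<inter> varies t)) =
      (if \<forall>s\<in>flat_sym T. even (card (varies s \<inter> varies t)) then of_nat (card (flat_sym T)) else 0)"
    using varies_sym_diff finite_varies flat_symD
    by (intro sum_parity_character[OF finite_flat_parts(1) xor]) blast+
  moreover have "(\<forall>s\<in>flat_sym T. even (card (varies s \<inter> varies t))) \<longleftrightarrow> t = {}"
    using half_orthogonal[OF assms] by auto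
  ultimately show ?thesis by simp
qed

text \<open>Since \<open>h\<close> squares to \<open>- 1\<close>, the product is a quadratic
  function of the set, with associated bilinear form \<open>(- 1) ^ card (X \<inter> Y)\<close>. It
  equals 1 on symmetric colourings, so summing over the symmetric summand leaves a character sum,
  nonzero only for \<open>t = {}\<close>.\<close>

lemma gauss_sum_square_neg_one:
  fixes h :: "'d set \<Rightarrow> 'a::comm_ring_1"
  assumes h: "\<And>c. c \<in> off \<Longrightarrow> h c * h (\<rho> ` c) = 1" "\<And>c. c \<in> off \<Longrightarrow> h c * h c = - 1"
  shows "(\<Sum>f\<in>flat T {}. \<Prod>c\<in>varies f. h c) = of_nat (card (flat_sym T))"
proof -
  have mult: "(\<Prod>c\<in>sym_diff X Y. h c) = (\<Prod>c\<in>X. h c) * (\<Prod>c\<in>Y. h c) * (- 1) ^ card (X \<inter> Y)"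
    if XY: "X \<subseteq> off" "Y \<subseteq> off" for X Y
  proof -
    have fin: "finite X" "finite Y" using XY finite_off finite_subset by auto
    have "(\<Prod>c\<in>X. h c) * (\<Prod>c\<in>Y. h c) =
        ((\<Prod>c\<in>X - Y. h c) * (\<Prod>c\<in>X \<inter> Y. h c)) * ((\<Prod>c\<in>Y - X. h c) * (\<Prod>c\<in>X \<inter> Y. h c))"
      using prod.Int_Diff[OF fin(1), of h Y] prod.Int_Diff[OF fin(2), of h X]
      by (simp add: mult_ac Int_commute)
    also have "\<dots> = ((\<Prod>c\<in>X - Y. h c) * (\<Prod>c\<in>Y - X. h c)) * (\<Prod>c\<in>X \<inter> Y. h c * h c)"
      by (simp add: prod.distrib mult_ac)
    also have "(\<Prod>c\<in>X - Y. h c) * (\<Prod>c\<in>Y - X. h c) = (\<Prod>c\<in>sym_diff X Y. h c)"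
      using fin by (intro prod.union_disjoint[symmetric]) auto
    also have "(\<Prod>c\<in>X \<inter> Y. h c * h c) = (\<Prod>c\<in>X \<inter> Y. - 1)"
      by (rule prod.cong[OF refl]) (use h(2) XY in blast)
    finally show ?thesis by (simp add: mult.assoc flip: power_mult_distrib)
  qed
  have one: "(\<Prod>c\<in>varies s. h c) = 1" if "s \<in> flat_sym T" for s
    using that varies_\<rho> by (intro prod_pairs[where h = h] varies_off h(1)) (auto simp: flat_sym_def)
  have "(\<Sum>f\<in>flat T {}. \<Prod>c\<in>varies f. h c) = (\<Sum>t\<in>flat_half T. \<Sum>s\<in>flat_sym T.
      (\<Prod>c\<in>sym_diff (varies s) (varies t). h c))"
    by (rule sum_flat)
  also have "\<dots> = (\<Sum>t\<in>flat_half T. (\<Prod>c\<in>varies t. h c) *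
      (\<Sum>s\<in>flat_sym T. (- 1) ^ card (varies s \<inter> varies t)))"
    unfolding sum_distrib_left
    by (intro sum.cong refl) (simp add: mult varies_off one)
  also have "\<dots> = (\<Sum>t\<in>flat_half T. if t = {} then of_nat (card (flat_sym T)) else 0)"
    by (intro sum.cong refl) (simp add: sum_flat_sym_character)
  also have "\<dots> = of_nat (card (flat_sym T))"
    using finite_flat_parts(2) empty_parts(2) by (simp add: sum.delta)
  finally show ?thesis .
qed

text \<open>The parity of a union is \<open>|X| + |Y| + |X \<inter> Y|\<close>, quadratic in the
  pair and trivial on pairs of symmetric colourings. The mixed terms couple \<open>s\<close> with
  \<open>t'\<close> and \<open>s'\<close> with \<open>t\<close>, so the two symmetric sums force
  both half colourings to vanish.\<close>

lemma gauss_sum_pairs: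
  "(\<Sum>f\<in>flat T {}. \<Sum>g\<in>flat T {}. (- 1 :: 'a::comm_ring_1) ^ card (varies f \<union> varies g)) =
    of_nat (card (flat_sym T)) ^ 2"
proof -
  define m :: "'d set set \<Rightarrow> 'a" where "m X = (- 1) ^ card X" for X
  have msd: "m (sym_diff X Y) = m X * m Y" if "X \<subseteq> off" "Y \<subseteq> off" for X Y
    unfolding m_def using that finite_off finite_subset by (intro neg_one_power_sym_diff) auto
  have mun: "m (X \<union> Y) = m X * m Y * m (X \<inter> Y)" if "X \<subseteq> off" "Y \<subseteq> off" for X Y
  proof -
    have "X \<union> Y = sym_diff (sym_diff X Y) (X \<inter> Y)" by blast
    then have "m (X \<union> Y) = m (sym_diff (sym_diff X Y) (X \<inter> Y))" by (rule arg_cong)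
    also have "\<dots> = m (sym_diff X Y) * m (X \<inter> Y)" by (rule msd) (use that in blast)+
    finally show ?thesis using msd[OF that] by simp
  qed
  have m1: "m Y = 1" if "Y \<subseteq> off" "\<And>c. c \<in> Y \<Longrightarrow> \<rho> ` c \<in> Y" for Y
    using prod_pairs[OF that, of "\<lambda>c. - 1 :: 'a"] by (simp add: m_def)
  have ms: "m (varies s) = 1" if "s \<in> flat_sym T" for s
    using that varies_\<rho> by (intro m1 varies_off) (auto simp: flat_sym_def)
  have mss: "m (varies s \<inter> varies s') = 1" if "s \<in> flat_sym T" "s' \<in> flat_sym T" for s s'
    using that varies_\<rho> varies_off[of s] by (intro m1) (auto simp: flat_sym_def)
  have key: "m (sym_diff (varies s) (varies t) \<union> sym_diff (varies s') (varies t')) =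
      m (varies t) * m (varies t') * m (varies t \<inter> varies t') *
      (m (varies s \<inter> varies t') * m (varies s' \<inter> varies t))"
    if "s \<in> flat_sym T" "s' \<in> flat_sym T" for s s' t t'
  proof -
    let ?S = "varies s" and ?S' = "varies s'" and ?T = "varies t" and ?T' = "varies t'"
    have o: "?S \<subseteq> off" "?S' \<subseteq> off" "?T \<subseteq> off" "?T' \<subseteq> off" by (rule varies_off)+
    have "sym_diff ?S ?T \<inter> sym_diff ?S' ?T' =
        sym_diff (sym_diff (?S \<inter> ?S') (?S \<inter> ?T')) (sym_diff (?S' \<inter> ?T) (?T \<inter> ?T'))" by blast
    moreover have "m (sym_diff (sym_diff (?S \<inter> ?S') (?S \<inter> ?T')) (sym_diff (?S' \<inter> ?T) (?T \<inter> ?T'))) =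
        m (?S \<inter> ?S') * m (?S \<inter> ?T') * (m (?S' \<inter> ?T) * m (?T \<inter> ?T'))"
      using o by (subst msd, blast, blast, subst msd, blast, blast, subst msd, blast, blast) (rule refl)
    ultimately have "m (sym_diff ?S ?T \<union> sym_diff ?S' ?T') =
        (m ?S * m ?T) * (m ?S' * m ?T') *
        (m (?S \<inter> ?S') * m (?S \<inter> ?T') * (m (?S' \<inter> ?T) * m (?T \<inter> ?T')))"
      using o by (subst mun, blast, blast) (simp add: msd)
    then show ?thesis using ms mss that by (simp add: mult_ac)
  qed
  have "(\<Sum>f\<in>flat T {}. \<Sum>g\<in>flat T {}. (- 1 :: 'a) ^ card (varies f \<union> varies g)) =
      (\<Sum>t\<in>flat_half T. \<Sum>s\<in>flat_sym T. \<Sum>t'\<in>flat_half T. \<Sum>s'\<in>flat_sym T.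
        m (sym_diff (varies s) (varies t) \<union> sym_diff (varies s') (varies t')))"
    unfolding m_def sum_flat[of "\<lambda>Y. (\<Sum>g\<in>flat T {}. (- 1 :: 'a) ^ card (Y \<union> varies g))"]
    by (intro sum.cong refl sum_flat)
  also have "\<dots> = (\<Sum>t\<in>flat_half T. \<Sum>s\<in>flat_sym T. \<Sum>t'\<in>flat_half T. \<Sum>s'\<in>flat_sym T.
        m (varies t) * m (varies t') * m (varies t \<inter> varies t') *
        (m (varies s \<inter> varies t') * m (varies s' \<inter> varies t)))"
    by (intro sum.cong refl key)
  also have "\<dots> = (\<Sum>t\<in>flat_half T. \<Sum>t'\<in>flat_half T.
        m (varies t) * m (varies t') * m (varies t \<inter> varies t') *
        ((\<Sum>s\<in>flat_sym T. m (varies s \<inter> varies t')) * (\<Sum>s'\<in>flat_sym T. m (varies s' \<inter> varies t))))"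
    unfolding sum_product unfolding sum_distrib_left
    by (rule sum.cong[OF refl], rule sum.swap)
  also have "\<dots> = (\<Sum>t\<in>flat_half T. \<Sum>t'\<in>flat_half T.
        if t = {} then if t' = {} then of_nat (card (flat_sym T)) ^ 2 else 0 else 0)"
    unfolding m_def
    by (intro sum.cong refl) (auto simp: sum_flat_sym_character power2_eq_square)
  also have "\<dots> = of_nat (card (flat_sym T)) ^ 2"
    using finite_flat_parts(2)[of T] empty_parts(2)[of T]
    by (subst sum.swap) (simp add: sum.delta)
  finally show ?thesis .
qed

end

section \<open>The state sum\<close>

lemma power_int_sum:
  fixes x :: "'a::field"
  assumes "x \<noteq> 0"
  shows "x powi (\<Sum>v\<in>V. g v) = (\<Prod>v\<in>V. x powi g v)"
  using assms by (induction V rule: infinite_finite_induct) (auto simp: power_int_add)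

context reflected_union
begin

text \<open>The crossings off the axis whose \<open>A\<close>-smoothing is \<open>bs\<close>.\<close>

definition aligned where "aligned = {v \<in> off. \<forall>d\<in>v. d \<in> over D \<longleftrightarrow> d \<in> black}"

lemma aligned_dart:
  assumes "v \<in> off" "d \<in> v"
  shows "v \<in> aligned \<longleftrightarrow> (d \<in> over D \<longleftrightarrow> d \<in> black)"
proof -
  have v: "vert d = v" using off_vert[OF assms] .
  have step: "(r x \<in> over D \<longleftrightarrow> r x \<in> black) \<longleftrightarrow> (x \<in> over D \<longleftrightarrow> x \<in> black)" if "x \<in> v" for x
    using over_off[OF assms(1) that] black_link(2)[OF off_link[OF assms(1) that]] by auto
  have "v = {d, r d, r (r d), r (r (r d))}" using off4(2)[of d] v assms by simp
  moreover from this have "r d \<in> v" "r (r d) \<in> v" by auto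
  ultimately show ?thesis
    using assms step[of d] step[of "r d"] step[of "r (r d)"] unfolding aligned_def by blast
qed

text \<open>Reflection keeps \<open>over\<close> and complements \<open>black\<close>; so mirrored
  crossings carry inverse weights.\<close>

lemma aligned_\<rho>:
  assumes "v \<in> off"
  shows "\<rho> ` v \<in> aligned \<longleftrightarrow> v \<notin> aligned"
proof -
  obtain d where d: "d \<in> v" using off_nonempty[OF assms] by auto
  have "\<rho> ` v \<in> aligned \<longleftrightarrow> (\<rho> d \<in> over D \<longleftrightarrow> \<rho> d \<in> black)"
    using aligned_dart[OF \<rho>_off(1)[OF assms]] d by blast
  then show ?thesis
    using aligned_dart[OF assms d] \<rho>_over[OF assms d] black_\<rho>[OF off_link[OF assms d]] by auto
qed

text \<open>Translation of conventions: \<open>U\<close> consists of the crossings smoothed by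
  \<open>ws\<close>, whereas \<open>smoothing\<close> expects those with the smoothing
  \<open>A\<close> or \<open>h\<close>.\<close>

definition state where "state T U = T \<union> {v \<in> off. v \<in> aligned \<longleftrightarrow> v \<notin> U}"

lemma smoothing_state:
  assumes T: "T \<subseteq> axc" and d: "d \<in> L"
  shows "smoothing D (state T U) d = jn T U d"
  using d
proof (cases rule: L_cases)
  case 1
  have "vert d \<notin> T" using 1 T off_axc by blast
  then have S: "vert d \<in> state T U \<longleftrightarrow> (vert d \<in> aligned \<longleftrightarrow> vert d \<notin> U)" using 1 by (auto simp: state_def)
  show ?thesis
    using 1 S aligned_dart[OF 1 vert_self]
    by (auto simp: smoothing_def jn_def smooth_A_def smooth_B_def bs_def ws_def Let_def)
next
  case 2
  have "vert d \<notin> axc" using 2 axp_axc by blast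
  then show ?thesis using 2 axp_opp[OF 2(1) d] by (simp add: smoothing_def jn_def Let_def)
next
  case 3
  then have "vert d \<in> state T U \<longleftrightarrow> vert d \<in> T" by (auto simp: state_def)
  then show ?thesis using 3 axc_smooth_h[OF 3(1) d] by (auto simp: smoothing_def jn_def Let_def)
qed

lemma card_flat_state:
  assumes "T \<subseteq> axc"
  shows "card (flat T U) = 2 ^ state_circles D (state T U)"
proof -
  have eq: "smoothing D (state T U) d = jn T U d" if "d \<in> L" for d
    using smoothing_state[OF assms that] .
  have "flat T U = inv_sets L e \<inter> inv_sets L (smoothing D (state T U))"
    unfolding flat_def inv_sets_def using eq by auto
  moreover have "card (inv_sets L e \<inter> inv_sets L (smoothing D (state T U))) =
      2 ^ state_circles D (state T U)"
    unfolding state_circles_def curves_def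
    by (rule card_inv_sets_quotient[OF finite_L]) (use e_e L_darts eq jn_props in auto)
  ultimately show ?thesis by simp
qed

lemma state_axis_pairs_state:
  assumes "T \<subseteq> axc"
  shows "state_axis_pairs D (state T U) = components D + card T"
proof -
  have "state T U \<inter> axc = T" using assms off_axc by (auto simp: state_def)
  then show ?thesis by (simp add: state_axis_pairs_def components_axis_points)
qed

text \<open>\<open>card_flat\<close> gives \<open>c(U) + c({}) = 2 a + |U|\<close>, while the
  splitting into symmetric and half colourings gives \<open>c({}) = 2 h + m\<close> and
  \<open>b = h + m\<close>; eliminate \<open>c({})\<close> and \<open>h\<close>.\<close>

lemma state_exponent:
  assumes T: "T \<subseteq> axc" and U: "U \<subseteq> off"
  obtains a b where "card {f \<in> flat T {}. varies f \<inter> U = {}} = 2 ^ a" "card (flat_sym T) = 2 ^ b"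
    "int (state_circles D (state T U)) - int (components D + card T) =
      2 * (int a - int b) + int (card U)"
proof -
  define k k0 m where "k = state_circles D (state T U)" and "k0 = state_circles D (state T {})"
    and "m = components D + card T"
  define N where "N = card {f \<in> flat T {}. varies f \<inter> U = {}}"
  have 1: "2 ^ (k + k0) = N\<^sup>2 * 2 ^ card U"
    using card_flat[OF U, of T] by (simp add: card_flat_state[OF T] N_def k_def k0_def power_add)
  then have "N dvd 2 ^ (k + k0)" by (simp add: power2_eq_square mult.assoc)
  then obtain a where a: "N = 2 ^ a" using divides_primepow_nat[OF two_is_prime_nat] by blast
  have "(2::nat) ^ (k + k0) = 2 ^ (2 * a + card U)" using 1 a by (simp add: power_add power_mult mult.commute)
  then have e1: "k + k0 = 2 * a + card U" by simp
  have S: "card (flat_sym T) = card (flat_half T) * 2 ^ m" using card_flat_sym[OF T] by (simp add: m_def)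
  have "2 ^ k0 = card (flat_sym T) * card (flat_half T)"
    using bij_betw_same_card[OF bij_flat, of T] by (simp add: card_flat_state[OF T] k0_def card_cartesian_product)
  then have 2: "2 ^ k0 = card (flat_half T) * card (flat_half T) * 2 ^ m" using S by simp
  then have "card (flat_half T) dvd 2 ^ k0" by (metis dvd_triv_left mult.assoc)
  then obtain h where h: "card (flat_half T) = 2 ^ h" using divides_primepow_nat[OF two_is_prime_nat] by blast
  have "(2::nat) ^ k0 = 2 ^ (2 * h + m)" using 2 h by (simp add: power_add mult_2)
  then have e2: "k0 = 2 * h + m" by simp
  have "card (flat_sym T) = 2 ^ (h + m)" using S h by (simp add: power_add)
  then show ?thesis
    using that[of a "h + m"] a e1 e2 by (simp add: N_def k_def m_def)
qed

text \<open>The coefficient of the smoothing \<open>bs\<close>; that of \<open>ws\<close> is its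
  inverse.\<close>

definition wt where "wt A v = (if v \<in> aligned then A else inverse A)"

context
  fixes A :: "'a::field_char_0" and \<delta> :: 'a
  assumes A: "A \<noteq> 0" and \<delta>: "\<delta> = - (A powi 2) - A powi (- 2)"
begin

lemma wt_nonzero: "wt A v \<noteq> 0"
  using A by (simp add: wt_def)

lemma wt_\<rho>: "v \<in> off \<Longrightarrow> wt A (\<rho> ` v) = inverse (wt A v)"
  using aligned_\<rho> by (simp add: wt_def)

text \<open>The curl relation of the Kauffman bracket, in both mirror forms.\<close>

lemma wt_kink: "wt A v + inverse (wt A v) * \<delta> = - (inverse (wt A v) ^ 3)"
proof -
  have \<delta>': "\<delta> = - (A ^ 2) - inverse A ^ 2"
    using \<delta> by (simp add: power_int_minus power_inverse)
  have "x + inverse x * (- (x ^ 2) - inverse x ^ 2) = - (inverse x ^ 3)" if "x \<noteq> 0" for x :: 'a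
    using that by (simp add: field_simps power2_eq_square power3_eq_cube)
  from this[of A] this[of "inverse A"] A show ?thesis
    unfolding wt_def \<delta>' by (auto simp: algebra_simps)
qed

text \<open>The sum factors over the crossings. A crossing outside \<open>Y\<close> gives the curl
  factor of \<open>wt_kink\<close>, one in \<open>Y\<close> only \<open>wt A v\<close>, which is
  \<open>- (wt A v ^ 4)\<close> times the curl factor; all curl factors together cancel in mirrored
  pairs.\<close>

lemma sum_states_avoiding:
  assumes Y: "Y \<subseteq> off"
  shows "(\<Sum>U\<in>Pow off. if Y \<inter> U = {} then (\<Prod>v\<in>U. inverse (wt A v) * \<delta>) * (\<Prod>v\<in>off - U. wt A v) else 0) =
    (\<Prod>v\<in>Y. - (wt A v ^ 4))"
proof -
  have finY: "finite Y" using Y finite_off finite_subset by auto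
  \<comment> \<open>Giving the crossings of \<open>Y\<close> weight 0 for \<open>ws\<close> encodes
    the condition on \<open>U\<close>, so that the product formula applies.\<close>
  have "(\<Sum>U\<in>Pow off. if Y \<inter> U = {} then (\<Prod>v\<in>U. inverse (wt A v) * \<delta>) * (\<Prod>v\<in>off - U. wt A v) else 0) =
      (\<Sum>U\<in>Pow off. (\<Prod>v\<in>U. if v \<in> Y then 0 else inverse (wt A v) * \<delta>) * (\<Prod>v\<in>off - U. wt A v))"
  proof (rule sum.cong[OF refl])
    fix U assume "U \<in> Pow off"
    then have finU: "finite U" using finite_off finite_subset by auto
    show "(if Y \<inter> U = {} then (\<Prod>v\<in>U. inverse (wt A v) * \<delta>) * (\<Prod>v\<in>off - U. wt A v) else 0) =
        (\<Prod>v\<in>U. if v \<in> Y then 0 else inverse (wt A v) * \<delta>) * (\<Prod>v\<in>off - U. wt A v)"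
    proof (cases "Y \<inter> U = {}")
      case True
      then have "(\<Prod>v\<in>U. if v \<in> Y then 0 else inverse (wt A v) * \<delta>) = (\<Prod>v\<in>U. inverse (wt A v) * \<delta>)"
        by (intro prod.cong) auto
      then show ?thesis using True by simp
    next
      case False
      then have "(\<Prod>v\<in>U. if v \<in> Y then 0 else inverse (wt A v) * \<delta>) = 0"
        using finU by (intro prod_zero) auto
      then show ?thesis using False by simp
    qed
  qed
  also have "\<dots> = (\<Prod>v\<in>off. (if v \<in> Y then 0 else inverse (wt A v) * \<delta>) + wt A v)"
    by (rule prod_add[OF finite_off, symmetric])
  also have "\<dots> = (\<Prod>v\<in>off. - (inverse (wt A v) ^ 3) * (if v \<in> Y then - (wt A v ^ 4) else 1))"
  proof (rule prod.cong[OF refl])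
    fix v
    have "inverse (wt A v) ^ 3 * wt A v ^ 4 = wt A v"
      using wt_nonzero[of v] by (simp add: field_simps eval_nat_numeral)
    then show "(if v \<in> Y then 0 else inverse (wt A v) * \<delta>) + wt A v =
        - (inverse (wt A v) ^ 3) * (if v \<in> Y then - (wt A v ^ 4) else 1)"
      using wt_kink[of v] by (simp add: add.commute)
  qed
  also have "\<dots> = (\<Prod>v\<in>off. - (inverse (wt A v) ^ 3)) * (\<Prod>v\<in>off. if v \<in> Y then - (wt A v ^ 4) else 1)"
    by (rule prod.distrib)
  also have "(\<Prod>v\<in>off. - (inverse (wt A v) ^ 3)) = 1"
    by (rule prod_pairs)
      (use \<rho>_off(1) wt_\<rho> wt_nonzero in \<open>auto simp: power_inverse simp flip: power_mult_distrib\<close>)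
  also have "(\<Prod>v\<in>off. if v \<in> Y then - (wt A v ^ 4) else 1) = (\<Prod>v\<in>Y. - (wt A v ^ 4))"
    using finite_off Y by (simp add: prod.If_cases Int_absorb1)
  finally show ?thesis by simp
qed

text \<open>Write \<open>N U ^ q\<close> as the number of \<open>q\<close>-tuples of black
  colourings constant on \<open>U\<close> and sum over \<open>U\<close> first. What remains is a
  Gauss sum whose value is exactly the denominator \<open>s ^ q\<close>.\<close>

lemma state_sum:
  assumes T: "T \<subseteq> axc" and sq: "\<delta> ^ 2 \<in> {1, 2, 4}"
  shows "(\<Sum>U\<in>Pow off. (\<Prod>v\<in>U. inverse (wt A v)) * (\<Prod>v\<in>off - U. wt A v) *
    \<delta> powi (int (state_circles D (state T U)) - int (components D + card T))) = 1"
proof -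
  obtain q :: nat where q: "\<delta> ^ 2 = 2 ^ q" "q = 0 \<or> q = 1 \<or> q = 2"
  proof -
    have "\<delta> ^ 2 = 2 ^ 0 \<or> \<delta> ^ 2 = 2 ^ 1 \<or> \<delta> ^ 2 = 2 ^ 2" using sq by auto
    then show ?thesis using that by metis
  qed
  have \<delta>0: "\<delta> \<noteq> 0" using q by auto
  define N where "N U = card {f \<in> flat T {}. varies f \<inter> U = {}}" for U
  define s where "s = card (flat_sym T)"
  have s0: "s \<noteq> 0" unfolding s_def using finite_flat_parts(1) empty_parts(1) by (auto simp: card_eq_0_iff)
  have pow: "\<delta> powi (int (state_circles D (state T U)) - int (components D + card T)) =
      \<delta> ^ card U * of_nat (N U) ^ q / of_nat s ^ q" if U: "U \<in> Pow off" for U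
  proof -
    obtain a b where ab: "N U = 2 ^ a" "s = 2 ^ b"
      "int (state_circles D (state T U)) - int (components D + card T) =
        2 * (int a - int b) + int (card U)"
      using state_exponent[OF T, of U] U unfolding N_def s_def by blast
    have "\<delta> powi (2 * (int a - int b)) = (\<delta> ^ 2) ^ a / (\<delta> ^ 2) ^ b"
    proof -
      have "\<delta> powi (2 * (int a - int b)) = (\<delta> powi 2) powi (int a - int b)" by (rule power_int_mult)
      also have "\<dots> = (\<delta> ^ 2) powi int a / (\<delta> ^ 2) powi int b"
        using \<delta>0 by (simp add: power_int_diff)
      finally show ?thesis by simp
    qed
    also have "\<dots> = (2 ^ a) ^ q / (2 ^ b) ^ q" unfolding q(1) by (simp add: mult.commute flip: power_mult)
    finally have "\<delta> powi (2 * (int a - int b)) = of_nat (N U) ^ q / of_nat s ^ q" using ab by simp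
    then show ?thesis unfolding ab(3) using \<delta>0 by (simp add: power_int_add)
  qed
  define w where "w U = (\<Prod>v\<in>U. inverse (wt A v) * \<delta>) * (\<Prod>v\<in>off - U. wt A v)" for U
  have "(\<Sum>U\<in>Pow off. (\<Prod>v\<in>U. inverse (wt A v)) * (\<Prod>v\<in>off - U. wt A v) *
      \<delta> powi (int (state_circles D (state T U)) - int (components D + card T))) =
      (\<Sum>U\<in>Pow off. w U * of_nat (N U) ^ q / of_nat s ^ q)"
    by (rule sum.cong[OF refl], unfold pow) (simp add: w_def prod.distrib mult_ac)
  also have "\<dots> = (\<Sum>U\<in>Pow off. w U * of_nat (N U) ^ q) / of_nat s ^ q"
    by (simp add: sum_divide_distrib)
  also have "(\<Sum>U\<in>Pow off. w U * of_nat (N U) ^ q) = of_nat s ^ q"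
  proof -
    have N_sum: "of_nat (N U) = (\<Sum>f\<in>flat T {}. if varies f \<inter> U = {} then 1 else 0 :: 'a)" for U
    proof -
      have "flat T {} \<inter> {f. varies f \<inter> U = {}} = {f \<in> flat T {}. varies f \<inter> U = {}}" by auto
      then show ?thesis using finite_flat by (simp add: sum.If_cases N_def)
    qed
    note avoid = sum_states_avoiding[folded w_def]
    have \<delta>A: "\<delta> ^ 2 = A ^ 4 + inverse (A ^ 4) + 2"
      using A unfolding \<delta> by (simp add: power_int_minus field_simps eval_nat_numeral)
    have w4: "wt A v ^ 4 = A ^ 4 \<or> wt A v ^ 4 = inverse (A ^ 4)" for v by (simp add: wt_def power_inverse)
    consider "q = 0" | "q = 1" | "q = 2" using q(2) by auto
    then show ?thesis
    proof cases
      case 1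
      then show ?thesis using avoid[of "{}"] by simp
    next
      case 2
      \<comment> \<open>Here \<open>\<delta>^2 = 2\<close> forces \<open>A^8 = - 1\<close>, so the
        weights \<open>- (wt A v ^ 4)\<close> square to \<open>- 1\<close>.\<close>
      have "(A ^ 4) * (A ^ 4 + inverse (A ^ 4)) = 0" using \<delta>A q(1) 2 by simp
      then have A8: "A ^ 4 * A ^ 4 = - 1" using A by (simp add: distrib_left eq_neg_iff_add_eq_0)
      have "inverse (A ^ 4) * inverse (A ^ 4) = inverse (A ^ 4 * A ^ 4)"
        by (rule inverse_mult_distrib[symmetric])
      then have A8': "inverse (A ^ 4) * inverse (A ^ 4) = - 1" unfolding A8 by simp
      have "(\<Sum>U\<in>Pow off. w U * of_nat (N U) ^ q) =
          (\<Sum>U\<in>Pow off. \<Sum>f\<in>flat T {}. if varies f \<inter> U = {} then w U else 0)"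
        unfolding N_sum 2 by (simp add: sum_distrib_left if_distrib[of "(*) _"] cong: if_cong)
      also have "\<dots> = (\<Sum>f\<in>flat T {}. \<Sum>U\<in>Pow off. if varies f \<inter> U = {} then w U else 0)"
        by (rule sum.swap)
      also have "\<dots> = (\<Sum>f\<in>flat T {}. \<Prod>v\<in>varies f. - (wt A v ^ 4))"
        by (intro sum.cong refl avoid varies_off)
      also have "\<dots> = of_nat s"
        unfolding s_def
      proof (rule gauss_sum_square_neg_one)
        fix c assume c: "c \<in> off"
        show "- (wt A c ^ 4) * - (wt A (\<rho> ` c) ^ 4) = 1"
          using wt_nonzero[of c] wt_\<rho>[OF c] by (simp flip: power_mult_distrib)
        show "- (wt A c ^ 4) * - (wt A c ^ 4) = - 1"
          using w4[of c] A8 A8' by (metis minus_mult_minus)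
      qed
      finally show ?thesis using 2 by simp
    next
      case 3
      \<comment> \<open>Here \<open>\<delta>^2 = 4\<close> forces \<open>A^4 = 1\<close>, so all
        weights \<open>- (wt A v ^ 4)\<close> are \<open>- 1\<close>.\<close>
      have "A ^ 4 + inverse (A ^ 4) = 2" using \<delta>A q(1) 3 by simp
      then have "A ^ 4 * (A ^ 4 + inverse (A ^ 4)) = A ^ 4 * 2" by simp
      then have "(A ^ 4 - 1) * (A ^ 4 - 1) = 0" using A by (simp add: algebra_simps)
      then have "A ^ 4 = 1" by simp
      then have w1: "wt A v ^ 4 = 1" for v using w4[of v] by auto
      have "(\<Sum>U\<in>Pow off. w U * of_nat (N U) ^ q) =
          (\<Sum>U\<in>Pow off. \<Sum>f\<in>flat T {}. \<Sum>g\<in>flat T {}.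
            if (varies f \<union> varies g) \<inter> U = {} then w U else 0)"
      proof (rule sum.cong[OF refl])
        fix U
        have "w U * of_nat (N U) ^ q = (\<Sum>f\<in>flat T {}. \<Sum>g\<in>flat T {}.
            w U * ((if varies f \<inter> U = {} then 1 else 0) * (if varies g \<inter> U = {} then 1 else 0)))"
          unfolding N_sum 3 power2_eq_square sum_product unfolding sum_distrib_left by (rule refl)
        also have "\<dots> = (\<Sum>f\<in>flat T {}. \<Sum>g\<in>flat T {}.
            if (varies f \<union> varies g) \<inter> U = {} then w U else 0)"
          by (intro sum.cong refl) (auto simp: Int_Un_distrib2)
        finally show "w U * of_nat (N U) ^ q = (\<Sum>f\<in>flat T {}. \<Sum>g\<in>flat T {}.
            if (varies f \<union> varies g) \<inter> U = {} then w U else 0)" .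
      qed
      also have "\<dots> = (\<Sum>f\<in>flat T {}. \<Sum>g\<in>flat T {}. \<Sum>U\<in>Pow off.
            if (varies f \<union> varies g) \<inter> U = {} then w U else 0)"
        by (rule trans[OF sum.swap], rule sum.cong[OF refl], rule sum.swap)
      also have "\<dots> = (\<Sum>f\<in>flat T {}. \<Sum>g\<in>flat T {}. \<Prod>v\<in>varies f \<union> varies g. - (wt A v ^ 4))"
        by (intro sum.cong refl avoid Un_least varies_off)
      also have "\<dots> = (\<Sum>f\<in>flat T {}. \<Sum>g\<in>flat T {}. (- 1) ^ card (varies f \<union> varies g))"
        by (simp add: w1)
      also have "\<dots> = of_nat s ^ 2" unfolding s_def by (rule gauss_sum_pairs)
      finally show ?thesis using 3 by simp
    qed
  qed
  finally show ?thesis using s0 by simp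
qed

end

section \<open>The bracket of a symmetric union\<close>

lemma finite_axc: "finite axc"
  using finite_vertices axc_vertices by (meson finite_subset subsetI)

lemma crossings_split: "crossings D = axc \<union> off" "axc \<inter> off = {}"
  using off_axc by (auto simp: crossings_def)

lemma sum_Pow_disjoint:
  assumes "finite X" "finite Y" "X \<inter> Y = {}"
  shows "(\<Sum>S\<in>Pow (X \<union> Y). h S) = (\<Sum>T\<in>Pow X. \<Sum>U\<in>Pow Y. h (T \<union> U))"
proof -
  have bij: "bij_betw (\<lambda>(T, U). T \<union> U) (Pow X \<times> Pow Y) (Pow (X \<union> Y))"
    by (rule bij_betwI[where g = "\<lambda>S. (S \<inter> X, S \<inter> Y)"]) (use assms(3) in auto)
  have "(\<Sum>S\<in>Pow (X \<union> Y). h S) = (\<Sum>x\<in>Pow X \<times> Pow Y. h (case x of (T, U) \<Rightarrow> T \<union> U))"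
    using sum.reindex_bij_betw[OF bij, of h] by simp
  then show ?thesis by (simp add: sum.cartesian_product case_prod_unfold)
qed

definition win where "win B v = (if X_o D v then B else inverse B)"

definition state_term where
  "state_term A B T U =
    (\<Prod>v\<in>T. win B v) * (\<Prod>v\<in>axc - T. inverse (win B v)) *
    ((\<Prod>v\<in>U. inverse (wt A v)) * (\<Prod>v\<in>off - U. wt A v)) * circles_value D A B (state T U)"

text \<open>On the subsets of \<open>off\<close>, passing from the \<open>ws\<close>-smoothings to
  the \<open>A\<close>-smoothings is an involution, so the states may be reindexed by it.\<close>

lemma bracket_states:
  fixes A B :: "'a::field_char_0"
  shows "bracket D A B = (\<Sum>T\<in>Pow axc. \<Sum>U\<in>Pow off. state_term A B T U)"
proof -
  let ?S = "\<lambda>U. {v \<in> off. v \<in> aligned \<longleftrightarrow> v \<notin> U}"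
  define h where "h S = (\<Prod>v\<in>S. weight_in D A B v) * (\<Prod>v\<in>crossings D - S. weight_out D A B v) *
      circles_value D A B S" for S
  have "bracket D A B = (\<Sum>S\<in>Pow (axc \<union> off). h S)"
    by (simp add: bracket_def partial_bracket_def crossings_split(1) h_def)
  also have "\<dots> = (\<Sum>T\<in>Pow axc. \<Sum>U\<in>Pow off. h (T \<union> U))"
    by (rule sum_Pow_disjoint[OF finite_axc finite_off crossings_split(2)])
  also have "\<dots> = (\<Sum>T\<in>Pow axc. \<Sum>U\<in>Pow off. h (T \<union> ?S U))"
  proof (rule sum.cong[OF refl])
    fix T
    have "bij_betw ?S (Pow off) (Pow off)"
      by (rule bij_betwI[where g = ?S]) auto
    then show "(\<Sum>U\<in>Pow off. h (T \<union> U)) = (\<Sum>U\<in>Pow off. h (T \<union> ?S U))"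
      using sum.reindex_bij_betw[of ?S "Pow off" "Pow off" "\<lambda>U. h (T \<union> U)"] by simp
  qed
  also have "\<dots> = (\<Sum>T\<in>Pow axc. \<Sum>U\<in>Pow off. state_term A B T U)"
  proof (intro sum.cong refl)
    fix T U assume T: "T \<in> Pow axc" and U: "U \<in> Pow off"
    have fT: "finite T" "finite U" using T U finite_axc finite_off finite_subset by auto
    have S: "?S U \<subseteq> off" by auto
    have TS: "T \<inter> off = {}" using T crossings_split(2) by auto
    have 1: "(\<Prod>v\<in>T \<union> ?S U. weight_in D A B v) = (\<Prod>v\<in>T. win B v) * (\<Prod>v\<in>?S U. A)"
    proof -
      have "(\<Prod>v\<in>T \<union> ?S U. weight_in D A B v) = (\<Prod>v\<in>T. weight_in D A B v) * (\<Prod>v\<in>?S U. weight_in D A B v)"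
        using fT finite_off TS by (intro prod.union_disjoint) auto
      also have "(\<Prod>v\<in>T. weight_in D A B v) = (\<Prod>v\<in>T. win B v)"
        by (intro prod.cong refl) (use TS in \<open>auto simp: weight_in_def win_def\<close>)
      also have "(\<Prod>v\<in>?S U. weight_in D A B v) = (\<Prod>v\<in>?S U. A)"
        by (intro prod.cong refl) (auto simp: weight_in_def)
      finally show ?thesis .
    qed
    have "crossings D - (T \<union> ?S U) = (axc - T) \<union> (off - ?S U)"
      using T crossings_split by auto
    then have "(\<Prod>v\<in>crossings D - (T \<union> ?S U). weight_out D A B v) =
        (\<Prod>v\<in>axc - T. weight_out D A B v) * (\<Prod>v\<in>off - ?S U. weight_out D A B v)"
      using finite_axc finite_off crossings_split(2) by (simp only:) (intro prod.union_disjoint; auto)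
    also have "(\<Prod>v\<in>axc - T. weight_out D A B v) = (\<Prod>v\<in>axc - T. inverse (win B v))"
      by (intro prod.cong refl) (use crossings_split(2) in \<open>auto simp: weight_out_def win_def\<close>)
    also have "(\<Prod>v\<in>off - ?S U. weight_out D A B v) = (\<Prod>v\<in>off - ?S U. inverse A)"
      by (intro prod.cong refl) (auto simp: weight_out_def)
    finally have 2: "(\<Prod>v\<in>crossings D - (T \<union> ?S U). weight_out D A B v) =
        (\<Prod>v\<in>axc - T. inverse (win B v)) * (\<Prod>v\<in>off - ?S U. inverse A)" .
    have split: "(\<Prod>v\<in>V. x v) * (\<Prod>v\<in>off - V. y v) = (\<Prod>v\<in>off. if v \<in> V then x v else y v)"
      if "V \<subseteq> off" for V and x y :: "'d set \<Rightarrow> 'a"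
      using that finite_off by (simp add: prod.If_cases Int_absorb1 Diff_eq)
    have 3: "(\<Prod>v\<in>?S U. A) * (\<Prod>v\<in>off - ?S U. inverse A) = (\<Prod>v\<in>U. inverse (wt A v)) * (\<Prod>v\<in>off - U. wt A v)"
      unfolding split[OF S] using U
      by (subst split) (auto intro!: prod.cong simp: wt_def)
    show "h (T \<union> ?S U) = state_term A B T U"
      unfolding h_def state_term_def 1 2 3[symmetric] by (simp add: state_def mult_ac)
  qed
  finally show ?thesis .
qed

lemma components_pos: "components D \<ge> 1"
proof -
  have "finite axp" using finite_vertices axp_vertices by (meson finite_subset subsetI)
  then have "card axp > 0" using axis_point_exists by (simp add: card_gt_0_iff)
  then show ?thesis using components_axis_points by simp
qed

text \<open>For each \<open>T\<close> the sum over the crossings off the axis is 1 by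
  \<open>state_sum\<close>. The sum over \<open>T\<close> then factors, each axis crossing
  contributing a curl factor in \<open>B\<close>.\<close>

lemma bracket_eval:
  fixes A B :: "'a::field_char_0"
  assumes A: "A \<noteq> 0" and B: "B \<noteq> 0" and sq: "(- (A powi 2) - A powi (- 2)) ^ 2 \<in> {1, 2, 4}"
  shows "bracket D A B = (- (B powi 2) - B powi (- 2)) ^ (components D - 1) *
    (\<Prod>v\<in>axc. - (win B v ^ 3))"
proof -
  define \<delta> where "\<delta> = - (A powi 2) - A powi (- 2)"
  define z where "z = - (B powi 2) - B powi (- 2)"
  have st: "(\<Sum>U\<in>Pow off. state_term A B T U) =
      z ^ (components D - 1) * ((\<Prod>v\<in>T. win B v * z) * (\<Prod>v\<in>axc - T. inverse (win B v)))"
    if T: "T \<in> Pow axc" for T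
  proof -
    have Tc: "T \<subseteq> axc" using T by simp
    have cv: "circles_value D A B (state T U) =
        \<delta> powi (int (state_circles D (state T U)) - int (components D + card T)) *
        (z ^ (components D - 1) * z ^ card T)" for U
    proof -
      \<comment> \<open>Truncated subtraction is harmless because there is at least one
        component.\<close>
      have "int (components D + card T) - 1 = int (components D - 1 + card T)"
        using components_pos by simp
      then show ?thesis
        by (simp only: circles_value_def state_axis_pairs_state[OF Tc] \<delta>_def z_def power_int_of_nat power_add)
    qed
    have "(\<Sum>U\<in>Pow off. state_term A B T U) =
        (\<Prod>v\<in>T. win B v) * (\<Prod>v\<in>axc - T. inverse (win B v)) * (z ^ (components D - 1) * z ^ card T) *
        (\<Sum>U\<in>Pow off. (\<Prod>v\<in>U. inverse (wt A v)) * (\<Prod>v\<in>off - U. wt A v) *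
          \<delta> powi (int (state_circles D (state T U)) - int (components D + card T)))"
      unfolding sum_distrib_left by (rule sum.cong[OF refl]) (simp only: state_term_def cv mult_ac)
    also have "(\<Sum>U\<in>Pow off. (\<Prod>v\<in>U. inverse (wt A v)) * (\<Prod>v\<in>off - U. wt A v) *
          \<delta> powi (int (state_circles D (state T U)) - int (components D + card T))) = 1"
      using state_sum[OF A \<delta>_def Tc] sq by (simp add: \<delta>_def)
    finally show ?thesis by (simp add: prod.distrib mult_ac)
  qed
  have "bracket D A B = (\<Sum>T\<in>Pow axc. z ^ (components D - 1) *
      ((\<Prod>v\<in>T. win B v * z) * (\<Prod>v\<in>axc - T. inverse (win B v))))"
    unfolding bracket_states by (rule sum.cong[OF refl st])
  also have "\<dots> = z ^ (components D - 1) * (\<Prod>v\<in>axc. win B v * z + inverse (win B v))"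
    by (simp add: prod_add[OF finite_axc] sum_distrib_left)
  also have "(\<Prod>v\<in>axc. win B v * z + inverse (win B v)) = (\<Prod>v\<in>axc. - (win B v ^ 3))"
  proof (rule prod.cong[OF refl])
    fix v
    have z: "z = - (B ^ 2) - inverse B ^ 2" by (simp add: z_def power_int_minus power_inverse)
    have "x * (- (x ^ 2) - inverse x ^ 2) + inverse x = - (x ^ 3)" if "x \<noteq> 0" for x :: 'a
      using that by (simp add: field_simps power2_eq_square power3_eq_cube)
    from this[of B] this[of "inverse B"] B show "win B v * z + inverse (win B v) = - (win B v ^ 3)"
      unfolding win_def z by (auto simp: algebra_simps)
  qed
  finally show ?thesis by (simp add: z_def)
qed

subsection \<open>Signs\<close>

context
  fixes Or
  assumes Or: "orientation D Or"
begin

lemma Or_L: "Or \<subseteq> L" and Or_e: "d \<in> L \<Longrightarrow> e d \<in> Or \<longleftrightarrow> d \<notin> Or"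
  and Or_travel: "d \<in> Or \<Longrightarrow> travel D d \<in> Or"
  using Or by (auto simp: orientation_def)

text \<open>If \<open>d\<close> is not outgoing, \<open>e d\<close> is, and by
  \<open>reverse\<close> the image \<open>\<rho> d\<close> is met on travelling from
  \<open>e d\<close>.\<close>

lemma Or_\<rho>:
  assumes "d \<in> L"
  shows "\<rho> d \<in> Or \<longleftrightarrow> d \<notin> Or"
proof -
  have *: "\<rho> x \<in> Or" if x: "x \<in> L" "x \<notin> Or" for x
  proof -
    have "e x \<in> Or" using Or_e x by simp
    have "y \<in> Or" if "y \<in> orbit (travel D) (e x)" for y
      using that by induction (use \<open>e x \<in> Or\<close> Or_travel in auto)
    then show ?thesis using reverse[OF x(1)] by simp
  qed
  have "\<rho> d \<notin> Or" if "d \<in> Or"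
  proof
    assume "\<rho> d \<in> Or"
    have "e d \<notin> Or" using Or_e[OF assms] that by simp
    then have "\<rho> (e d) \<in> Or" using *[of "e d"] assms by simp
    then show False using \<open>\<rho> d \<in> Or\<close> Or_e[of "\<rho> d"] assms \<rho>_e L_darts by simp
  qed
  then show ?thesis using * assms by blast
qed

lemma Or_opp:
  assumes "d \<in> L"
  shows "opp D d \<in> Or \<longleftrightarrow> d \<notin> Or"
proof -
  have *: "opp D x \<in> Or" if x: "x \<in> L" "x \<notin> Or" for x
    using Or_travel[of "e x"] Or_e[OF x(1)] x e_e L_darts by (simp add: travel_def)
  have "opp D d \<notin> Or" if "d \<in> Or"
  proof
    assume o: "opp D d \<in> Or"
    have "opp D (\<rho> d) \<in> Or" using *[of "\<rho> d"] Or_\<rho>[OF assms] assms that by simp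
    then show False using o Or_\<rho>[OF opp_props(2)[OF assms]] opp_props(4)[OF assms] by simp
  qed
  then show ?thesis using * assms by blast
qed

definition positive where "positive v \<longleftrightarrow> (\<exists>d\<in>v \<inter> over D \<inter> Or. next_link D d \<in> Or)"

lemma crossing_sign_positive: "crossing_sign D Or v = (if positive v then 1 else - 1)"
  by (simp add: crossing_sign_def positive_def)

lemma positive_off:
  assumes v: "v \<in> off" and d: "d \<in> v \<inter> over D \<inter> Or"
  shows "positive v \<longleftrightarrow> r d \<in> Or"
proof -
  have vd: "vert d = v" using off_vert[OF v] d by simp
  note 4 = off4[of d, unfolded vd, OF v]
  have "r d \<notin> over D" using over_off[OF v, of d] d by simp
  moreover have "r (r (r d)) \<notin> over D"
    using over_off[OF v, of d] over_off[OF v, of "r d"] over_off[OF v, of "r (r d)"] 4(2) d by simp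
  moreover have "r (r d) \<notin> Or" using Or_opp[of d] 4(3) d Or_L by auto
  ultimately have "v \<inter> over D \<inter> Or = {d}" using 4(2) d by auto
  moreover have "next_link D d = r d"
    using off_link[OF v, of "r d"] 4(2) by (auto simp: next_link_def link_def)
  ultimately show ?thesis by (simp add: positive_def)
qed

text \<open>Reflection preserves over and under and reverses both strands, which leaves the sign
  alone; reversing the orientation of the plane changes it.\<close>

lemma positive_\<rho>:
  assumes v: "v \<in> off"
  shows "positive (\<rho> ` v) \<longleftrightarrow> \<not> positive v"
proof -
  obtain x where x: "x \<in> v" using off_nonempty[OF v] by auto
  have rx: "r x \<in> v" using off4(2)[of x] off_vert[OF v x] v by simp
  obtain y where y: "y \<in> v" "y \<in> over D" using x rx over_off[OF v x] by blast
  have yL: "y \<in> L" using off_link[OF v y(1)] .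
  have oy: "opp D y \<in> v" using off_closed[OF v y(1)] by simp
  have "v \<in> crossings D" using v by (simp add: crossings_def)
  then have "opp D y \<in> over D" using over_opp[of y] yL y by blast
  then obtain d where d: "d \<in> v \<inter> over D \<inter> Or" using Or_opp[OF yL] y oy by blast
  have dL: "d \<in> L" using d Or_L by auto
  have vd: "vert d = v" using off_vert[OF v] d by simp
  note 4 = off4[of d, unfolded vd, OF v]
  have od: "opp D d \<in> v" "opp D d \<in> L" using off_closed[OF v] opp_props(2)[OF dL] d by auto
  have "opp D d \<in> over D" using over_opp[of d] dL d \<open>v \<in> crossings D\<close> by blast
  then have "\<rho> (opp D d) \<in> \<rho> ` v \<inter> over D \<inter> Or"
    using od \<rho>_over[OF v od(1)] Or_\<rho>[OF od(2)] Or_opp[OF dL] d by auto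
  then have "positive (\<rho> ` v) \<longleftrightarrow> r (\<rho> (opp D d)) \<in> Or"
    by (rule positive_off[OF \<rho>_off(1)[OF v]])
  also have "r (\<rho> (opp D d)) = \<rho> (r d)" using 4(3) r_\<rho>_r[of "r d"] L_darts[OF dL] by simp
  also have "\<rho> (r d) \<in> Or \<longleftrightarrow> r d \<notin> Or"
    using Or_\<rho>[of "r d"] off_link[OF v, of "r d"] 4(2) by simp
  finally show ?thesis using positive_off[OF v d] by simp
qed

text \<open>The strands are mirror images with reversed orientation, so both cross the axis in the
  same direction and the two outgoing ends lie on one side. Which of them is over depends only on
  the type of the crossing.\<close>

lemma positive_axc:
  assumes v: "v \<in> axc"
  shows "positive v \<longleftrightarrow> X_o D v"
proof -
  obtain a where a: "a \<in> v" "a \<in> axis D" "v = vert a" using axis_in_vertex v by blast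
  note A = axc_axis[of a, folded a(3), OF v a(2)]
  let ?d1 = "r a" and ?d2 = "r (r a)" and ?d3 = "r' (r' a)" and ?d4 = "r' a" and ?a' = "r (r (r a))"
  have vc: "v \<in> crossings D" using v by (simp add: crossings_def)
  have o1: "?d3 \<in> Or \<longleftrightarrow> ?d1 \<notin> Or" "?d2 \<in> Or \<longleftrightarrow> ?d4 \<notin> Or"
    using Or_opp[OF A(1)] Or_opp[OF A(3)] A(7,8) by simp_all
  have o2: "?d4 \<in> Or \<longleftrightarrow> ?d1 \<notin> Or" using Or_\<rho>[OF A(1)] \<rho>_at_axis(1)[OF a(2)] by simp
  have in_v: "?d1 \<in> v" "?d2 \<in> v" "?d3 \<in> v" "?d4 \<in> v" "?a' \<in> v" using A(9) by auto
  have p1: "?d3 \<in> over D \<longleftrightarrow> ?d1 \<in> over D" "?d2 \<in> over D \<longleftrightarrow> ?d4 \<in> over D"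
    using over_opp[of ?d1] over_opp[of ?d4] A(1,3,7,8) in_v vc by auto
  have p2: "?d2 \<in> over D \<longleftrightarrow> ?d1 \<notin> over D" using over_axc[OF v, of a] a by simp
  have ra': "r ?a' = ?d3" using A(6) by (metis r_r')
  have nax: "d \<in> L \<Longrightarrow> d \<notin> axis D" for d by (simp add: link_def)
  have n: "next_link D ?d1 = ?d2" "next_link D ?d2 = ?d3" "next_link D ?d3 = ?d4" "next_link D ?d4 = ?d1"
    using nax[OF A(2)] nax[OF A(3)] A(5) a(2) ra' by (simp_all add: next_link_def)
  have notover: "a \<notin> over D" "?a' \<notin> over D" using over_link a(2) A(5) nax by blast+
  have set_v: "v \<inter> over D \<inter> Or = {?d1, ?d2, ?d3, ?d4} \<inter> over D \<inter> Or"
    using A(9) notover by blast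
  have "positive v \<longleftrightarrow> ?d1 \<in> over D"
    unfolding positive_def set_v using n o1 o2 p1 p2 by auto
  moreover have "X_o D v \<longleftrightarrow> ?d1 \<in> over D"
  proof -
    have "v \<inter> axis D = {a, ?a'}" using A(9) a(2) A(5) nax A(1-4) by blast
    then show ?thesis using ra' p1 by (simp add: X_o_def)
  qed
  ultimately show ?thesis by simp
qed

lemma sum_sign_off: "(\<Sum>v\<in>off. crossing_sign D Or v) = 0"
proof -
  have bij: "bij_betw (image \<rho>) off off"
    by (rule bij_betwI[where g = "image \<rho>"]) (use \<rho>_off in auto)
  have "(\<Sum>v\<in>off. crossing_sign D Or v) = (\<Sum>v\<in>off. crossing_sign D Or (\<rho> ` v))"
    using sum.reindex_bij_betw[OF bij, of "crossing_sign D Or"] by simp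
  also have "\<dots> = - (\<Sum>v\<in>off. crossing_sign D Or v)"
    unfolding sum_negf[symmetric]
    by (rule sum.cong[OF refl]) (simp add: crossing_sign_positive positive_\<rho>)
  finally show ?thesis by simp
qed

text \<open>Signs off the axis cancel in mirrored pairs and those on the axis are determined by the
  types; the right-hand side no longer depends on \<open>Or\<close>.\<close>

lemma W_bracket:
  assumes "B \<noteq> 0"
  shows "W D Or A B = bracket D A B * (\<Prod>v\<in>axc. - (inverse (win B v) ^ 3))"
proof -
  have "(- (B powi (- 3))) powi (\<Sum>v\<in>axc. crossing_sign D Or v) =
      (\<Prod>v\<in>axc. (- (B powi (- 3))) powi crossing_sign D Or v)"
    using assms by (intro power_int_sum) simp
  also have "\<dots> = (\<Prod>v\<in>axc. - (inverse (win B v) ^ 3))"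
    by (rule prod.cong[OF refl])
      (use assms in \<open>auto simp: crossing_sign_positive positive_axc win_def power_int_minus power_inverse\<close>)
  finally show ?thesis by (simp add: W_def sum_sign_off)
qed

lemma W_eval:
  fixes A B :: "'a::field_char_0"
  assumes "A \<noteq> 0" and B: "B \<noteq> 0" and "(- (A powi 2) - A powi (- 2)) ^ 2 \<in> {1, 2, 4}"
  shows "W D Or A B = (- (B powi 2) - B powi (- 2)) ^ (components D - 1)"
proof -
  have win0: "win B v \<noteq> 0" for v using B by (simp add: win_def)
  have "(\<Prod>v\<in>axc. - (win B v ^ 3)) * (\<Prod>v\<in>axc. - (inverse (win B v) ^ 3)) = 1"
    unfolding prod.distrib[symmetric]
    by (rule prod.neutral) (use win0 in \<open>simp add: power_inverse\<close>)
  then show ?thesis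
    unfolding W_bracket[OF B] bracket_eval[OF assms] by (simp add: mult.assoc)
qed

end

end

section \<open>Symmetry in \<open>A\<close>\<close>

context reflected_union
begin

lemma \<rho>_off_image:
  assumes "U \<subseteq> off"
  shows "image \<rho> ` image \<rho> ` U = U"
proof (intro set_eqI iffI)
  fix c assume "c \<in> image \<rho> ` image \<rho> ` U"
  then obtain c' where "c' \<in> U" "c = \<rho> ` \<rho> ` c'" by blast
  then show "c \<in> U" using \<rho>_off(2)[of c'] assms by (metis subsetD)
next
  fix c assume c: "c \<in> U"
  then have "c = \<rho> ` \<rho> ` c" using \<rho>_off(2)[of c] assms by (metis subsetD)
  then show "c \<in> image \<rho> ` image \<rho> ` U" using c by (metis imageI)
qed

text \<open>The matching of the mirrored state is the conjugate by \<open>\<rho>\<close>, because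
  \<open>\<rho>\<close> commutes with \<open>bs\<close>, \<open>ws\<close> and
  \<open>sv\<close>.\<close>

lemma card_flat_\<rho>: "card (flat T (image \<rho> ` U)) = card (flat T U)" if U: "U \<subseteq> off"
proof -
  let ?m = "\<lambda>f. {d \<in> L. \<rho> d \<in> f}"
  have jn: "jn T (image \<rho> ` V) (\<rho> d) = \<rho> (jn T V d)" if d: "d \<in> L" and V: "V \<subseteq> off" for V d
  proof (cases "vert d \<in> off")
    case True
    note s = off_smoothings[OF True]
    have "\<rho> ` vert d \<in> image \<rho> ` V \<longleftrightarrow> vert d \<in> V"
    proof
      assume "\<rho> ` vert d \<in> image \<rho> ` V"
      then obtain c where c: "c \<in> V" "\<rho> ` vert d = \<rho> ` c" by auto
      then have "vert d = c" using \<rho>_off(2)[OF True] \<rho>_off(2)[of c] V by (metis subsetD)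
      then show "vert d \<in> V" using c by simp
    qed auto
    then show ?thesis
      using True vert_\<rho>_cases(1)[OF L_darts[OF d]] vert_\<rho>[OF L_darts[OF d]] s(6,12) by (simp add: jn_def)
  next
    case False
    have "sv (\<rho> d) = \<rho> (sv d)" if "vert d \<notin> axp"
      using that False axc_smooth_v(6)[OF _ d] L_cases[OF d] by metis
    then show ?thesis using False \<rho>_vert_axis[OF d False] by (simp add: jn_def)
  qed
  have m: "?m f \<in> flat T V" if f: "f \<in> flat T (image \<rho> ` V)" and V: "V \<subseteq> off" for f V
  proof (rule flatI)
    fix d assume d: "d \<in> L"
    show "e d \<in> ?m f \<longleftrightarrow> d \<in> ?m f"
      using flatD(2)[OF f, of "\<rho> d"] d \<rho>_e[OF L_darts[OF d]] by simp
    show "jn T V d \<in> ?m f \<longleftrightarrow> d \<in> ?m f"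
      using flatD(3)[OF f, of "\<rho> d"] d jn[OF d V] jn_props(3)[OF d] by simp
  qed auto
  have U': "image \<rho> ` U \<subseteq> off" using U \<rho>_off(1) by blast
  have UU: "image \<rho> ` image \<rho> ` U = U"
    by (rule \<rho>_off_image[OF U])
  have mm: "?m (?m f) = f" if "f \<subseteq> L" for f
    using that \<rho>_\<rho> L_darts by auto
  have "bij_betw ?m (flat T (image \<rho> ` U)) (flat T U)"
  proof (rule bij_betwI[where g = ?m])
    show "?m \<in> flat T (image \<rho> ` U) \<rightarrow> flat T U" using m[OF _ U] by blast
    show "?m \<in> flat T U \<rightarrow> flat T (image \<rho> ` U)" 
      using m[OF _ U', unfolded UU] by blast
    show "?m (?m f) = f" if "f \<in> flat T (image \<rho> ` U)" for f by (rule mm[OF flatD(1)[OF that]])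
    show "?m (?m f) = f" if "f \<in> flat T U" for f by (rule mm[OF flatD(1)[OF that]])
  qed
  then show ?thesis by (rule bij_betw_same_card)
qed

lemma state_circles_\<rho>:
  assumes "T \<subseteq> axc" "U \<subseteq> off"
  shows "state_circles D (state T (image \<rho> ` U)) = state_circles D (state T U)"
  using card_flat_\<rho>[OF assms(2), of T] by (simp add: card_flat_state[OF assms(1)])

lemma bij_\<rho>_off: "bij_betw (image (image \<rho>)) (Pow off) (Pow off)"
proof (rule bij_betwI[where g = "image (image \<rho>)"])
  show "image (image \<rho>) \<in> Pow off \<rightarrow> Pow off" "image (image \<rho>) \<in> Pow off \<rightarrow> Pow off"
    using \<rho>_off(1) by auto
  show "image \<rho> ` image \<rho> ` U = U" "image \<rho> ` image \<rho> ` U = U" if "U \<in> Pow off" for U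
    by (rule \<rho>_off_image; use that in simp)+
qed

text \<open>Renaming the states by reflection inverts all weights off the axis, while circle numbers
  and the loop value stay the same.\<close>

lemma bracket_inverse:
  fixes A B :: "'a::field_char_0"
  shows "bracket D (inverse A) B = bracket D A B"
  unfolding bracket_states
proof (rule sum.cong[OF refl])
  fix T assume T: "T \<in> Pow axc"
  have eq: "state_term (inverse A) B T U = state_term A B T (image \<rho> ` U)" if U: "U \<in> Pow off" for U
  proof -
    have Uo: "U \<subseteq> off" using U by simp
    have inj: "inj_on (image \<rho>) V" if "V \<subseteq> off" for V
      by (rule inj_onI) (use \<rho>_off(2) that in \<open>metis subsetD\<close>)
    have surj: "image \<rho> ` off = off"
      using \<rho>_off_image[OF subset_refl] \<rho>_off(1) by (metis image_mono image_subset_iff subset_antisym)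
    have wt: "wt A (\<rho> ` v) = wt (inverse A) v" if "v \<in> off" for v
      using aligned_\<rho>[OF that] by (simp add: wt_def)
    have 1: "(\<Prod>v\<in>image \<rho> ` U. inverse (wt A v)) = (\<Prod>v\<in>U. inverse (wt (inverse A) v))"
      unfolding prod.reindex[OF inj[OF Uo]]
      by (rule prod.cong[OF refl]) (use wt Uo in auto)
    have "off - image \<rho> ` U = image \<rho> ` (off - U)"
      using inj_on_image_set_diff[OF inj[OF subset_refl], of off U] Uo surj by auto
    then have 2: "(\<Prod>v\<in>off - image \<rho> ` U. wt A v) = (\<Prod>v\<in>off - U. wt (inverse A) v)"
      using prod.reindex[OF inj[of "off - U"], of "wt A"] wt
      by (simp add: o_def)
    have p: "inverse A powi 2 = A powi (- 2)" "inverse A powi (- 2) = A powi 2"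
      by (simp_all add: power_int_minus power_inverse)
    have 3: "circles_value D (inverse A) B (state T U) = circles_value D A B (state T (image \<rho> ` U))"
    proof -
      have "- (A powi (- 2)) - A powi 2 = - (A powi 2) - A powi (- 2)" by simp
      moreover have "T \<subseteq> axc" using T by simp
      ultimately show ?thesis
        by (simp only: circles_value_def p state_circles_\<rho>[OF _ Uo] state_axis_pairs_state)
    qed
    show ?thesis unfolding state_term_def 1 2 3 by (rule refl)
  qed
  show "(\<Sum>U\<in>Pow off. state_term (inverse A) B T U) = (\<Sum>U\<in>Pow off. state_term A B T U)"
    using sum.reindex_bij_betw[OF bij_\<rho>_off, of "state_term A B T"] eq by simp
qed

text \<open>Every crossing off the axis contributes one sign, and there is an even number of them;
  the loop value sees only \<open>A^2\<close>.\<close>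

lemma bracket_uminus:
  fixes A B :: "'a::field_char_0"
  shows "bracket D (- A) B = bracket D A B"
  unfolding bracket_states
proof (intro sum.cong refl)
  fix T U assume U: "U \<in> Pow off"
  have wt: "wt (- A) v = - 1 * wt A v" for v by (simp add: wt_def)
  have "(\<Prod>v\<in>U. inverse (wt (- A) v)) * (\<Prod>v\<in>off - U. wt (- A) v) =
      ((- 1) ^ card U * (- 1) ^ card (off - U)) * ((\<Prod>v\<in>U. inverse (wt A v)) * (\<Prod>v\<in>off - U. wt A v))"
    unfolding wt inverse_mult_distrib prod.distrib by (simp add: mult_ac)
  also have "(- 1) ^ card U * (- 1) ^ card (off - U) = ((- 1) ^ card off :: 'a)"
    using U finite_off card_mono[OF finite_off, of U]
    by (simp add: card_Diff_subset finite_subset flip: power_add)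
  also have "\<dots> = 1" using prod_pairs[of off "\<lambda>c. - 1 :: 'a"] \<rho>_off(1) by simp
  finally have 1: "(\<Prod>v\<in>U. inverse (wt (- A) v)) * (\<Prod>v\<in>off - U. wt (- A) v) =
      (\<Prod>v\<in>U. inverse (wt A v)) * (\<Prod>v\<in>off - U. wt A v)" by simp
  have p: "(- A) powi 2 = A powi 2" "(- A) powi (- 2) = A powi (- 2)"
    by (simp_all add: power_int_minus)
  show "state_term (- A) B T U = state_term A B T U"
    unfolding state_term_def circles_value_def 1 p by (rule refl)
qed

section \<open>The derivative at \<open>t = 1\<close>\<close>

context
  fixes Or
  assumes Or: "orientation D Or"
begin

lemma W_inverse:
  fixes A B :: "'a::field_char_0"
  shows "B \<noteq> 0 \<Longrightarrow> W D Or (inverse A) B = W D Or A B"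
  and W_uminus: "B \<noteq> 0 \<Longrightarrow> W D Or (- A) B = W D Or A B"
  by (simp_all add: W_bracket[OF Or] bracket_inverse bracket_uminus)

text \<open>States with fewer circles than \<open>m\<close> produce negative powers of the loop
  value, so the domain must avoid its zeros as well as 0.\<close>

lemma W_differentiable:
  fixes A B :: complex
  assumes B: "B \<noteq> 0" and A: "A \<noteq> 0" "- (A powi 2) - A powi (- 2) \<noteq> 0"
  shows "(\<lambda>A. W D Or A B) field_differentiable (at A)"
proof -
  define S where "S = {A :: complex. A \<noteq> 0 \<and> - (A powi 2) - A powi (- 2) \<noteq> 0}"
  have S_eq: "S = {A. A \<noteq> 0 \<and> A ^ 4 + 1 \<noteq> 0}"
  proof -
    have *: "- (A powi 2) - A powi (- 2) = - (A ^ 4 + 1) / A ^ 2" if "A \<noteq> 0" for A :: complex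
      using that by (simp add: power_int_minus field_simps eval_nat_numeral)
    have "- (A powi 2) - A powi (- 2) \<noteq> 0 \<longleftrightarrow> A ^ 4 + 1 \<noteq> 0" if "A \<noteq> 0" for A :: complex
      unfolding *[OF that] divide_eq_0_iff neg_equal_0_iff_equal using that by simp
    then show ?thesis unfolding S_def by blast
  qed
  have "open S"
  proof -
    have "open {A :: complex. A \<noteq> 0}" "open {A :: complex. A ^ 4 + 1 \<noteq> 0}"
      by (intro open_Collect_neq continuous_intros)+
    then show ?thesis unfolding S_eq by (simp add: open_Collect_conj)
  qed
  have "(\<lambda>A. wt A v) holomorphic_on S" "(\<lambda>A. inverse (wt A v)) holomorphic_on S" for v
    by (cases "v \<in> aligned"; auto intro!: holomorphic_intros simp: wt_def S_def)+
  moreover have "wt x v = 0 \<longleftrightarrow> x = 0" for x :: complex and v by (simp add: wt_def)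
  ultimately have "(\<lambda>A. W D Or A B) holomorphic_on S"
    unfolding W_bracket[OF Or B] bracket_states state_term_def circles_value_def
    by (intro holomorphic_intros) (auto simp: S_def)
  then show ?thesis
    using \<open>open S\<close> A by (auto simp: S_def intro: holomorphic_on_imp_differentiable_at)
qed

text \<open>If \<open>A^2 = 1\<close>, then \<open>A\<close> is fixed by inversion, whose derivative
  there is \<open>- 1\<close>. If \<open>A^2 = - 1\<close>, inversion sends \<open>A\<close> to
  \<open>- A\<close> with derivative 1, while evenness makes the derivatives at \<open>A\<close> and
  \<open>- A\<close> opposite.\<close>

lemma W_deriv_zero:
  fixes A B :: complex
  assumes B: "B \<noteq> 0" and A4: "A ^ 4 = 1"
  shows "((\<lambda>A. W D Or A B) has_field_derivative 0) (at A)"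
proof -
  let ?w = "\<lambda>A. W D Or A B"
  have A0: "A \<noteq> 0" using A4 by auto
  have sq: "A ^ 2 = 1 \<or> A ^ 2 = - 1"
    using A4 power2_eq_1_iff[of "A ^ 2"] by (simp flip: power_mult)
  have nz: "- (A powi 2) - A powi (- 2) \<noteq> 0" "- ((- A) powi 2) - (- A) powi (- 2) \<noteq> 0"
    using sq by (auto simp: power_int_minus)
  obtain l where l: "(?w has_field_derivative l) (at A)"
    using W_differentiable[OF B A0 nz(1)] by (auto simp: field_differentiable_def)
  obtain l' where l': "(?w has_field_derivative l') (at (- A))"
    using W_differentiable[OF B _ nz(2)] A0 by (auto simp: field_differentiable_def)
  have "((\<lambda>A. ?w (- A)) has_field_derivative l' * (- 1)) (at A)"
    by (rule DERIV_chain2[where f = ?w]) (use l' in \<open>auto intro!: derivative_eq_intros\<close>)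
  then have "l = - l'" using DERIV_unique[OF l] by (simp add: W_uminus[OF B])
  moreover have "l = 0 \<or> l = l'"
    using sq
  proof
    assume a: "A ^ 2 = 1"
    then have inv: "inverse A = A" by (metis A0 inverse_unique power2_eq_square)
    have "((\<lambda>A. ?w (inverse A)) has_field_derivative l * (- (inverse A ^ Suc (Suc 0)))) (at A)"
      by (rule DERIV_chain2[where f = ?w]) (use l inv DERIV_inverse[OF A0] in simp_all)
    then have "((\<lambda>A. ?w A) has_field_derivative l * (- (inverse A ^ Suc (Suc 0)))) (at A)"
      by (simp only: W_inverse[OF B])
    then have "l = l * (- (inverse A ^ Suc (Suc 0)))" by (rule DERIV_unique[OF l])
    also have "inverse A ^ Suc (Suc 0) = 1" using a unfolding inv by (simp add: power2_eq_square)
    finally show ?thesis by simp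
  next
    assume a: "A ^ 2 = - 1"
    then have inv: "inverse A = - A"
      by (metis inverse_unique mult_minus_right minus_minus power2_eq_square)
    have "((\<lambda>A. ?w (inverse A)) has_field_derivative l' * (- (inverse A ^ Suc (Suc 0)))) (at A)"
      by (rule DERIV_chain2[where f = ?w]) (use l' inv DERIV_inverse[OF A0] in simp_all)
    then have "((\<lambda>A. ?w A) has_field_derivative l' * (- (inverse A ^ Suc (Suc 0)))) (at A)"
      by (simp only: W_inverse[OF B])
    then have "l = l' * (- (inverse A ^ Suc (Suc 0)))" by (rule DERIV_unique[OF l])
    also have "inverse A ^ Suc (Suc 0) = - 1" using a unfolding inv by (simp add: power2_eq_square)
    finally show ?thesis by simp
  qed
  ultimately have "l = 0" by auto
  then show ?thesis using l by simp
qed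

end

end

text \<open>Continuity at 1 is enough: \<open>A(t)^4 - a^4 = (A(t) - a) G(t)\<close>, where
  \<open>G\<close> tends to \<open>4 a^3\<close>, which is nonzero, so the difference quotient
  converges.\<close>

lemma fourth_root_differentiable:
  fixes A :: "complex \<Rightarrow> complex"
  assumes cont: "A \<midarrow>1\<rightarrow> A 1" and ev: "\<forall>\<^sub>F t in nhds 1. A t ^ 4 * t = 1"
  shows "(A has_field_derivative - (A 1) / 4) (at 1)"
proof -
  define a where "a = A 1"
  have a4: "a ^ 4 = 1" using eventually_nhds_x_imp_x[OF ev] by (simp add: a_def)
  then have a0: "a \<noteq> 0" by auto
  define G where "G t = A t ^ 3 + A t ^ 2 * a + A t * a ^ 2 + a ^ 3" for t
  have lim: "((\<lambda>t. - 1 / (t * G t)) \<longlongrightarrow> - 1 / (1 * (a ^ 3 + a ^ 2 * a + a * a ^ 2 + a ^ 3))) (at 1)"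
    unfolding G_def using cont a0
    by (intro tendsto_intros) (auto simp: a_def eval_nat_numeral)
  have "(\<forall>\<^sub>F t in at 1. (A t - a) / (t - 1) = - 1 / (t * G t))"
  proof -
    have "\<forall>\<^sub>F t in at 1. A t ^ 4 * t = 1" using ev by (simp add: eventually_nhds_conv_at)
    moreover have "\<forall>\<^sub>F t :: complex in at 1. t \<noteq> 1" by (simp add: eventually_at_filter)
    ultimately show ?thesis
    proof eventually_elim
      fix t assume t: "A t ^ 4 * t = 1" "t \<noteq> 1"
      then have t0: "t \<noteq> 0" by auto
      have "(A t - a) * G t = A t ^ 4 - a ^ 4" by (simp add: G_def algebra_simps eval_nat_numeral)
      then have "t * ((A t - a) * G t) = t * (A t ^ 4 - 1)" using a4 by simp
      then have *: "(A t - a) * (t * G t) = 1 - t" using t by (simp add: algebra_simps)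
      then have "t * G t \<noteq> 0" using t by auto
      then show "(A t - a) / (t - 1) = - 1 / (t * G t)"
        using * t by (simp add: divide_simps)
    qed
  qed
  then have "((\<lambda>t. (A t - a) / (t - 1)) \<longlongrightarrow> - 1 / (1 * (a ^ 3 + a ^ 2 * a + a * a ^ 2 + a ^ 3))) (at 1)"
    using lim by (simp add: tendsto_cong)
  moreover have "- 1 / (1 * (a ^ 3 + a ^ 2 * a + a * a ^ 2 + a ^ 3)) = - a / 4"
    using a0 a4 by (simp add: divide_simps) (simp add: algebra_simps eval_nat_numeral)
  ultimately show ?thesis unfolding has_field_derivative_iff a_def[symmetric] by (simp only:)
qed

section \<open>Specialization of the formal invariant\<close>

lemma poly_map_poly_hom:
  fixes h :: "'a::comm_ring_1 \<Rightarrow> 'b::comm_ring_1"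
  assumes h: "h 0 = 0" "\<And>x y. h (x + y) = h x + h y" "\<And>x y. h (x * y) = h x * h y"
  shows "poly (map_poly h (p + q)) x = poly (map_poly h p) x + poly (map_poly h q) x"
    "poly (map_poly h (p * q)) x = poly (map_poly h p) x * poly (map_poly h q) x"
proof -
  have add: "map_poly h (p + q) = map_poly h p + map_poly h q" for p q
    by (rule poly_eqI) (simp add: coeff_map_poly h)
  show "poly (map_poly h (p + q)) x = poly (map_poly h p) x + poly (map_poly h q) x"
    by (simp add: add)
  show "poly (map_poly h (p * q)) x = poly (map_poly h p) x * poly (map_poly h q) x"
    by (induction p) (simp_all add: h add map_poly_pCons map_poly_smult algebra_simps)
qed

definition eval_int :: "complex \<Rightarrow> int poly \<Rightarrow> complex" where
  "eval_int a c = poly (map_poly of_int c) a"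

definition eval2 :: "complex \<Rightarrow> complex \<Rightarrow> int poly poly \<Rightarrow> complex" where
  "eval2 a b p = poly (map_poly (eval_int a) p) b"

lemma eval_int_simps [simp]:
  "eval_int a 0 = 0" "eval_int a 1 = 1" "eval_int a (c + d) = eval_int a c + eval_int a d"
  "eval_int a (c * d) = eval_int a c * eval_int a d" "eval_int a (of_int k) = of_int k"
  by (simp_all add: eval_int_def poly_map_poly_hom of_int_poly map_poly_pCons)

lemma eval2_simps [simp]:
  "eval2 a b 0 = 0" "eval2 a b 1 = 1" "eval2 a b (p + q) = eval2 a b p + eval2 a b q"
  "eval2 a b (p * q) = eval2 a b p * eval2 a b q" "eval2 a b (of_int k) = of_int k"
  by (simp_all add: eval2_def poly_map_poly_hom) (simp add: eval_int_def of_int_poly map_poly_pCons)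

text \<open>Evaluation is only partially defined on rational functions and refers to a fraction with
  nonvanishing denominator; a relation keeps track of this without choosing representatives.\<close>

definition specializes :: "complex \<Rightarrow> complex \<Rightarrow> ratfun \<Rightarrow> complex \<Rightarrow> bool" where
  "specializes a b x z \<longleftrightarrow>
    (\<exists>p q. x = Fraction_Field.Fract p q \<and> eval2 a b q \<noteq> 0 \<and> z = eval2 a b p / eval2 a b q)"

lemma specializesI:
  "eval2 a b q \<noteq> 0 \<Longrightarrow> specializes a b (Fraction_Field.Fract p q) (eval2 a b p / eval2 a b q)"
  by (auto simp: specializes_def)

lemma specializesE:
  assumes "specializes a b x z"
  obtains p q where "x = Fraction_Field.Fract p q" "eval2 a b q \<noteq> 0" "q \<noteq> 0"
    "z = eval2 a b p / eval2 a b q"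
proof -
  obtain p q where "x = Fraction_Field.Fract p q" "eval2 a b q \<noteq> 0" "z = eval2 a b p / eval2 a b q"
    using assms by (auto simp: specializes_def)
  moreover from this have "q \<noteq> 0" by auto
  ultimately show ?thesis by (rule_tac that)
qed

lemma specializes_unique:
  assumes "specializes a b x z" "specializes a b x z'"
  shows "z = z'"
proof -
  obtain p q where 1: "x = Fraction_Field.Fract p q" "eval2 a b q \<noteq> 0" "q \<noteq> 0"
    "z = eval2 a b p / eval2 a b q" using assms(1) by (rule specializesE)
  obtain p' q' where 2: "x = Fraction_Field.Fract p' q'" "eval2 a b q' \<noteq> 0" "q' \<noteq> 0"
    "z' = eval2 a b p' / eval2 a b q'" using assms(2) by (rule specializesE)
  have "p * q' = p' * q" using 1 2 by (simp add: eq_fract)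
  then have "eval2 a b (p * q') = eval2 a b (p' * q)" by simp
  then show ?thesis using 1 2 by (simp add: frac_eq_eq)
qed

lemma specializes_of_int: "specializes a b (of_int k) (of_int k)"
proof -
  have "of_int k = Fraction_Field.Fract (of_int k) (1 :: int poly poly)"
    by (cases k) (simp_all add: of_nat_fract One_fract_def Fraction_Field.minus_fract)
  then show ?thesis using specializesI[of a b 1 "of_int k"] by simp
qed

lemma specializes_0 [simp]: "specializes a b 0 0" and specializes_1 [simp]: "specializes a b 1 1"
  using specializes_of_int[of a b 0] specializes_of_int[of a b 1] by simp_all

lemma specializes_add:
  assumes "specializes a b x z" "specializes a b y w"
  shows "specializes a b (x + y) (z + w)"
proof -
  obtain p q where 1: "x = Fraction_Field.Fract p q" "eval2 a b q \<noteq> 0" "q \<noteq> 0"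
    "z = eval2 a b p / eval2 a b q" using assms(1) by (rule specializesE)
  obtain p' q' where 2: "y = Fraction_Field.Fract p' q'" "eval2 a b q' \<noteq> 0" "q' \<noteq> 0"
    "w = eval2 a b p' / eval2 a b q'" using assms(2) by (rule specializesE)
  show ?thesis
    using specializesI[of a b "q * q'" "p * q' + p' * q"] 1 2 by (simp add: add_frac_eq)
qed

lemma specializes_mult:
  assumes "specializes a b x z" "specializes a b y w"
  shows "specializes a b (x * y) (z * w)"
proof -
  obtain p q where 1: "x = Fraction_Field.Fract p q" "eval2 a b q \<noteq> 0" "q \<noteq> 0"
    "z = eval2 a b p / eval2 a b q" using assms(1) by (rule specializesE)
  obtain p' q' where 2: "y = Fraction_Field.Fract p' q'" "eval2 a b q' \<noteq> 0" "q' \<noteq> 0"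
    "w = eval2 a b p' / eval2 a b q'" using assms(2) by (rule specializesE)
  show ?thesis using specializesI[of a b "q * q'" "p * p'"] 1 2 by simp
qed

lemma specializes_inverse:
  assumes "specializes a b x z" "z \<noteq> 0"
  shows "specializes a b (inverse x) (inverse z)"
proof -
  obtain p q where 1: "x = Fraction_Field.Fract p q" "eval2 a b q \<noteq> 0" "q \<noteq> 0"
    "z = eval2 a b p / eval2 a b q" using assms(1) by (rule specializesE)
  show ?thesis using specializesI[of a b p q] 1 assms(2) by simp
qed

lemma specializes_uminus: "specializes a b x z \<Longrightarrow> specializes a b (- x) (- z)"
  using specializes_mult[OF specializes_of_int[of a b "- 1"], of x z] by simp

lemma specializes_diff:
  "specializes a b x z \<Longrightarrow> specializes a b y w \<Longrightarrow> specializes a b (x - y) (z - w)"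
  using specializes_add[OF _ specializes_uminus, of a b x z y w] by simp

lemma specializes_sum:
  "(\<And>i. i \<in> I \<Longrightarrow> specializes a b (f i) (g i)) \<Longrightarrow> specializes a b (sum f I) (sum g I)"
  by (induction I rule: infinite_finite_induct) (auto intro!: specializes_add)

lemma specializes_prod:
  "(\<And>i. i \<in> I \<Longrightarrow> specializes a b (f i) (g i)) \<Longrightarrow> specializes a b (prod f I) (prod g I)"
  by (induction I rule: infinite_finite_induct) (auto intro!: specializes_mult)

lemma specializes_power: "specializes a b x z \<Longrightarrow> specializes a b (x ^ n) (z ^ n)"
  by (induction n) (auto intro!: specializes_mult)

lemma specializes_power_int:
  assumes "specializes a b x z" "z \<noteq> 0 \<or> k \<ge> 0"
  shows "specializes a b (x powi k) (z powi k)"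
proof (cases "k \<ge> 0")
  case True
  then show ?thesis using specializes_power[OF assms(1)] by (simp add: power_int_def)
next
  case False
  then show ?thesis using specializes_power[OF specializes_inverse[OF assms(1)]] assms(2)
    by (simp add: power_int_def)
qed

lemma specializes_var_A: "specializes a b var_A a" and specializes_var_B: "specializes a b var_B b"
proof -
  have "eval2 a b [:[:0, 1:]:] = a" "eval2 a b [:0, 1:] = b"
    by (simp_all add: eval2_def eval_int_def map_poly_pCons)
  then show "specializes a b var_A a" "specializes a b var_B b"
    using specializesI[of a b 1 "[:[:0, 1:]:]"] specializesI[of a b 1 "[:0, 1:]"]
    by (simp_all add: var_A_def var_B_def to_fract_def)
qed

lemma specializes_laurent_eval:
  assumes "specializes a b x z" "specializes a b y w" "z \<noteq> 0" "w \<noteq> 0"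
  shows "specializes a b (laurent_eval P x y) (laurent_eval P z w)"
  unfolding laurent_eval_def case_prod_unfold
  using assms by (intro specializes_sum specializes_mult specializes_power_int specializes_of_int) auto

context reflected_union
begin

lemma specializes_W:
  fixes a b :: complex
  assumes ab: "a \<noteq> 0" "b \<noteq> 0" and nz: "- (a powi 2) - a powi (- 2) \<noteq> 0"
  shows "specializes a b (W D Or var_A var_B) (W D Or a b)"
proof -
  note A = specializes_var_A[of a b] and B = specializes_var_B[of a b]
  note pow = specializes_power_int[OF A] specializes_power_int[OF B]
  have inv: "specializes a b (inverse var_A) (inverse a)" "specializes a b (inverse var_B) (inverse b)"
    using specializes_inverse[OF A] specializes_inverse[OF B] ab by auto
  have weight: "specializes a b (weight_in D var_A var_B v) (weight_in D a b v)"
    "specializes a b (weight_out D var_A var_B v) (weight_out D a b v)" for v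
    using A B inv by (simp_all add: weight_in_def weight_out_def)
  have circles: "specializes a b (circles_value D var_A var_B S) (circles_value D a b S)" for S
  proof -
    \<comment> \<open>The loop value in \<open>B\<close> has a nonnegative exponent, so it may
      vanish at \<open>b\<close>; only that in \<open>A\<close> must not.\<close>
    have "state_axis_pairs D S \<ge> 1"
      using components_pos components_axis_points by (simp add: state_axis_pairs_def)
    then show ?thesis
      unfolding circles_value_def
      using ab nz by (intro specializes_mult specializes_power_int specializes_diff specializes_uminus A B) auto
  qed
  have "specializes a b (bracket D var_A var_B) (bracket D a b)"
    unfolding bracket_def partial_bracket_def
    by (intro specializes_sum specializes_mult specializes_prod weight circles)
  then show ?thesis
    unfolding W_def
    using ab by (intro specializes_mult specializes_power_int specializes_uminus A B) auto
qed

lemma W_laurent_specialize: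
  fixes a b :: complex
  assumes P: "W_laurent D Or P" and ab: "a \<noteq> 0" "b \<noteq> 0" and nz: "- (a powi 2) - a powi (- 2) \<noteq> 0"
  shows "W D Or a b = laurent_eval P (b powi (- 2)) (a powi (- 4))"
proof (rule specializes_unique[of a b])
  show "specializes a b (W D Or var_A var_B) (W D Or a b)"
    using ab nz by (rule specializes_W)
  show "specializes a b (W D Or var_A var_B) (laurent_eval P (b powi (- 2)) (a powi (- 4)))"
    using P ab unfolding W_laurent_def
    by (auto intro!: specializes_laurent_eval specializes_power_int specializes_var_A specializes_var_B)
qed

end

section \<open>Laurent polynomials\<close>

lemma laurent_eval_superset:
  assumes "finite K" "Poly_Mapping.keys P \<subseteq> K"
  shows "laurent_eval P x y =
    (\<Sum>(i, j)\<in>K. of_int (Poly_Mapping.lookup P (i, j)) * x powi i * y powi j)"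
  unfolding laurent_eval_def
  by (rule sum.mono_neutral_left[OF assms]) (auto simp: in_keys_iff)

lemma laurent_eval_diff: "laurent_eval (P - Q) x y = laurent_eval P x y - laurent_eval Q x y"
proof -
  let ?K = "Poly_Mapping.keys P \<union> Poly_Mapping.keys Q"
  have "laurent_eval R x y = (\<Sum>(i, j)\<in>?K. of_int (Poly_Mapping.lookup R (i, j)) * x powi i * y powi j)"
    if "R \<in> {P, Q, P - Q}" for R
    by (rule laurent_eval_superset) (use that keys_diff[of P Q] in auto)
  then show ?thesis
    by (simp add: lookup_minus case_prod_unfold left_diff_distrib sum_subtractf)
qed

lemma laurent_eval_0 [simp]: "laurent_eval 0 x y = 0"
  by (simp add: laurent_eval_def)

lemma laurent_eval_uminus: "laurent_eval (- P) x y = - laurent_eval P x y"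
  using laurent_eval_diff[of 0 P] by simp

lemma laurent_eval_add: "laurent_eval (P + Q) x y = laurent_eval P x y + laurent_eval Q x y"
  using laurent_eval_diff[of P "- Q"] by (simp add: laurent_eval_uminus)

lemma laurent_eval_single [simp]:
  "laurent_eval (Poly_Mapping.single (i, j) c) x y = of_int c * x powi i * y powi j"
  by (simp add: laurent_eval_def)

lemma laurent_eval_mult:
  assumes "x \<noteq> 0" "y \<noteq> 0"
  shows "laurent_eval (P * Q) x y = laurent_eval P x y * laurent_eval Q x y"
  using subset_UNIV
proof (induction P rule: frag_induction)
  case (one k)
  obtain i j where k: "k = (i, j)" by force
  show ?case
    using subset_UNIV
  proof (induction Q rule: frag_induction)
    case (one l)
    obtain i' j' where "l = (i', j')" by force
    then show ?case using assms k by (simp add: mult_single power_int_add)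
  qed (simp_all add: laurent_eval_diff right_diff_distrib)
qed (simp_all add: laurent_eval_diff left_diff_distrib)

lemma laurent_eval_1 [simp]: "laurent_eval 1 x y = 1"
  using laurent_eval_single[of 0 0 1 x y] by (simp add: zero_prod_def[symmetric] del: laurent_eval_single)

lemma laurent_eval_power:
  assumes "x \<noteq> 0" "y \<noteq> 0"
  shows "laurent_eval (P ^ n) x y = laurent_eval P x y ^ n"
  by (induction n) (simp_all add: laurent_eval_mult[OF assms])

lemma laurent_eval_vars [simp]:
  "laurent_eval sqrt_s x y = x" "laurent_eval inv_sqrt_s x y = inverse x" "laurent_eval var_t x y = y"
  by (simp_all add: sqrt_s_def inv_sqrt_s_def var_t_def power_int_minus)

section \<open>Division with remainder in \<open>t\<close> over the Laurent polynomials in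
  \<open>s^(1/2)\<close>\<close>

definition t_free :: "laurent set" where
  "t_free = {C. Poly_Mapping.keys C \<subseteq> UNIV \<times> {0}}"

lemma t_free_closed:
  "0 \<in> t_free" "C \<in> t_free \<Longrightarrow> C' \<in> t_free \<Longrightarrow> C + C' \<in> t_free"
  "C \<in> t_free \<Longrightarrow> C' \<in> t_free \<Longrightarrow> C - C' \<in> t_free" "Poly_Mapping.single (i, 0) c \<in> t_free"
  using keys_add[of C C'] keys_diff[of C C'] by (auto simp: t_free_def)

lemma laurent_eval_t_free: "C \<in> t_free \<Longrightarrow> laurent_eval C x y = laurent_eval C x 1"
  unfolding laurent_eval_def by (rule sum.cong[OF refl]) (auto simp: t_free_def)

definition modulus :: laurent where
  "modulus = (var_t - 1) ^ 2 * (var_t ^ 2 + 1) * (var_t ^ 2 + var_t + 1)"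

lemma modulus_expand:
  "modulus = var_t ^ 6 - var_t ^ 5 + var_t ^ 4 - 2 * var_t ^ 3 + var_t ^ 2 - var_t + 1"
  unfolding modulus_def by (simp add: algebra_simps eval_nat_numeral)

text \<open>
  The modulus is monic with constant term 1, so that dividing by it works in both directions and
  leaves a remainder of degree less than 6 in \<open>t\<close>.
\<close>

definition divisible_with_remainder :: "laurent \<Rightarrow> bool" where
  "divisible_with_remainder P \<longleftrightarrow> (\<exists>Q. \<exists>C0\<in>t_free. \<exists>C1\<in>t_free. \<exists>C2\<in>t_free. \<exists>C3\<in>t_free. \<exists>C4\<in>t_free. \<exists>C5\<in>t_free.
    P = modulus * Q + (C0 + C1 * var_t + C2 * var_t ^ 2 + C3 * var_t ^ 3 + C4 * var_t ^ 4 + C5 * var_t ^ 5))"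

lemma divisible_with_remainderI:
  assumes "C0 \<in> t_free" "C1 \<in> t_free" "C2 \<in> t_free" "C3 \<in> t_free" "C4 \<in> t_free" "C5 \<in> t_free"
    "P = modulus * Q + (C0 + C1 * var_t + C2 * var_t ^ 2 + C3 * var_t ^ 3 + C4 * var_t ^ 4 + C5 * var_t ^ 5)"
  shows "divisible_with_remainder P"
  using assms unfolding divisible_with_remainder_def by blast

lemma divisible_with_remainderE:
  assumes "divisible_with_remainder P"
  obtains Q C0 C1 C2 C3 C4 C5 where
    "C0 \<in> t_free" "C1 \<in> t_free" "C2 \<in> t_free" "C3 \<in> t_free" "C4 \<in> t_free" "C5 \<in> t_free"
    "P = modulus * Q + (C0 + C1 * var_t + C2 * var_t ^ 2 + C3 * var_t ^ 3 + C4 * var_t ^ 4 + C5 * var_t ^ 5)"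
  using assms unfolding divisible_with_remainder_def by blast

lemma divisible_with_remainder_diff:
  assumes "divisible_with_remainder P" "divisible_with_remainder P'"
  shows "divisible_with_remainder (P - P')"
proof -
  obtain Q C0 C1 C2 C3 C4 C5 where
    C: "C0 \<in> t_free" "C1 \<in> t_free" "C2 \<in> t_free" "C3 \<in> t_free" "C4 \<in> t_free" "C5 \<in> t_free"
    "P = modulus * Q + (C0 + C1 * var_t + C2 * var_t ^ 2 + C3 * var_t ^ 3 + C4 * var_t ^ 4 + C5 * var_t ^ 5)"
    using assms(1) by (rule divisible_with_remainderE)
  obtain Q' C0' C1' C2' C3' C4' C5' where
    C': "C0' \<in> t_free" "C1' \<in> t_free" "C2' \<in> t_free" "C3' \<in> t_free" "C4' \<in> t_free" "C5' \<in> t_free"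
    "P' = modulus * Q' + (C0' + C1' * var_t + C2' * var_t ^ 2 + C3' * var_t ^ 3 + C4' * var_t ^ 4 + C5' * var_t ^ 5)"
    using assms(2) by (rule divisible_with_remainderE)
  show ?thesis
    by (rule divisible_with_remainderI[of "C0 - C0'" "C1 - C1'" "C2 - C2'" "C3 - C3'" "C4 - C4'" "C5 - C5'" _ "Q - Q'"])
      (simp_all add: C C' t_free_closed(3), simp add: algebra_simps)
qed

lemma divisible_with_remainder_times_t:
  assumes "divisible_with_remainder P"
  shows "divisible_with_remainder (var_t * P)"
proof -
  obtain Q C0 C1 C2 C3 C4 C5 where
    C: "C0 \<in> t_free" "C1 \<in> t_free" "C2 \<in> t_free" "C3 \<in> t_free" "C4 \<in> t_free" "C5 \<in> t_free"
    "P = modulus * Q + (C0 + C1 * var_t + C2 * var_t ^ 2 + C3 * var_t ^ 3 + C4 * var_t ^ 4 + C5 * var_t ^ 5)"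
    using assms by (rule divisible_with_remainderE)
  show ?thesis
    \<comment> \<open>The term \<open>C5 * var_t ^ 6\<close> is reduced by the monic modulus; the
      corrections are \<open>C5\<close> times the negatives of the lower coefficients in
      \<open>modulus_expand\<close>.\<close>
    by (rule divisible_with_remainderI[of "0 - C5" "C0 + C5" "C1 - C5" "C2 + (C5 + C5)" "C3 - C5" "C4 + C5" _
          "var_t * Q + C5"])
      (simp_all only: C t_free_closed(1-3), simp add: modulus_expand algebra_simps eval_nat_numeral)
qed

definition inv_t :: laurent where "inv_t = Poly_Mapping.single (0, -1) 1"

lemma inv_t_t: "inv_t * var_t = 1"
  by (simp add: inv_t_def var_t_def mult_single zero_prod_def[symmetric])

lemma divisible_with_remainder_times_inv_t:
  assumes "divisible_with_remainder P"
  shows "divisible_with_remainder (inv_t * P)"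
proof -
  obtain Q C0 C1 C2 C3 C4 C5 where
    C: "C0 \<in> t_free" "C1 \<in> t_free" "C2 \<in> t_free" "C3 \<in> t_free" "C4 \<in> t_free" "C5 \<in> t_free"
    "P = modulus * Q + (C0 + C1 * var_t + C2 * var_t ^ 2 + C3 * var_t ^ 3 + C4 * var_t ^ 4 + C5 * var_t ^ 5)"
    using assms by (rule divisible_with_remainderE)
  define u where "u = inv_t"
  define t where "t = var_t"
  have ut: "u * t = 1" by (simp add: u_def t_def inv_t_t)
  have ut': "u * (t * X) = X" for X using ut by (simp flip: mult.assoc)
  have "u * P = modulus * (u * Q + u * C0) + ((C1 + C0) + (C2 - C0) * t + (C3 + (C0 + C0)) * t ^ 2 +
      (C4 - C0) * t ^ 3 + (C5 + C0) * t ^ 4 + (0 - C0) * t ^ 5)"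
  proof -
    have "u * modulus = u + (t ^ 5 - t ^ 4 + t ^ 3 - 2 * t ^ 2 + t - 1)"
      unfolding modulus_expand t_def[symmetric]
      by (simp add: right_diff_distrib distrib_left eval_nat_numeral ut ut' mult.left_commute[of u 2])
    \<comment> \<open>The constant term 1 expresses the inverse of \<open>t\<close> by a multiple of
      the modulus and nonnegative powers up to \<open>t^5\<close>.\<close>
    then have um: "u = u * modulus - (t ^ 5 - t ^ 4 + t ^ 3 - 2 * t ^ 2 + t - 1)" by simp
    have "u * P = modulus * (u * Q) + u * C0 + (u * t) * (C1 + C2 * t + C3 * t ^ 2 + C4 * t ^ 3 + C5 * t ^ 4)"
      unfolding C(7) t_def[symmetric] by (simp add: algebra_simps eval_nat_numeral)
    also have "u * C0 = (u * modulus - (t ^ 5 - t ^ 4 + t ^ 3 - 2 * t ^ 2 + t - 1)) * C0"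
      by (subst um) (rule refl)
    finally show ?thesis unfolding ut by (simp add: algebra_simps)
  qed
  then show ?thesis
    unfolding u_def t_def
    by (rule divisible_with_remainderI[rotated 6]) (simp_all only: C t_free_closed(1-3))
qed

lemma divisible_with_remainder: "divisible_with_remainder P"
  using subset_UNIV
proof (induction P rule: frag_induction)
  case zero
  show ?case
    by (rule divisible_with_remainderI[of 0 0 0 0 0 0 _ 0]) (simp_all add: t_free_closed)
next
  case (one k)
  obtain i j where k: "k = (i, j)" by force
  have "divisible_with_remainder (Poly_Mapping.single (i, j) 1)"
  proof (induction j rule: int_induct[of _ 0])
    case base
    show ?case
      by (rule divisible_with_remainderI[of "Poly_Mapping.single (i, 0) 1" 0 0 0 0 0 _ 0])
        (simp_all add: t_free_closed)
  next
    case (step1 j)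
    have "Poly_Mapping.single (i, j + 1) 1 = var_t * Poly_Mapping.single (i, j) 1"
      by (simp add: var_t_def mult_single add.commute)
    then show ?case using divisible_with_remainder_times_t[OF step1(2)] by simp
  next
    case (step2 j)
    have "Poly_Mapping.single (i, j - 1) 1 = inv_t * Poly_Mapping.single (i, j) 1"
      by (simp add: inv_t_def mult_single)
    then show ?case using divisible_with_remainder_times_inv_t[OF step2(2)] by simp
  qed
  then show ?case by (simp add: k)
next
  case (diff P Q)
  then show ?case by (rule divisible_with_remainder_diff)
qed

text \<open>After multiplication by a power of \<open>x\<close> this is a complex polynomial with
  infinitely many roots; the shift keeps distinct exponents distinct.\<close>

lemma t_free_eq_0:
  assumes C: "C \<in> t_free" and zero: "\<And>x :: complex. x \<noteq> 0 \<Longrightarrow> laurent_eval C x 1 = 0"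
  shows "C = 0"
proof (rule ccontr)
  assume "C \<noteq> 0"
  then obtain k0 where "k0 \<in> Poly_Mapping.keys C" by (metis all_not_in_conv keys_eq_empty)
  then obtain i0 j0 where k0: "(i0, j0) \<in> Poly_Mapping.keys C" by (cases k0) auto
  define K where "K = Poly_Mapping.keys C"
  have finK: "finite K" by (simp add: K_def)
  define N where "N = Max ((\<lambda>k. \<bar>fst k\<bar>) ` K)"
  have N: "0 \<le> i + N" if "(i, j) \<in> K" for i j
  proof -
    have "\<bar>i\<bar> \<le> N" unfolding N_def using finK that by (intro Max_ge) force+
    then show ?thesis by simp
  qed
  define p :: "complex poly" where
    "p = (\<Sum>k\<in>K. monom (of_int (Poly_Mapping.lookup C k)) (nat (fst k + N)))"
  have "poly p x = 0" if x: "x \<noteq> 0" for x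
  proof -
    have "poly p x = (\<Sum>k\<in>K. of_int (Poly_Mapping.lookup C k) * x ^ nat (fst k + N))"
      by (simp add: p_def poly_sum poly_monom)
    also have "\<dots> = (\<Sum>(i, j)\<in>K. (of_int (Poly_Mapping.lookup C (i, j)) * x powi i * 1 powi j) * x powi N)"
    proof (rule sum.cong[OF refl])
      fix k assume k: "k \<in> K"
      have "x ^ nat (fst k + N) = x powi (fst k + N)" using N[of "fst k" "snd k"] k by (simp add: power_int_def)
      then show "of_int (Poly_Mapping.lookup C k) * x ^ nat (fst k + N) =
          (case k of (i, j) \<Rightarrow> (of_int (Poly_Mapping.lookup C (i, j)) * x powi i * 1 powi j) * x powi N)"
        using x by (simp add: power_int_add case_prod_unfold)
    qed
    also have "\<dots> = laurent_eval C x 1 * x powi N"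
      by (simp add: laurent_eval_def K_def sum_distrib_right case_prod_unfold)
    finally show ?thesis using zero[OF x] by simp
  qed
  then have "UNIV - {0} \<subseteq> {x. poly p x = 0}" by auto
  moreover have "infinite (UNIV - {0 :: complex})" using infinite_UNIV_char_0 by simp
  ultimately have "p = 0" using poly_roots_finite[of p] finite_subset by blast
  then have "0 = coeff p (nat (i0 + N))" by simp
  also have "\<dots> = (\<Sum>k\<in>K. if k = (i0, j0) then of_int (Poly_Mapping.lookup C k) else 0)"
    unfolding p_def coeff_sum coeff_monom
  proof (rule sum.cong[OF refl])
    fix k assume k: "k \<in> K"
    have "snd k = 0" "j0 = 0" using C k k0 by (auto simp: t_free_def K_def)
    moreover have "nat (fst k + N) = nat (i0 + N) \<longleftrightarrow> fst k = i0"
      using N[of "fst k" "snd k"] N[of i0 j0] k k0 by (auto simp: K_def)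
    ultimately show "(if nat (fst k + N) = nat (i0 + N) then of_int (Poly_Mapping.lookup C k) else 0) =
        (if k = (i0, j0) then of_int (Poly_Mapping.lookup C k) else (0 :: complex))"
      by (auto simp: prod_eq_iff)
  qed
  also have "\<dots> = of_int (Poly_Mapping.lookup C (i0, j0))"
    using k0 finK by (simp add: K_def)
  finally show False using k0 by (simp add: in_keys_iff)
qed

lemma laurent_eval_holomorphic: "x \<noteq> 0 \<Longrightarrow> laurent_eval P x holomorphic_on - {0 :: complex}"
  unfolding laurent_eval_def case_prod_unfold by (intro holomorphic_intros) auto

lemma laurent_eval_differentiable:
  "x \<noteq> 0 \<Longrightarrow> laurent_eval P x field_differentiable (at (1 :: complex))"
  by (rule holomorphic_on_imp_differentiable_at[OF laurent_eval_holomorphic]) auto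

section \<open>From complex zeros to divisibility\<close>

definition special_values :: "complex set" where
  "special_values = {1, \<i>, - \<i>, exp (2 * \<i> * pi / 3), exp (- (2 * \<i> * pi / 3))}"

lemma exp_thirds:
  "exp (2 * \<i> * pi / 3) = Complex (- 1 / 2) (sqrt 3 / 2)"
  "exp (- (2 * \<i> * pi / 3)) = Complex (- 1 / 2) (- sqrt 3 / 2)"
proof -
  have 1: "2 * \<i> * pi / 3 = \<i> * of_real (2 * pi / 3)" by simp
  then have 2: "- (2 * \<i> * pi / 3) = \<i> * of_real (- (2 * pi / 3))" by simp
  show "exp (2 * \<i> * pi / 3) = Complex (- 1 / 2) (sqrt 3 / 2)"
    unfolding 1 by (simp only: cis_conv_exp[symmetric] complex_eq_iff cis.sel complex.sel cos_120 sin_120)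
  show "exp (- (2 * \<i> * pi / 3)) = Complex (- 1 / 2) (- sqrt 3 / 2)"
    unfolding 2 by (simp only: cis_conv_exp[symmetric] complex_eq_iff cis.sel complex.sel
        cos_minus sin_minus cos_120 sin_120) simp
qed

lemma card_special_values: "card special_values = 5"
  unfolding special_values_def exp_thirds by (simp add: complex_eq_iff card_insert_if)

lemma special_values_nonzero: "\<xi> \<in> special_values \<Longrightarrow> \<xi> \<noteq> 0"
  unfolding special_values_def by auto

lemma special_values_trace: "\<xi> \<in> special_values \<Longrightarrow> \<xi> + inverse \<xi> + 2 \<in> {1, 2, 4}"
  unfolding special_values_def
proof (elim insertE emptyE)
  let ?\<omega> = "exp (2 * \<i> * pi / 3)" and ?\<omega>' = "exp (- (2 * \<i> * pi / 3))"
  have "inverse ?\<omega> = ?\<omega>'" "inverse ?\<omega>' = ?\<omega>" by (simp_all add: exp_minus)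
  moreover have "?\<omega> + ?\<omega>' = - 1" unfolding exp_thirds by (simp add: complex_eq_iff)
  ultimately have "?\<omega> + inverse ?\<omega> + 2 = 1" "?\<omega>' + inverse ?\<omega>' + 2 = 1" by (simp_all add: add.commute)
  then show "\<xi> = ?\<omega> \<Longrightarrow> \<xi> + inverse \<xi> + 2 \<in> {1, 2, 4}" "\<xi> = ?\<omega>' \<Longrightarrow> \<xi> + inverse \<xi> + 2 \<in> {1, 2, 4}"
    by simp_all
qed auto

text \<open>Dividing with remainder keeps integer coefficients. For each \<open>x\<close> the
  remainder has degree at most 5 in \<open>t\<close>, but zeros at the five special values, the one
  at 1 being double; so it vanishes, and with it every coefficient.\<close>

lemma modulus_dvd:
  assumes zero: "\<And>x \<xi> :: complex. x \<noteq> 0 \<Longrightarrow> \<xi> \<in> special_values \<Longrightarrow> laurent_eval F x \<xi> = 0"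
    and deriv: "\<And>x :: complex. x \<noteq> 0 \<Longrightarrow> (laurent_eval F x has_field_derivative 0) (at 1)"
  shows "modulus dvd F"
proof -
  obtain Q C0 C1 C2 C3 C4 C5 where
    C: "C0 \<in> t_free" "C1 \<in> t_free" "C2 \<in> t_free" "C3 \<in> t_free" "C4 \<in> t_free" "C5 \<in> t_free"
    and F: "F = modulus * Q + (C0 + C1 * var_t + C2 * var_t ^ 2 + C3 * var_t ^ 3 + C4 * var_t ^ 4 + C5 * var_t ^ 5)"
    using divisible_with_remainder by (rule divisible_with_remainderE)
  let ?v = "\<lambda>C x :: complex. laurent_eval C x 1"
  have coeffs: "[:?v C0 x, ?v C1 x, ?v C2 x, ?v C3 x, ?v C4 x, ?v C5 x:] = 0" if x: "x \<noteq> 0" for x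
  proof -
    define R where "R = [:?v C0 x, ?v C1 x, ?v C2 x, ?v C3 x, ?v C4 x, ?v C5 x:]"
    define m :: "complex \<Rightarrow> complex" where "m y = (y - 1) ^ 2 * ((y ^ 2 + 1) * (y ^ 2 + y + 1))" for y
    have FR: "laurent_eval F x y = m y * laurent_eval Q x y + poly R y" if y: "y \<noteq> 0" for y
      unfolding F modulus_def m_def R_def
      using laurent_eval_t_free[OF C(1), of x y] laurent_eval_t_free[OF C(2), of x y]
        laurent_eval_t_free[OF C(3), of x y] laurent_eval_t_free[OF C(4), of x y]
        laurent_eval_t_free[OF C(5), of x y] laurent_eval_t_free[OF C(6), of x y]
      by (simp add: laurent_eval_add laurent_eval_diff laurent_eval_mult[OF x y] laurent_eval_power[OF x y])
        (simp add: algebra_simps eval_nat_numeral)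
    have m0: "m \<xi> = 0" if "\<xi> \<in> special_values" for \<xi>
    proof -
      have *: "Complex (- 1 / 2) (sqrt 3 / 2) ^ 2 + Complex (- 1 / 2) (sqrt 3 / 2) + 1 = 0"
        "Complex (- 1 / 2) (- sqrt 3 / 2) ^ 2 + Complex (- 1 / 2) (- sqrt 3 / 2) + 1 = 0"
        by (simp_all add: complex_eq_iff power2_eq_square)
      show ?thesis
        using that * unfolding special_values_def exp_thirds m_def by auto
    qed
    have R0: "poly R \<xi> = 0" if "\<xi> \<in> special_values" for \<xi>
      using zero[OF x that] FR[OF special_values_nonzero[OF that]] m0[OF that] by simp
    obtain q' where q': "(laurent_eval Q x has_field_derivative q') (at 1)"
      using laurent_eval_differentiable[OF x] by (auto simp: field_differentiable_def)
    \<comment> \<open>The double factor of the modulus at 1 passes the vanishing derivative of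
      \<open>F\<close> on to the remainder.\<close>
    have "(m has_field_derivative 0) (at 1)"
      unfolding m_def by (auto intro!: derivative_eq_intros)
    then have "((\<lambda>y. m y * laurent_eval Q x y) has_field_derivative 0 * laurent_eval Q x 1 + q' * m 1) (at 1)"
      using q' by (rule DERIV_mult)
    then have "((\<lambda>y. m y * laurent_eval Q x y) has_field_derivative 0) (at 1)" by (simp add: m_def)
    then have "((\<lambda>y. laurent_eval F x y - m y * laurent_eval Q x y) has_field_derivative 0 - 0) (at 1)"
      by (intro DERIV_diff deriv x)
    then have "(poly R has_field_derivative 0 - 0) (at 1)"
      by (rule has_field_derivative_transform_within_open[of _ _ _ "- {0}"]) (use FR in auto)
    then have R'0: "poly (pderiv R) 1 = 0"
      using DERIV_unique[OF poly_DERIV[of R 1]] by simp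
    have "R = 0"
    proof (rule ccontr)
      assume "R \<noteq> 0"
      have "poly R 1 = 0" by (rule R0) (simp add: special_values_def)
      then obtain R1 where R1: "R = [:- 1, 1:] * R1" by (auto simp: poly_eq_0_iff_dvd)
      then have "R1 \<noteq> 0" using \<open>R \<noteq> 0\<close> by auto
      \<comment> \<open>After division by \<open>t - 1\<close> all five values are still zeros,
        while the degree is at most 4.\<close>
      have "poly R1 1 = 0" using R'0 unfolding R1 pderiv_mult by (simp add: pderiv_pCons)
      then have "poly R1 \<xi> = 0" if "\<xi> \<in> special_values" for \<xi>
        using R0[OF that] unfolding R1 by (cases "\<xi> = 1") auto
      then have "special_values \<subseteq> {\<xi>. poly R1 \<xi> = 0}" by auto
      then have "5 \<le> card {\<xi>. poly R1 \<xi> = 0}"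
        using card_mono[OF poly_roots_finite[OF \<open>R1 \<noteq> 0\<close>]] card_special_values by metis
      also have "\<dots> \<le> degree R1" by (rule card_poly_roots_bound[OF \<open>R1 \<noteq> 0\<close>])
      also have "degree R = degree R1 + 1"
        unfolding R1 by (subst degree_mult_eq) (use \<open>R1 \<noteq> 0\<close> in auto)
      moreover have "degree R \<le> 5" unfolding R_def by (simp add: degree_pCons_eq_if)
      ultimately show False by simp
    qed
    then show ?thesis by (simp add: R_def)
  qed
  then have "C0 = 0" "C1 = 0" "C2 = 0" "C3 = 0" "C4 = 0" "C5 = 0"
    by (auto intro!: t_free_eq_0[OF C(1)] t_free_eq_0[OF C(2)] t_free_eq_0[OF C(3)] t_free_eq_0[OF C(4)]
        t_free_eq_0[OF C(5)] t_free_eq_0[OF C(6)] simp: pCons_eq_0_iff)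
  then show ?thesis unfolding F by simp
qed

section \<open>Special values of the W-polynomial\<close>

lemma loop_value_square:
  fixes A :: complex
  assumes "A ^ 4 * \<xi> = 1"
  shows "A \<noteq> 0" "(- (A powi 2) - A powi (- 2)) ^ 2 = \<xi> + inverse \<xi> + 2"
proof -
  show A: "A \<noteq> 0" using assms by auto
  have \<xi>: "inverse \<xi> = A ^ 4" "\<xi> = inverse (A ^ 4)"
    using assms by (metis inverse_unique mult.commute)+
  have "(- (A powi 2) - A powi (- 2)) ^ 2 = inverse (A ^ 4) + A ^ 4 + 2"
    using A by (simp add: power_int_minus field_simps eval_nat_numeral)
  also have "\<dots> = \<xi> + inverse \<xi> + 2" by (simp only: \<xi>(1) \<xi>(2)[symmetric])
  finally show "(- (A powi 2) - A powi (- 2)) ^ 2 = \<xi> + inverse \<xi> + 2" .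
qed

lemma ex_fourth_root: "\<exists>a :: complex. a ^ 4 = z"
proof
  have "csqrt (csqrt z) ^ 4 = ((csqrt (csqrt z)) ^ 2) ^ 2" by (simp only: power_mult[symmetric]) simp
  also have "\<dots> = z" by simp
  finally show "csqrt (csqrt z) ^ 4 = z" .
qed

text \<open>\<open>q\<close> stands for \<open>s^(1/2)\<close>. As \<open>W\<close> is a function of
  \<open>A\<close>, the derivative in \<open>t\<close> is taken along any branch of
  \<open>t^(-1/4)\<close> continuous at 1; the last part treats the invariant formally.\<close>

theorem proposition1p10:
  fixes D :: "'d axial_diagram" and Or :: "'d set" and n :: nat
  assumes "symmetric_union D" and "orientation D Or" and "n = components D"
  shows
    "(\<forall>\<xi> \<in> {1, \<i>, - \<i>, exp (2 * \<i> * pi / 3), exp (- (2 * \<i> * pi / 3))}.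
       \<forall>A B q :: complex. A ^ 4 * \<xi> = 1 \<longrightarrow> B ^ 2 * q = 1 \<longrightarrow>
         W D Or A B = (- q - inverse q) ^ (n - 1)) \<and>
     (\<forall>A B. A \<midarrow>1\<rightarrow> A 1 \<longrightarrow> (\<forall>\<^sub>F t in nhds (1::complex). A t ^ 4 * t = 1) \<longrightarrow> B \<noteq> 0 \<longrightarrow>
         ((\<lambda>t. W D Or (A t) B) has_field_derivative 0) (at 1)) \<and>
     (\<forall>P. W_laurent D Or P \<longrightarrow>
         (var_t - 1) ^ 2 * (var_t ^ 2 + 1) * (var_t ^ 2 + var_t + 1)
           dvd P - (- sqrt_s - inv_sqrt_s) ^ (n - 1))"
proof -
  obtain \<rho> where "symmetric_by D \<rho>" "\<forall>d\<in>link D. \<rho> d \<in> orbit (travel D) (edge D d)"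
    using assms(1) unfolding symmetric_union_def by blast
  then interpret reflected_union D \<rho> by unfold_locales auto
  note Or = assms(2)
  have eval: "W D Or A B = (- q - inverse q) ^ (n - 1)"
    if \<xi>: "\<xi> \<in> special_values" and A: "A ^ 4 * \<xi> = 1" and B: "B ^ 2 * q = 1" for \<xi> A B q :: complex
  proof -
    have B0: "B \<noteq> 0" using B by auto
    have "inverse q = B ^ 2" "q = inverse (B ^ 2)"
      using B by (metis inverse_unique mult.commute)+
    then have "- (B powi 2) - B powi (- 2) = - q - inverse q" by (simp add: power_int_minus)
    moreover have "(- (A powi 2) - A powi (- 2)) ^ 2 \<in> {1, 2, 4}"
      using loop_value_square(2)[OF A] special_values_trace[OF \<xi>] by simp
    ultimately show ?thesis
      using W_eval[OF Or loop_value_square(1)[OF A] B0] assms(3) by simp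
  qed
  have deriv: "((\<lambda>t. W D Or (A t) B) has_field_derivative 0) (at 1)"
    if "A \<midarrow>1\<rightarrow> A 1" and ev: "\<forall>\<^sub>F t in nhds (1::complex). A t ^ 4 * t = 1" and "B \<noteq> 0" for A B
  proof -
    have "A 1 ^ 4 = 1" using eventually_nhds_x_imp_x[OF ev] by simp
    from DERIV_chain2[where f = "\<lambda>a. W D Or a B", OF W_deriv_zero[OF Or \<open>B \<noteq> 0\<close> this]
        fourth_root_differentiable[OF that(1,2)]]
    show ?thesis by simp
  qed
  have dvd: "modulus dvd P - (- sqrt_s - inv_sqrt_s) ^ (n - 1)" if P: "W_laurent D Or P" for P
  proof (rule modulus_dvd)
    let ?F = "P - (- sqrt_s - inv_sqrt_s) ^ (n - 1)"
    fix x :: complex assume x: "x \<noteq> 0"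
    \<comment> \<open>\<open>x\<close> is the value of \<open>s^(1/2)\<close>, and
      \<open>B^2 = s^(-1/2)\<close>.\<close>
    define b where "b = csqrt (inverse x)"
    have b2: "b ^ 2 = inverse x" by (simp add: b_def)
    then have b: "b \<noteq> 0" using x by auto
    have bx: "b powi (- 2) = x" using b2 by (simp add: power_int_minus)
    have F: "laurent_eval ?F x y = laurent_eval P x y - (- x - inverse x) ^ (n - 1)" if "y \<noteq> 0" for y
      using laurent_eval_power[OF x that] by (simp add: laurent_eval_diff laurent_eval_uminus)
    have PW: "laurent_eval P x y = W D Or a b" if a: "a ^ 4 * y = 1" and y: "y \<noteq> - 1" for a y
    proof -
      have "a ^ 4 = inverse y" "y = inverse (a ^ 4)"
        using a by (metis inverse_unique mult.commute)+
      then have ay: "a powi (- 4) = y" by (simp add: power_int_minus)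
      \<comment> \<open>This is the square of the loop value, whose only zero is
        \<open>t = - 1\<close>; elsewhere the formal invariant specializes.\<close>
      have "y + inverse y + 2 \<noteq> 0"
      proof
        assume "y + inverse y + 2 = 0"
        moreover have "y \<noteq> 0" using a by auto
        ultimately have "(y + 1) ^ 2 = 0" by (simp add: field_simps power2_eq_square)
        then show False using y by (simp add: eq_neg_iff_add_eq_0)
      qed
      then have "- (a powi 2) - a powi (- 2) \<noteq> 0" using loop_value_square(2)[OF a] by auto
      from W_laurent_specialize[OF P loop_value_square(1)[OF a] b this]
      show ?thesis by (simp only: bx ay)
    qed
    show "laurent_eval ?F x \<xi> = 0" if \<xi>: "\<xi> \<in> special_values" for \<xi>
    proof -
      obtain a where "a ^ 4 = inverse \<xi>" using ex_fourth_root by blast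
      then have a: "a ^ 4 * \<xi> = 1" using special_values_nonzero[OF \<xi>] by simp
      have "\<xi> \<noteq> - 1" using special_values_trace[OF \<xi>] by auto
      then show ?thesis
        using PW[OF a] eval[OF \<xi> a, of b x] b2 x F[OF special_values_nonzero[OF \<xi>]] by simp
    qed
    obtain l where l: "(laurent_eval ?F x has_field_derivative l) (at 1)"
      using laurent_eval_differentiable[OF x] by (auto simp: field_differentiable_def)
    have der: "((\<lambda>y. laurent_eval ?F x (inverse y)) has_field_derivative l * (- 1)) (at 1)"
      by (rule DERIV_chain2[where f = "laurent_eval ?F x"])
        (use l DERIV_inverse[of "1 :: complex"] in simp_all)
    \<comment> \<open>Invariance under inversion of \<open>A\<close> is invariance under inversion
      of \<open>t\<close>, which has derivative \<open>- 1\<close> at its fixed point 1.\<close>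
    have inv: "laurent_eval ?F x (inverse y) = laurent_eval ?F x y" if "y \<in> - {0, - 1}" for y
    proof -
      obtain a where "a ^ 4 = inverse y" using ex_fourth_root by blast
      then have a: "a ^ 4 * y = 1" using that by simp
      then have a': "inverse a ^ 4 * inverse y = 1" by (metis inverse_1 inverse_mult_distrib power_inverse)
      have "inverse y \<noteq> - 1" using that by (metis ComplD inverse_inverse_eq inverse_minus_eq inverse_1 insertCI)
      then show ?thesis
        using PW[OF a] PW[OF a'] F[of y] F[of "inverse y"] that W_inverse[OF Or b, of a] by simp
    qed
    have "(laurent_eval ?F x has_field_derivative l * (- 1)) (at 1)"
    proof (rule has_field_derivative_transform_within_open[OF der])
      show "open (- {0, - 1 :: complex})" by (simp add: open_Compl)
      show "1 \<in> - {0, - 1 :: complex}" by simp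
      show "laurent_eval ?F x (inverse y) = laurent_eval ?F x y" if "y \<in> - {0, - 1}" for y
        by (rule inv[OF that])
    qed
    then have "l = l * (- 1)" by (rule DERIV_unique[OF l])
    then have "l = 0" by simp
    then show "(laurent_eval ?F x has_field_derivative 0) (at 1)" using l by (simp only:)
  qed
  have "\<forall>\<xi>\<in>special_values. \<forall>A B q. A ^ 4 * \<xi> = 1 \<longrightarrow> B ^ 2 * q = 1 \<longrightarrow>
      W D Or A B = (- q - inverse q) ^ (n - 1)"
    using eval by blast
  moreover have "\<forall>A B. A \<midarrow>1\<rightarrow> A 1 \<longrightarrow> (\<forall>\<^sub>F t in nhds (1::complex). A t ^ 4 * t = 1) \<longrightarrow> B \<noteq> 0 \<longrightarrow>
      ((\<lambda>t. W D Or (A t) B) has_field_derivative 0) (at 1)"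
    using deriv by blast
  moreover have "\<forall>P. W_laurent D Or P \<longrightarrow> modulus dvd P - (- sqrt_s - inv_sqrt_s) ^ (n - 1)"
    using dvd by blast
  ultimately show ?thesis
    unfolding special_values_def modulus_def by (intro conjI)
qed

end
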